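(* Suppose that $I\subset\mathbb{C}[z_1,\ldots,z_d]$ is a prime homogeneous ideal such that $Z(I)$ is a distinguished variety. Then the identity representation of $C^*([I]^\perp)$ is not a boundary representation for $\mathcal{B}(S_1,\ldots,S_d)$.
   Context: $d\ge3$ is an integer; $H^2(\mathbb{D}^d)$ is the Hardy space over the unit polydisc $\mathbb{D}^d$. $Z(I)\subset\mathbb{C}^d$ is the common zero set of $I$; a homogeneous variety $V$ (nonempty, $V\ne\{0\}$) is distinguished if $V\cap\partial\mathbb{D}^d\subset\mathbb{T}^d$. $[I]$ is the closure of $I$ in $H^2(\mathbb{D}^d)$ and $[I]^\perp$ its orthogonal complement. $S_i=P_{[I]^\perp}M_{z_i}|_{[I]^\perp}$, where $M_{z_i}$ is multiplication by $z_i$ and $P_{[I]^\perp}$ is the orthogonal projection onto $[I]^\perp$. $C^*([I]^\perp)$ is the $C^*$-algebra generated by the identity and $S_1,\ldots,S_d$; $\mathcal{B}(S_1,\ldots,S_d)$ is the norm-closed (non-selfadjoint) algebra generated by the identity and $S_1,\ldots,S_d$. For a unital operator algebra $\mathcal{A}$ generating the $C^*$-algebra $C^*(\mathcal{A})$, an irreducible representation $\pi$ of $C^*(\mathcal{A})$ is a boundary representation for $\mathcal{A}$ if $\pi$ is the only completely positive map on $C^*(\mathcal{A})$ extending $\pi|_{\mathcal{A}}$. *)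

theory Defs
  imports
    "HOL-Analysis.Analysis"
    "HOL-Algebra.Ideal"
    "HOL-Library.Poly_Mapping"
    "HOL-Library.Complex_Order"
begin

section \<open>Complex Hilbert spaces and their bounded operators\<close>

text \<open>The inner product is linear in its first argument.  The norm and the topology are those of
  the underlying real inner product, which is the real part of the complex one.\<close>

class complex_hilbert = real_inner + complete_space +
  fixes scaleC :: "complex \<Rightarrow> 'a \<Rightarrow> 'a"  (infixr \<open>*\<^sub>C\<close> 75)
    and cinner :: "'a \<Rightarrow> 'a \<Rightarrow> complex"
  assumes scaleC_add_right: "c *\<^sub>C (x + y) = c *\<^sub>C x + c *\<^sub>C y"
    and scaleC_add_left: "(b + c) *\<^sub>C x = b *\<^sub>C x + c *\<^sub>C x"
    and scaleC_scaleC: "b *\<^sub>C c *\<^sub>C x = (b * c) *\<^sub>C x"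
    and scaleC_of_real: "complex_of_real r *\<^sub>C x = r *\<^sub>R x"
    and cinner_commute: "cinner x y = cnj (cinner y x)"
    and cinner_add_left: "cinner (x + y) z = cinner x z + cinner y z"
    and cinner_scaleC_left: "cinner (c *\<^sub>C x) y = c * cinner x y"
    and Re_cinner: "Re (cinner x y) = inner x y"

text \<open>A closed complex subspace of a type of class \<^class>\<open>complex_hilbert\<close> is used as a Hilbert
  space in its own right.\<close>

definition closed_csubspace :: "'a::complex_hilbert set \<Rightarrow> bool" where
  "closed_csubspace K \<longleftrightarrow> closed K \<and> 0 \<in> K \<and> (\<forall>x\<in>K. \<forall>y\<in>K. x + y \<in> K) \<and> (\<forall>c. \<forall>x\<in>K. c *\<^sub>C x \<in> K)"

definition orth_compl :: "'a::complex_hilbert set \<Rightarrow> 'a set" where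
  "orth_compl M = {x. \<forall>y\<in>M. cinner x y = 0}"

definition orth_proj :: "'a::complex_hilbert set \<Rightarrow> 'a \<Rightarrow> 'a" where
  "orth_proj K x = (THE y. y \<in> K \<and> x - y \<in> orth_compl K)"

text \<open>\<open>bounded_ops K\<close> is the algebra of bounded operators on \<open>K\<close>.  Operators are functions
  with domain exactly \<open>K\<close> (undefined elsewhere), so that equality of operators on \<open>K\<close> is equality
  of functions.\<close>

definition bounded_ops :: "'a::complex_hilbert set \<Rightarrow> ('a \<Rightarrow> 'a) set" where
  "bounded_ops K = {T \<in> K \<rightarrow>\<^sub>E K.
     (\<forall>x\<in>K. \<forall>y\<in>K. T (x + y) = T x + T y) \<and>
     (\<forall>c. \<forall>x\<in>K. T (c *\<^sub>C x) = c *\<^sub>C T x) \<and>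
     (\<exists>B. \<forall>x\<in>K. norm (T x) \<le> B * norm x)}"

definition op_id :: "'a::complex_hilbert set \<Rightarrow> 'a \<Rightarrow> 'a" where
  "op_id K = (\<lambda>x\<in>K. x)"

definition op_add :: "'a::complex_hilbert set \<Rightarrow> ('a \<Rightarrow> 'a) \<Rightarrow> ('a \<Rightarrow> 'a) \<Rightarrow> 'a \<Rightarrow> 'a" where
  "op_add K S T = (\<lambda>x\<in>K. S x + T x)"

definition op_scale :: "'a::complex_hilbert set \<Rightarrow> complex \<Rightarrow> ('a \<Rightarrow> 'a) \<Rightarrow> 'a \<Rightarrow> 'a" where
  "op_scale K c T = (\<lambda>x\<in>K. c *\<^sub>C T x)"

definition op_mult :: "'a::complex_hilbert set \<Rightarrow> ('a \<Rightarrow> 'a) \<Rightarrow> ('a \<Rightarrow> 'a) \<Rightarrow> 'a \<Rightarrow> 'a" where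
  "op_mult K S T = (\<lambda>x\<in>K. S (T x))"

definition op_adj :: "'a::complex_hilbert set \<Rightarrow> ('a \<Rightarrow> 'a) \<Rightarrow> 'a \<Rightarrow> 'a" where
  "op_adj K T = (THE S. S \<in> bounded_ops K \<and> (\<forall>x\<in>K. \<forall>y\<in>K. cinner (T x) y = cinner x (S y)))"

definition compression :: "'a::complex_hilbert set \<Rightarrow> ('a \<Rightarrow> 'a) \<Rightarrow> 'a \<Rightarrow> 'a" where
  "compression K T = (\<lambda>x\<in>K. orth_proj K (T x))"


section \<open>Operator algebras and boundary representations\<close>

definition unital_subalgebra :: "'a::complex_hilbert set \<Rightarrow> ('a \<Rightarrow> 'a) set \<Rightarrow> bool" where
  "unital_subalgebra K A \<longleftrightarrow> A \<subseteq> bounded_ops K \<and> op_id K \<in> A \<and>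
     (\<forall>S\<in>A. \<forall>T\<in>A. op_add K S T \<in> A \<and> op_mult K S T \<in> A) \<and>
     (\<forall>c. \<forall>T\<in>A. op_scale K c T \<in> A)"

text \<open>The condition on \<open>S\<close> below says that the operator norm of \<open>S - T\<close> is at most \<open>e\<close>.\<close>

definition norm_closed :: "'a::complex_hilbert set \<Rightarrow> ('a \<Rightarrow> 'a) set \<Rightarrow> bool" where
  "norm_closed K A \<longleftrightarrow>
     (\<forall>T\<in>bounded_ops K. (\<forall>e>0. \<exists>S\<in>A. \<forall>x\<in>K. norm (S x - T x) \<le> e * norm x) \<longrightarrow> T \<in> A)"

definition generated_algebra :: "'a::complex_hilbert set \<Rightarrow> ('a \<Rightarrow> 'a) set \<Rightarrow> ('a \<Rightarrow> 'a) set" where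
  "generated_algebra K X = \<Inter>{A. unital_subalgebra K A \<and> norm_closed K A \<and> X \<subseteq> A}"

definition generated_cstar :: "'a::complex_hilbert set \<Rightarrow> ('a \<Rightarrow> 'a) set \<Rightarrow> ('a \<Rightarrow> 'a) set" where
  "generated_cstar K X =
     \<Inter>{A. unital_subalgebra K A \<and> norm_closed K A \<and> (\<forall>T\<in>A. op_adj K T \<in> A) \<and> X \<subseteq> A}"

definition linear_on_ops ::
  "'a::complex_hilbert set \<Rightarrow> ('a \<Rightarrow> 'a) set \<Rightarrow> 'b::complex_hilbert set \<Rightarrow>
   (('a \<Rightarrow> 'a) \<Rightarrow> 'b \<Rightarrow> 'b) \<Rightarrow> bool" where
  "linear_on_ops K C L \<phi> \<longleftrightarrow> (\<forall>T\<in>C. \<phi> T \<in> bounded_ops L) \<and>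
     (\<forall>S\<in>C. \<forall>T\<in>C. \<phi> (op_add K S T) = op_add L (\<phi> S) (\<phi> T)) \<and>
     (\<forall>c. \<forall>T\<in>C. \<phi> (op_scale K c T) = op_scale L c (\<phi> T))"

definition representation ::
  "'a::complex_hilbert set \<Rightarrow> ('a \<Rightarrow> 'a) set \<Rightarrow> 'b::complex_hilbert set \<Rightarrow>
   (('a \<Rightarrow> 'a) \<Rightarrow> 'b \<Rightarrow> 'b) \<Rightarrow> bool" where
  "representation K C L \<pi> \<longleftrightarrow> closed_csubspace L \<and> linear_on_ops K C L \<pi> \<and>
     \<pi> (op_id K) = op_id L \<and>
     (\<forall>S\<in>C. \<forall>T\<in>C. \<pi> (op_mult K S T) = op_mult L (\<pi> S) (\<pi> T)) \<and>
     (\<forall>T\<in>C. \<pi> (op_adj K T) = op_adj L (\<pi> T))"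

definition irreducible_representation ::
  "'a::complex_hilbert set \<Rightarrow> ('a \<Rightarrow> 'a) set \<Rightarrow> 'b::complex_hilbert set \<Rightarrow>
   (('a \<Rightarrow> 'a) \<Rightarrow> 'b \<Rightarrow> 'b) \<Rightarrow> bool" where
  "irreducible_representation K C L \<pi> \<longleftrightarrow> representation K C L \<pi> \<and> L \<noteq> {0} \<and>
     (\<forall>M. closed_csubspace M \<and> M \<subseteq> L \<and> (\<forall>T\<in>C. \<pi> T ` M \<subseteq> M) \<longrightarrow> M = {0} \<or> M = L)"

text \<open>An \<open>n \<times> n\<close> matrix of operators on \<open>K\<close> (indices below \<open>n\<close>) is positive if it is a positive
  operator on the direct sum of \<open>n\<close> copies of \<open>K\<close>.  For a \<open>C\<^sup>*\<close>-algebra of operators on \<open>K\<close> this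
  is positivity in the matrix algebra over it.  The order on \<^typ>\<open>complex\<close> is that of
  \<^theory>\<open>HOL-Library.Complex_Order\<close>: \<open>0 \<le> z\<close> means that \<open>z\<close> is real and nonnegative.\<close>

definition positive_matrix ::
  "'a::complex_hilbert set \<Rightarrow> nat \<Rightarrow> (nat \<Rightarrow> nat \<Rightarrow> 'a \<Rightarrow> 'a) \<Rightarrow> bool" where
  "positive_matrix K n T \<longleftrightarrow>
     (\<forall>h. (\<forall>i<n. h i \<in> K) \<longrightarrow> 0 \<le> (\<Sum>i<n. \<Sum>j<n. cinner (T i j (h j)) (h i)))"

definition completely_positive ::
  "'a::complex_hilbert set \<Rightarrow> ('a \<Rightarrow> 'a) set \<Rightarrow> 'b::complex_hilbert set \<Rightarrow>
   (('a \<Rightarrow> 'a) \<Rightarrow> 'b \<Rightarrow> 'b) \<Rightarrow> bool" where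
  "completely_positive K C L \<phi> \<longleftrightarrow> linear_on_ops K C L \<phi> \<and>
     (\<forall>n T. (\<forall>i<n. \<forall>j<n. T i j \<in> C) \<and> positive_matrix K n T \<longrightarrow>
        positive_matrix L n (\<lambda>i j. \<phi> (T i j)))"

text \<open>Here \<open>A\<close> is a unital algebra of operators on \<open>K\<close>, and \<open>\<pi>\<close> represents the \<open>C\<^sup>*\<close>-algebra
  generated by \<open>A\<close> on \<open>L\<close>.\<close>

definition boundary_representation ::
  "'a::complex_hilbert set \<Rightarrow> ('a \<Rightarrow> 'a) set \<Rightarrow> 'b::complex_hilbert set \<Rightarrow>
   (('a \<Rightarrow> 'a) \<Rightarrow> 'b \<Rightarrow> 'b) \<Rightarrow> bool" where
  "boundary_representation K A L \<pi> \<longleftrightarrow>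
     irreducible_representation K (generated_cstar K A) L \<pi> \<and>
     (\<forall>\<phi>. completely_positive K (generated_cstar K A) L \<phi> \<and> (\<forall>T\<in>A. \<phi> T = \<pi> T) \<longrightarrow>
        (\<forall>T\<in>generated_cstar K A. \<phi> T = \<pi> T))"

lemma generated_cstar_generated_algebra:
  "generated_cstar K (generated_algebra K X) = generated_cstar K X"
proof -
  have "generated_algebra K X \<subseteq> A \<longleftrightarrow> X \<subseteq> A" if "unital_subalgebra K A" "norm_closed K A" for A
    using that unfolding generated_algebra_def by blast
  then have "{A. unital_subalgebra K A \<and> norm_closed K A \<and> (\<forall>T\<in>A. op_adj K T \<in> A) \<and>
               generated_algebra K X \<subseteq> A} =
             {A. unital_subalgebra K A \<and> norm_closed K A \<and> (\<forall>T\<in>A. op_adj K T \<in> A) \<and> X \<subseteq> A}"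
    by blast
  then show ?thesis unfolding generated_cstar_def by argo
qed


section \<open>Polynomials, homogeneous ideals and distinguished varieties\<close>

text \<open>A multi-index is a map from the set \<open>'n\<close> of variables to \<^typ>\<open>nat\<close>, and a polynomial
  is a finitely supported map from multi-indices to coefficients, with the convolution product.\<close>

type_synonym 'n mindex = "'n \<Rightarrow>\<^sub>0 nat"
type_synonym 'n cpoly = "'n mindex \<Rightarrow>\<^sub>0 complex"

definition mindex_degree :: "'n::finite mindex \<Rightarrow> nat" where
  "mindex_degree \<alpha> = (\<Sum>i\<in>UNIV. Poly_Mapping.lookup \<alpha> i)"

definition zpow :: "complex ^ 'n::finite \<Rightarrow> 'n mindex \<Rightarrow> complex" where
  "zpow z \<alpha> = (\<Prod>i\<in>UNIV. (z $ i) ^ Poly_Mapping.lookup \<alpha> i)"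

definition poly_eval :: "'n::finite cpoly \<Rightarrow> complex ^ 'n \<Rightarrow> complex" where
  "poly_eval p z = (\<Sum>\<alpha>\<in>Poly_Mapping.keys p. Poly_Mapping.lookup p \<alpha> * zpow z \<alpha>)"

definition poly_ring :: "'n::finite cpoly ring" where
  "poly_ring = \<lparr>carrier = UNIV, monoid.mult = (*), one = 1, zero = 0, add = (+)\<rparr>"

lemma cring_poly_ring: "cring (poly_ring :: 'n::finite cpoly ring)"
  by unfold_locales
    (auto simp: poly_ring_def algebra_simps Units_def, metis add.commute add.right_inverse)

definition homogeneous_part :: "nat \<Rightarrow> 'n::finite cpoly \<Rightarrow> 'n cpoly" where
  "homogeneous_part k p =
     (\<Sum>\<alpha>\<in>{\<alpha> \<in> Poly_Mapping.keys p. mindex_degree \<alpha> = k}.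
        Poly_Mapping.single \<alpha> (Poly_Mapping.lookup p \<alpha>))"

definition homogeneous_ideal :: "'n::finite cpoly set \<Rightarrow> bool" where
  "homogeneous_ideal I \<longleftrightarrow> ideal I poly_ring \<and> (\<forall>p\<in>I. \<forall>k. homogeneous_part k p \<in> I)"

definition zero_locus :: "'n::finite cpoly set \<Rightarrow> (complex ^ 'n) set" where
  "zero_locus I = {z. \<forall>p\<in>I. poly_eval p z = 0}"

definition polydisc :: "(complex ^ 'n::finite) set" where
  "polydisc = {z. \<forall>i. norm (z $ i) < 1}"

definition torus :: "(complex ^ 'n::finite) set" where
  "torus = {z. \<forall>i. norm (z $ i) = 1}"

definition homogeneous_variety :: "(complex ^ 'n::finite) set \<Rightarrow> bool" where
  "homogeneous_variety V \<longleftrightarrow> (\<exists>I. homogeneous_ideal I \<and> V = zero_locus I)"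

definition distinguished_variety :: "(complex ^ 'n::finite) set \<Rightarrow> bool" where
  "distinguished_variety V \<longleftrightarrow> homogeneous_variety V \<and> V \<noteq> {} \<and> V \<noteq> {0} \<and>
     V \<inter> frontier polydisc \<subseteq> torus"


section \<open>The Hardy space over the polydisc\<close>

definition square_summable :: "('n::finite mindex \<Rightarrow> complex) \<Rightarrow> bool" where
  "square_summable a \<longleftrightarrow> (\<lambda>\<alpha>. (norm (a \<alpha>))\<^sup>2) summable_on UNIV"

definition hardy_expansion :: "(complex ^ 'n::finite \<Rightarrow> complex) \<Rightarrow> ('n mindex \<Rightarrow> complex) \<Rightarrow> bool" where
  "hardy_expansion f a \<longleftrightarrow> square_summable a \<and>
     (\<forall>z\<in>polydisc. ((\<lambda>\<alpha>. a \<alpha> * zpow z \<alpha>) has_sum f z) UNIV)"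

lemma digits_eq:
  fixes x y :: "nat \<Rightarrow> nat"
  assumes "\<And>i. i < d \<Longrightarrow> x i < N \<and> y i < N"
    and "(\<Sum>i<d. x i * N ^ i) = (\<Sum>i<d. y i * N ^ i)"
  shows "\<forall>i<d. x i = y i"
  using assms
proof (induction d)
  case (Suc d)
  have bd: "(\<Sum>i<d. w i * N ^ i) < N ^ d" if "\<And>i. i < d \<Longrightarrow> w i < N" for w :: "nat \<Rightarrow> nat"
    using that
  proof (induction d)
    case (Suc d)
    then have "(\<Sum>i<d. w i * N ^ i) < N ^ d" "w d + 1 \<le> N" by (auto simp: Suc_le_eq)
    then have "(\<Sum>i<Suc d. w i * N ^ i) < (w d + 1) * N ^ d" by simp
    also have "\<dots> \<le> N * N ^ d" using \<open>w d + 1 \<le> N\<close> by (rule mult_right_mono) simp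
    finally show ?case by simp
  qed simp
  have bx: "(\<Sum>i<d. x i * N ^ i) < N ^ d" and bY: "(\<Sum>i<d. y i * N ^ i) < N ^ d"
    using Suc.prems(1) by (auto intro!: bd)
  have e: "(\<Sum>i<d. x i * N ^ i) + x d * N ^ d = (\<Sum>i<d. y i * N ^ i) + y d * N ^ d"
    using Suc.prems(2) by simp
  have "N ^ d > 0" using bx by linarith
  then have dm: "(s + u * N ^ d) div N ^ d = u" if "s < N ^ d" for s u :: nat
    using that \<open>N ^ d > 0\<close> by (subst div_mult_self1) auto
  have "x d = ((\<Sum>i<d. x i * N ^ i) + x d * N ^ d) div N ^ d" by (rule dm[OF bx, symmetric])
  also have "\<dots> = y d" unfolding e by (rule dm[OF bY])
  finally have xy: "x d = y d" .
  have "(\<Sum>i<d. x i * N ^ i) = (\<Sum>i<d. y i * N ^ i)"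
    using e unfolding xy by (rule add_right_imp_eq)
  then have "\<forall>i<d. x i = y i" using Suc.IH Suc.prems(1) less_Suc_eq by metis
  with xy show ?case by (metis less_Suc_eq)
qed simp

lemma separating_weights:
  fixes \<beta> :: "'n::finite mindex"
  obtains w :: "'n \<Rightarrow> nat" where "\<And>i. w i \<ge> 1"
    and "\<And>\<alpha>. (\<Sum>i\<in>UNIV. w i * Poly_Mapping.lookup \<alpha> i) =
          (\<Sum>i\<in>UNIV. w i * Poly_Mapping.lookup \<beta> i) \<Longrightarrow> \<alpha> = \<beta>"
proof -
  define k where "k = mindex_degree \<beta>"
  define N where "N = k + 1"
  define d where "d = CARD('n)"
  define B where "B = k * N ^ d + 1"
  obtain e where e: "bij_betw e (UNIV :: 'n set) {..<d}"
    using ex_bij_betw_finite_nat[of "UNIV :: 'n set"] by (auto simp: d_def atLeast0LessThan)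
  have eb: "N ^ e i \<le> N ^ d" for i
  proof (rule power_increasing)
    have "e i < d" using e by (auto simp: bij_betw_def)
    then show "e i \<le> d" by simp
  qed (simp add: N_def)
  define w where "w i = B + N ^ e i" for i
  have wsum: "(\<Sum>i\<in>UNIV. w i * Poly_Mapping.lookup \<alpha> i) =
      B * mindex_degree \<alpha> + (\<Sum>i\<in>UNIV. Poly_Mapping.lookup \<alpha> i * N ^ e i)" for \<alpha>
    by (simp add: w_def mindex_degree_def sum_distrib_left sum.distrib algebra_simps)
  have up: "(\<Sum>i\<in>UNIV. Poly_Mapping.lookup \<alpha> i * N ^ e i) \<le> mindex_degree \<alpha> * N ^ d" for \<alpha>
    by (simp add: mindex_degree_def sum_distrib_right eb sum_mono)
  have lt: "B * mindex_degree \<alpha> + (\<Sum>i\<in>UNIV. Poly_Mapping.lookup \<alpha> i * N ^ e i)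
      < B * mindex_degree \<gamma> + (\<Sum>i\<in>UNIV. Poly_Mapping.lookup \<gamma> i * N ^ e i)"
    if "mindex_degree \<alpha> < mindex_degree \<gamma>" "mindex_degree \<alpha> \<le> k" for \<alpha> \<gamma>
  proof -
    have "(\<Sum>i\<in>UNIV. Poly_Mapping.lookup \<alpha> i * N ^ e i) \<le> k * N ^ d"
      using up[of \<alpha>] that(2) by (meson le_trans mult_right_mono zero_le)
    then have "(\<Sum>i\<in>UNIV. Poly_Mapping.lookup \<alpha> i * N ^ e i) < B" by (simp add: B_def)
    then have "B * mindex_degree \<alpha> + (\<Sum>i\<in>UNIV. Poly_Mapping.lookup \<alpha> i * N ^ e i)
        < B * (mindex_degree \<alpha> + 1)" by simp
    also have "\<dots> \<le> B * mindex_degree \<gamma>" using that(1) by (intro mult_left_mono) auto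
    finally show ?thesis by linarith
  qed
  show ?thesis
  proof (rule that[of w])
    show "w i \<ge> 1" for i by (simp add: w_def B_def)
    fix \<alpha> assume "(\<Sum>i\<in>UNIV. w i * Poly_Mapping.lookup \<alpha> i) = (\<Sum>i\<in>UNIV. w i * Poly_Mapping.lookup \<beta> i)"
    then have eq: "B * mindex_degree \<alpha> + (\<Sum>i\<in>UNIV. Poly_Mapping.lookup \<alpha> i * N ^ e i) =
       B * mindex_degree \<beta> + (\<Sum>i\<in>UNIV. Poly_Mapping.lookup \<beta> i * N ^ e i)"
      by (simp only: wsum)
    have deg: "mindex_degree \<alpha> = k"
    proof (rule ccontr)
      assume "mindex_degree \<alpha> \<noteq> k"
      then consider "mindex_degree \<alpha> < k" | "k < mindex_degree \<alpha>" by linarith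
      then show False
      proof cases
        case 1 then show False using lt[of \<alpha> \<beta>] eq by (simp add: k_def)
      next
        case 2 then show False using lt[of \<beta> \<alpha>] eq by (simp add: k_def)
      qed
    qed
    have small: "Poly_Mapping.lookup \<gamma> i < N" if "mindex_degree \<gamma> = k" for \<gamma> :: "'n mindex" and i
    proof -
      have "Poly_Mapping.lookup \<gamma> i \<le> mindex_degree \<gamma>"
        unfolding mindex_degree_def by (rule member_le_sum) auto
      then show ?thesis using that by (simp add: N_def)
    qed
    let ?g = "the_inv_into UNIV e"
    have re: "(\<Sum>i\<in>UNIV. Poly_Mapping.lookup \<gamma> i * N ^ e i) = (\<Sum>j<d. Poly_Mapping.lookup \<gamma> (?g j) * N ^ j)"
      for \<gamma> :: "'n mindex"
    proof -
      have "(\<Sum>j<d. Poly_Mapping.lookup \<gamma> (?g j) * N ^ j) =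
         (\<Sum>i\<in>UNIV. Poly_Mapping.lookup \<gamma> (?g (e i)) * N ^ e i)"
        by (rule sum.reindex_bij_betw[OF e, symmetric])
      then show ?thesis using e by (simp add: bij_betw_def the_inv_into_f_f)
    qed
    have "(\<Sum>j<d. Poly_Mapping.lookup \<alpha> (?g j) * N ^ j) = (\<Sum>j<d. Poly_Mapping.lookup \<beta> (?g j) * N ^ j)"
      using eq deg by (simp add: re k_def)
    then have *: "\<forall>j<d. Poly_Mapping.lookup \<alpha> (?g j) = Poly_Mapping.lookup \<beta> (?g j)"
      by (intro digits_eq[where N = N]) (auto intro!: small deg simp: k_def)
    show "\<alpha> = \<beta>"
    proof (rule poly_mapping_eqI)
      fix i
      have "e i < d" "?g (e i) = i" using e by (auto simp: bij_betw_def the_inv_into_f_f)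
      then show "Poly_Mapping.lookup \<alpha> i = Poly_Mapping.lookup \<beta> i" using * by metis
    qed
  qed
qed

lemma mindex_finite_le:
  fixes n :: nat
  shows "finite {\<alpha> :: 'n::finite mindex. \<forall>i. Poly_Mapping.lookup \<alpha> i \<le> n}"
proof -
  have "finite (Pi\<^sub>E UNIV (\<lambda>_::'n. {..n}))" by (intro finite_PiE) auto
  moreover have "Poly_Mapping.lookup ` {\<alpha> :: 'n mindex. \<forall>i. Poly_Mapping.lookup \<alpha> i \<le> n} \<subseteq> Pi\<^sub>E UNIV (\<lambda>_. {..n})"
    by auto
  ultimately show ?thesis
    by (intro finite_imageD[where f = Poly_Mapping.lookup] inj_onI)
      (auto intro: finite_subset poly_mapping_eqI)
qed

lemma power_series_zero:
  fixes a :: "'n::finite mindex \<Rightarrow> complex"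
  assumes a: "\<And>z. z \<in> polydisc \<Longrightarrow> ((\<lambda>\<alpha>. a \<alpha> * zpow z \<alpha>) has_sum 0) UNIV"
  shows "a \<beta> = 0"
proof -
  obtain w :: "'n \<Rightarrow> nat" where w1: "\<And>i. w i \<ge> 1"
    and w2: "\<And>\<alpha>. (\<Sum>i\<in>UNIV. w i * Poly_Mapping.lookup \<alpha> i) =
          (\<Sum>i\<in>UNIV. w i * Poly_Mapping.lookup \<beta> i) \<Longrightarrow> \<alpha> = \<beta>"
    using separating_weights by blast
  define W where "W \<alpha> = (\<Sum>i\<in>UNIV. w i * Poly_Mapping.lookup \<alpha> i)" for \<alpha> :: "'n mindex"
  define fib where "fib n = {\<alpha>. W \<alpha> = n}" for n
  have fin: "finite (fib n)" for n
  proof (rule finite_subset[OF _ mindex_finite_le[of n]], rule subsetI, rule CollectI, rule allI)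
    fix \<alpha> i assume "\<alpha> \<in> fib n"
    then have "W \<alpha> = n" by (simp add: fib_def)
    have "Poly_Mapping.lookup \<alpha> i \<le> w i * Poly_Mapping.lookup \<alpha> i" using w1[of i] by simp
    also have "\<dots> \<le> W \<alpha>" unfolding W_def by (rule member_le_sum) auto
    finally show "Poly_Mapping.lookup \<alpha> i \<le> n" using \<open>W \<alpha> = n\<close> by simp
  qed
  define c where "c n = (\<Sum>\<alpha>\<in>fib n. a \<alpha>)" for n
  have c_beta: "c (W \<beta>) = a \<beta>"
  proof -
    have "fib (W \<beta>) = {\<beta>}" using w2 by (auto simp: fib_def W_def)
    then show ?thesis by (simp add: c_def)
  qed
  have sums0: "(\<lambda>n. c n * t ^ n) sums 0" if "norm t < 1" for t :: complex
  proof -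
    let ?z = "(\<chi> i. t ^ w i) :: complex ^ 'n"
    have z: "?z \<in> polydisc"
      using that w1 by (auto simp: polydisc_def norm_power power_less_one_iff Suc_le_eq)
    have zp: "zpow ?z \<alpha> = t ^ W \<alpha>" for \<alpha>
      by (simp add: zpow_def W_def power_sum flip: power_mult)
    have "((\<lambda>\<alpha>. a \<alpha> * t ^ W \<alpha>) has_sum 0) UNIV" using a[OF z] by (simp add: zp)
    moreover have "bij_betw snd (Sigma UNIV fib) UNIV"
      by (rule bij_betwI[where g = "\<lambda>\<alpha>. (W \<alpha>, \<alpha>)"]) (auto simp: fib_def)
    ultimately have "((\<lambda>p. a (snd p) * t ^ W (snd p)) has_sum 0) (Sigma UNIV fib)"
      by (subst has_sum_reindex_bij_betw)
    then have "((\<lambda>n. \<Sum>\<alpha>\<in>fib n. a \<alpha> * t ^ W \<alpha>) has_sum 0) UNIV"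
    proof (rule has_sum_SigmaD)
      show "((\<lambda>y. a (snd (n, y)) * t ^ W (snd (n, y))) has_sum (\<Sum>\<alpha>\<in>fib n. a \<alpha> * t ^ W \<alpha>)) (fib n)" for n
        using fin by simp
    qed
    moreover have "(\<Sum>\<alpha>\<in>fib n. a \<alpha> * t ^ W \<alpha>) = c n * t ^ n" for n
      by (simp add: c_def fib_def sum_distrib_right)
    ultimately show ?thesis by (auto dest: has_sum_imp_sums)
  qed
  have "Abs_fps c = 0"
  proof (rule eval_fps_eqD)
    have "fps_conv_radius (Abs_fps c) \<ge> ereal (1/2)"
    proof -
      have "summable (\<lambda>n. c n * (1/2) ^ n)" using sums0[of "1/2"] by (simp add: sums_iff)
      then show ?thesis
        using conv_radius_geI[of c "1/2"] by (simp add: fps_conv_radius_def)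
    qed
    then show "fps_conv_radius (Abs_fps c) > 0"
      by (rule less_le_trans[rotated]) simp
    show "fps_conv_radius (0 :: complex fps) > 0" by simp
    have "\<forall>\<^sub>F z in nhds 0. z \<in> ball (0::complex) 1" by (intro eventually_nhds_in_open) auto
    then show "\<forall>\<^sub>F z in nhds 0. eval_fps (Abs_fps c) z = eval_fps 0 z"
      by eventually_elim (use sums0 in \<open>auto simp: eval_fps_def sums_iff\<close>)
  qed
  then have "c n = 0" for n by (metis fps_nth_Abs_fps fps_zero_nth)
  with c_beta show ?thesis by metis
qed

lemma square_summable_add:
  assumes "square_summable a" "square_summable b"
  shows "square_summable (\<lambda>\<alpha>. a \<alpha> + b \<alpha>)"
proof -
  have "(\<lambda>\<alpha>. 2 * (norm (a \<alpha>))\<^sup>2 + 2 * (norm (b \<alpha>))\<^sup>2) summable_on UNIV"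
    using assms by (intro summable_on_add summable_on_cmult_right) (auto simp: square_summable_def)
  moreover have "norm ((norm (a \<alpha> + b \<alpha>))\<^sup>2) \<le> 2 * (norm (a \<alpha>))\<^sup>2 + 2 * (norm (b \<alpha>))\<^sup>2" for \<alpha>
  proof -
    have "(norm (a \<alpha> + b \<alpha>))\<^sup>2 \<le> (norm (a \<alpha>) + norm (b \<alpha>))\<^sup>2"
      by (intro power_mono norm_triangle_ineq) simp
    also have "\<dots> \<le> 2 * (norm (a \<alpha>))\<^sup>2 + 2 * (norm (b \<alpha>))\<^sup>2"
      using sum_squares_bound[of "norm (a \<alpha>)" "norm (b \<alpha>)"] by (simp add: power2_sum)
    finally show ?thesis by simp
  qed
  ultimately have "(\<lambda>\<alpha>. norm ((norm (a \<alpha> + b \<alpha>))\<^sup>2)) summable_on UNIV"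
    by (intro Infinite_Sum.abs_summable_on_comparison_test')
  then show ?thesis by (simp add: square_summable_def)
qed

lemma square_summable_cmult:
  "square_summable a \<Longrightarrow> square_summable (\<lambda>\<alpha>. c * a \<alpha>)"
  by (auto simp: square_summable_def norm_mult power_mult_distrib intro: summable_on_cmult_right)

lemma square_summable_mult:
  assumes "square_summable a" "square_summable b"
  shows "(\<lambda>\<alpha>. norm (a \<alpha> * cnj (b \<alpha>))) summable_on UNIV" "(\<lambda>\<alpha>. norm (a \<alpha> * b \<alpha>)) summable_on UNIV"
proof -
  have s: "(\<lambda>\<alpha>. (norm (a \<alpha>))\<^sup>2 + (norm (b \<alpha>))\<^sup>2) summable_on UNIV"
    using assms by (intro summable_on_add) (auto simp: square_summable_def)
  have "norm (a \<alpha>) * norm (b \<alpha>) \<le> (norm (a \<alpha>))\<^sup>2 + (norm (b \<alpha>))\<^sup>2" for \<alpha>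
    using sum_squares_bound[of "norm (a \<alpha>)" "norm (b \<alpha>)"]
      mult_nonneg_nonneg[OF norm_ge_zero norm_ge_zero, of "a \<alpha>" "b \<alpha>"] by linarith
  then show "(\<lambda>\<alpha>. norm (a \<alpha> * cnj (b \<alpha>))) summable_on UNIV" "(\<lambda>\<alpha>. norm (a \<alpha> * b \<alpha>)) summable_on UNIV"
    by (intro Infinite_Sum.abs_summable_on_comparison_test'[OF s], simp add: norm_mult)+
qed

lemma square_summable_zpow:
  assumes "z \<in> polydisc"
  shows "square_summable (\<lambda>\<alpha>. zpow z \<alpha>)"
  unfolding square_summable_def
proof (rule nonneg_bdd_above_summable_on)
  let ?r = "\<lambda>i. (norm (z $ i))\<^sup>2"
  have r: "?r i < 1" for i using assms by (simp add: polydisc_def power_less_one_iff abs_square_less_1)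
  have sq: "(norm (zpow z \<alpha>))\<^sup>2 = (\<Prod>i\<in>UNIV. ?r i ^ Poly_Mapping.lookup \<alpha> i)" for \<alpha>
    by (simp add: zpow_def prod_norm[symmetric] norm_power prod_power_distrib power_commutes
        flip: power_mult) (simp add: mult.commute)
  show "bdd_above (sum (\<lambda>\<alpha>. (norm (zpow z \<alpha>))\<^sup>2) ` {F. F \<subseteq> UNIV \<and> finite F})"
  proof (rule bdd_aboveI2)
    fix F assume "F \<in> {F. F \<subseteq> (UNIV :: 'a mindex set) \<and> finite F}"
    then have F: "finite F" by simp
    define n where "n = Max (insert 0 ((\<lambda>(\<alpha>, i). Poly_Mapping.lookup \<alpha> i) ` (F \<times> UNIV)))"
    have n: "Poly_Mapping.lookup \<alpha> i \<le> n" if "\<alpha> \<in> F" for \<alpha> i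
      unfolding n_def using F that by (intro Max_ge) (auto intro!: image_eqI[where x = "(\<alpha>, i)"])
    have "(\<Sum>\<alpha>\<in>F. (norm (zpow z \<alpha>))\<^sup>2) = (\<Sum>g\<in>Poly_Mapping.lookup ` F. \<Prod>i\<in>UNIV. ?r i ^ g i)"
      by (subst sum.reindex) (auto simp: sq o_def inj_on_def intro: poly_mapping_eqI)
    also have "\<dots> \<le> (\<Sum>g\<in>Pi\<^sub>E UNIV (\<lambda>_. {..n}). \<Prod>i\<in>UNIV. ?r i ^ g i)"
      by (intro sum_mono2 finite_PiE prod_nonneg) (auto intro: n)
    also have "\<dots> = (\<Prod>i\<in>UNIV. \<Sum>k\<le>n. ?r i ^ k)" by (rule prod_sum_PiE[symmetric]) auto
    also have "\<dots> \<le> (\<Prod>i\<in>UNIV. 1 / (1 - ?r i))"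
    proof (intro prod_mono conjI sum_nonneg)
      fix i
      have "(\<Sum>k\<le>n. ?r i ^ k) \<le> suminf (\<lambda>k. ?r i ^ k)"
        using r[of i] by (intro sum_le_suminf summable_geometric) auto
      also have "\<dots> = 1 / (1 - ?r i)" using r[of i] by (intro suminf_geometric) auto
      finally show "(\<Sum>k\<le>n. ?r i ^ k) \<le> 1 / (1 - ?r i)" .
    qed auto
    finally show "(\<Sum>\<alpha>\<in>F. (norm (zpow z \<alpha>))\<^sup>2) \<le> (\<Prod>i\<in>UNIV. 1 / (1 - ?r i))" .
  qed
qed simp

lemma hardy_expansion_unique:
  assumes "hardy_expansion f a" "hardy_expansion f b"
  shows "a = b"
proof
  fix \<beta>
  have "(\<lambda>\<alpha>. a \<alpha> + (-1) * b \<alpha>) \<beta> = 0"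
  proof (rule power_series_zero)
    fix z :: "complex ^ 'a" assume "z \<in> polydisc"
    then have "((\<lambda>\<alpha>. a \<alpha> * zpow z \<alpha>) has_sum f z) UNIV" "((\<lambda>\<alpha>. b \<alpha> * zpow z \<alpha>) has_sum f z) UNIV"
      using assms by (auto simp: hardy_expansion_def)
    from has_sum_add[OF this(1) has_sum_cmult_right[OF this(2), of "- 1"]]
    show "((\<lambda>\<alpha>. (a \<alpha> + (-1) * b \<alpha>) * zpow z \<alpha>) has_sum 0) UNIV"
      by (simp add: algebra_simps)
  qed
  then show "a \<beta> = b \<beta>" by simp
qed

lemma hardy_expansion_infsum:
  assumes "square_summable a"
  shows "hardy_expansion (\<lambda>z. if z \<in> polydisc then \<Sum>\<^sub>\<infinity>\<alpha>. a \<alpha> * zpow z \<alpha> else 0) a"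
  unfolding hardy_expansion_def
proof (intro conjI ballI)
  fix z :: "complex ^ 'a" assume z: "z \<in> polydisc"
  have "(\<lambda>\<alpha>. a \<alpha> * zpow z \<alpha>) summable_on UNIV"
    by (rule abs_summable_summable[OF square_summable_mult(2)[OF assms square_summable_zpow[OF z]]])
  then show "((\<lambda>\<alpha>. a \<alpha> * zpow z \<alpha>) has_sum
      (if z \<in> polydisc then \<Sum>\<^sub>\<infinity>\<alpha>. a \<alpha> * zpow z \<alpha> else 0)) UNIV"
    using z by simp
qed (fact assms)

lemma hardy_expansion_add:
  "hardy_expansion f a \<Longrightarrow> hardy_expansion g b \<Longrightarrow>
   hardy_expansion (\<lambda>z. f z + g z) (\<lambda>\<alpha>. a \<alpha> + b \<alpha>)"
  by (auto simp: hardy_expansion_def algebra_simps intro: square_summable_add has_sum_add)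

lemma hardy_expansion_cmult:
  "hardy_expansion f a \<Longrightarrow> hardy_expansion (\<lambda>z. c * f z) (\<lambda>\<alpha>. c * a \<alpha>)"
  by (auto simp: hardy_expansion_def mult.assoc intro: square_summable_cmult has_sum_cmult_right)

lemma hardy_expansion_zero: "hardy_expansion (\<lambda>z. 0) (\<lambda>\<alpha>. 0)"
  by (simp add: hardy_expansion_def square_summable_def)

lemma hardy_expansion_coordinate:
  fixes f :: "complex ^ 'n::finite \<Rightarrow> complex"
  assumes "hardy_expansion f a"
  shows "hardy_expansion (\<lambda>z. z $ i * f z)
    (\<lambda>\<alpha>. if Poly_Mapping.lookup \<alpha> i = 0 then 0 else a (\<alpha> - Poly_Mapping.single i 1))"
    (is "hardy_expansion _ ?b")
proof -
  let ?s = "\<lambda>\<alpha> :: 'n mindex. \<alpha> + Poly_Mapping.single i 1"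
  have inj: "inj ?s" by (simp add: inj_def)
  have ran: "\<alpha> \<in> range ?s" if "Poly_Mapping.lookup \<alpha> i \<noteq> 0" for \<alpha>
  proof -
    have "\<alpha> = ?s (\<alpha> - Poly_Mapping.single i 1)"
      using that by (intro poly_mapping_eqI) (auto simp: lookup_add lookup_minus lookup_single when_def)
    then show ?thesis by blast
  qed
  have b_s: "?b (?s \<alpha>) = a \<alpha>" for \<alpha> by (simp add: lookup_add)
  have "((\<lambda>\<alpha>. (norm (a \<alpha>))\<^sup>2) has_sum x) UNIV \<longleftrightarrow> ((\<lambda>\<alpha>. (norm (?b \<alpha>))\<^sup>2) has_sum x) UNIV" for x
  proof -
    have "((\<lambda>\<alpha>. (norm (?b \<alpha>))\<^sup>2) has_sum x) UNIV \<longleftrightarrow> ((\<lambda>\<alpha>. (norm (?b \<alpha>))\<^sup>2) has_sum x) (range ?s)"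
      by (rule has_sum_cong_neutral) (use ran in auto)
    then show ?thesis by (simp only: has_sum_reindex[OF inj] o_def b_s)
  qed
  then have "square_summable ?b"
    using assms by (auto simp: hardy_expansion_def square_summable_def summable_on_def)
  moreover have "((\<lambda>\<alpha>. ?b \<alpha> * zpow z \<alpha>) has_sum (z $ i * f z)) UNIV" if "z \<in> polydisc" for z
  proof -
    have zs: "zpow z (?s \<alpha>) = z $ i * zpow z \<alpha>" for \<alpha>
    proof -
      have "(\<Prod>j\<in>UNIV. z $ j ^ Poly_Mapping.lookup (Poly_Mapping.single i (1::nat)) j) = z $ i"
        by (subst prod.mono_neutral_right[of _ "{i}"]) (auto simp: lookup_single when_def)
      then show ?thesis by (simp add: zpow_def lookup_add power_add prod.distrib)
    qed
    have "((\<lambda>\<alpha>. z $ i * (a \<alpha> * zpow z \<alpha>)) has_sum (z $ i * f z)) UNIV"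
      using assms that by (intro has_sum_cmult_right) (auto simp: hardy_expansion_def)
    then have "((\<lambda>\<alpha>. ?b \<alpha> * zpow z \<alpha>) has_sum (z $ i * f z)) (range ?s)"
      by (simp only: has_sum_reindex[OF inj] o_def b_s zs mult.left_commute)
    moreover have "((\<lambda>\<alpha>. ?b \<alpha> * zpow z \<alpha>) has_sum (z $ i * f z)) UNIV \<longleftrightarrow>
       ((\<lambda>\<alpha>. ?b \<alpha> * zpow z \<alpha>) has_sum (z $ i * f z)) (range ?s)"
      by (rule has_sum_cong_neutral) (use ran in auto)
    ultimately show ?thesis by blast
  qed
  ultimately show ?thesis by (simp add: hardy_expansion_def)
qed

lemma hardy_expansion_poly:
  "hardy_expansion (poly_eval p) (Poly_Mapping.lookup p)"
  unfolding hardy_expansion_def square_summable_def summable_on_def poly_eval_def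
  by (auto intro!: exI has_sum_finite_neutralI[of "Poly_Mapping.keys p"] simp: in_keys_iff)

text \<open>The Hardy space consists of the functions on the polydisc whose power series has
  square-summable coefficients.  A function on the polydisc is represented by its extension by
  zero.\<close>

typedef 'n hardy =
  "{f :: complex ^ 'n::finite \<Rightarrow> complex. (\<forall>z. z \<notin> polydisc \<longrightarrow> f z = 0) \<and> (\<exists>a. hardy_expansion f a)}"
  morphisms hardy_fun Abs_hardy
  by (rule exI[of _ "\<lambda>z. 0"], rule CollectI, intro conjI exI) (simp, rule hardy_expansion_zero)

setup_lifting type_definition_hardy

definition taylor :: "'n::finite hardy \<Rightarrow> 'n mindex \<Rightarrow> complex" where
  "taylor f = (THE a. hardy_expansion (hardy_fun f) a)"

lemma hardy_expansion_taylor: "hardy_expansion (hardy_fun f) (taylor f)"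
proof -
  obtain a where "hardy_expansion (hardy_fun f) a" using hardy_fun[of f] by blast
  then have "\<exists>!a. hardy_expansion (hardy_fun f) a" using hardy_expansion_unique by blast
  then show ?thesis unfolding taylor_def by (rule theI')
qed

lemma taylor_eqI: "hardy_expansion (hardy_fun f) a \<Longrightarrow> taylor f = a"
  by (rule hardy_expansion_unique[OF hardy_expansion_taylor])

lemma square_summable_taylor: "square_summable (taylor f)"
  using hardy_expansion_taylor by (auto simp: hardy_expansion_def)

lemma hardy_eqI:
  assumes "taylor f = taylor g"
  shows "f = g"
proof -
  have "hardy_fun f z = hardy_fun g z" for z
  proof (cases "z \<in> polydisc")
    case True
    then show ?thesis
      using hardy_expansion_taylor[of f] hardy_expansion_taylor[of g] assms
      unfolding hardy_expansion_def by (metis has_sum_unique)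
  next
    case False
    then show ?thesis using hardy_fun[of f] hardy_fun[of g] by simp
  qed
  then show ?thesis by (metis ext hardy_fun_inject)
qed

lemma hardy_of_coefficients:
  assumes "square_summable a"
  obtains f where "taylor f = a"
proof -
  let ?F = "\<lambda>z. if z \<in> polydisc then \<Sum>\<^sub>\<infinity>\<alpha>. a \<alpha> * zpow z \<alpha> else 0"
  have "hardy_fun (Abs_hardy ?F) = ?F"
    by (rule Abs_hardy_inverse) (use hardy_expansion_infsum[OF assms] in auto)
  then have "taylor (Abs_hardy ?F) = a"
    using hardy_expansion_infsum[OF assms] by (intro taylor_eqI) simp
  then show ?thesis using that by blast
qed

lift_definition hardy_scale :: "complex \<Rightarrow> 'n::finite hardy \<Rightarrow> 'n hardy" is "\<lambda>c f z. c * f z"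
  using hardy_expansion_cmult by fastforce

definition hardy_inner :: "'n::finite hardy \<Rightarrow> 'n hardy \<Rightarrow> complex" where
  "hardy_inner f g = (\<Sum>\<^sub>\<infinity>\<alpha>. taylor f \<alpha> * cnj (taylor g \<alpha>))"

instantiation hardy :: (finite) real_inner
begin

lift_definition zero_hardy :: "'a hardy" is "\<lambda>z. 0"
  using hardy_expansion_zero by blast

lift_definition plus_hardy :: "'a hardy \<Rightarrow> 'a hardy \<Rightarrow> 'a hardy" is "\<lambda>f g z. f z + g z"
  using hardy_expansion_add by fastforce

definition uminus_hardy :: "'a hardy \<Rightarrow> 'a hardy" where
  "uminus_hardy f = hardy_scale (-1) f"

definition minus_hardy :: "'a hardy \<Rightarrow> 'a hardy \<Rightarrow> 'a hardy" where
  "minus_hardy f g = f + - g"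

definition scaleR_hardy :: "real \<Rightarrow> 'a hardy \<Rightarrow> 'a hardy" where
  "scaleR_hardy r f = hardy_scale (complex_of_real r) f"

definition inner_hardy :: "'a hardy \<Rightarrow> 'a hardy \<Rightarrow> real" where
  "inner_hardy f g = Re (hardy_inner f g)"

definition norm_hardy :: "'a hardy \<Rightarrow> real" where
  "norm_hardy f = sqrt (inner f f)"

definition sgn_hardy :: "'a hardy \<Rightarrow> 'a hardy" where
  "sgn_hardy f = inverse (norm f) *\<^sub>R f"

definition dist_hardy :: "'a hardy \<Rightarrow> 'a hardy \<Rightarrow> real" where
  "dist_hardy f g = norm (f - g)"

definition uniformity_hardy :: "('a hardy \<times> 'a hardy) filter" where
  "uniformity_hardy = (INF e\<in>{0<..}. principal {(f, g). dist f g < e})"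

definition open_hardy :: "'a hardy set \<Rightarrow> bool" where
  "open_hardy U \<longleftrightarrow> (\<forall>f\<in>U. \<forall>\<^sub>F (f', g) in uniformity. f' = f \<longrightarrow> g \<in> U)"

lemma taylor_zero: "taylor (0 :: 'a hardy) = (\<lambda>\<alpha>. 0)"
  by (rule taylor_eqI) (simp add: zero_hardy.rep_eq hardy_expansion_zero)

lemma taylor_add: "taylor (f + g :: 'a hardy) = (\<lambda>\<alpha>. taylor f \<alpha> + taylor g \<alpha>)"
  by (rule taylor_eqI) (simp add: plus_hardy.rep_eq hardy_expansion_add hardy_expansion_taylor)

lemma taylor_scaleC: "taylor (hardy_scale c f :: 'a hardy) = (\<lambda>\<alpha>. c * taylor f \<alpha>)"
  by (rule taylor_eqI) (simp add: hardy_scale.rep_eq hardy_expansion_cmult hardy_expansion_taylor)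

lemma taylor_diff: "taylor (f - g :: 'a hardy) = (\<lambda>\<alpha>. taylor f \<alpha> - taylor g \<alpha>)"
  by (simp add: minus_hardy_def uminus_hardy_def taylor_add taylor_scaleC)

lemma cinner_summable: "(\<lambda>\<alpha>. taylor f \<alpha> * cnj (taylor g \<alpha>)) summable_on UNIV" for f g :: "'a hardy"
  by (rule abs_summable_summable[OF square_summable_mult(1)[OF square_summable_taylor square_summable_taylor]])

lemma inner_hardy_self: "inner f f = (\<Sum>\<^sub>\<infinity>\<alpha>. (norm (taylor f \<alpha>))\<^sup>2)" for f :: "'a hardy"
proof -
  have "inner f f = (\<Sum>\<^sub>\<infinity>\<alpha>. Re (taylor f \<alpha> * cnj (taylor f \<alpha>)))"
    unfolding inner_hardy_def hardy_inner_def by (rule infsum_Re[OF cinner_summable, symmetric])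
  then show ?thesis by (simp add: complex_norm_square[symmetric] flip: of_real_power)
qed

lemma hardy_commute: "hardy_inner f g = cnj (hardy_inner g f)" for f g :: "'a hardy"
  by (simp add: hardy_inner_def mult.commute flip: infsum_cnj)

lemma hardy_cinner_add: "hardy_inner (f + g) h = hardy_inner f h + hardy_inner g h" for f g h :: "'a hardy"
  unfolding hardy_inner_def taylor_add distrib_right by (intro infsum_add cinner_summable)

lemma hardy_cinner_scaleC: "hardy_inner (hardy_scale c f) g = c * hardy_inner f g" for f g :: "'a hardy"
  by (simp add: hardy_inner_def taylor_scaleC mult.assoc infsum_cmult_right')

lemma taylor_le_norm: "norm (taylor f \<alpha>) \<le> norm f" for f :: "'a hardy"
proof -
  have "(\<Sum>\<alpha>\<in>{\<alpha>}. (norm (taylor f \<alpha>))\<^sup>2) \<le> (\<Sum>\<^sub>\<infinity>\<alpha>. (norm (taylor f \<alpha>))\<^sup>2)"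
    using square_summable_taylor[of f] by (intro finite_sum_le_infsum) (auto simp: square_summable_def)
  then show ?thesis by (simp add: norm_hardy_def inner_hardy_self real_le_rsqrt)
qed

instance
proof
  fix f g h :: "'a hardy" and r s :: real and U :: "'a hardy set"
  show "f + g + h = f + (g + h)" "f + g = g + f" "0 + f = f"
    by (rule hardy_eqI, simp add: taylor_add taylor_zero algebra_simps)+
  show "- f + f = 0" by (rule hardy_eqI) (simp add: uminus_hardy_def taylor_add taylor_zero taylor_scaleC)
  show "f - g = f + - g" by (simp add: minus_hardy_def)
  show "r *\<^sub>R (f + g) = r *\<^sub>R f + r *\<^sub>R g" "(r + s) *\<^sub>R f = r *\<^sub>R f + s *\<^sub>R f"
    "r *\<^sub>R s *\<^sub>R f = (r * s) *\<^sub>R f" "1 *\<^sub>R f = f"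
    by (rule hardy_eqI, simp add: scaleR_hardy_def taylor_add taylor_scaleC algebra_simps)+
  show "sgn f = inverse (norm f) *\<^sub>R f" by (fact sgn_hardy_def)
  show "dist f g = norm (f - g)" by (fact dist_hardy_def)
  show "uniformity = (INF e\<in>{0<..}. principal {(f, g :: 'a hardy). dist f g < e})" by (fact uniformity_hardy_def)
  show "open U \<longleftrightarrow> (\<forall>f\<in>U. \<forall>\<^sub>F (f', g) in uniformity. f' = f \<longrightarrow> g \<in> U)" by (fact open_hardy_def)
  show "inner f g = inner g f" unfolding inner_hardy_def by (subst hardy_commute) simp
  show "inner (f + g) h = inner f h + inner g h" by (simp add: inner_hardy_def hardy_cinner_add)
  show "inner (r *\<^sub>R f) g = r * inner f g" by (simp add: inner_hardy_def scaleR_hardy_def hardy_cinner_scaleC)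
  show ge: "0 \<le> inner f f" unfolding inner_hardy_self by (rule infsum_nonneg) simp
  show "norm f = sqrt (inner f f)" by (fact norm_hardy_def)
  show "inner f f = 0 \<longleftrightarrow> f = 0"
  proof
    assume "inner f f = 0"
    then have "norm f = 0" by (simp add: norm_hardy_def)
    then have "taylor f \<alpha> = 0" for \<alpha> using taylor_le_norm[of f \<alpha>] by simp
    then show "f = 0" by (intro hardy_eqI ext) (simp add: taylor_zero)
  qed (simp add: inner_hardy_self taylor_zero)
qed

end

instance hardy :: (finite) complete_space
proof
  fix X :: "nat \<Rightarrow> 'a hardy"
  assume "Cauchy X"
  have dist_taylor: "norm (taylor f \<alpha> - taylor g \<alpha>) \<le> dist f g" for f g :: "'a hardy" and \<alpha>
    using taylor_le_norm[of "f - g" \<alpha>] by (simp add: taylor_diff dist_hardy_def)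
  have "Cauchy (\<lambda>n. taylor (X n) \<alpha>)" for \<alpha>
  proof (rule metric_CauchyI)
    fix e :: real assume "e > 0"
    then obtain M where "\<forall>m\<ge>M. \<forall>n\<ge>M. dist (X m) (X n) < e"
      using \<open>Cauchy X\<close> unfolding Cauchy_def by blast
    then show "\<exists>M. \<forall>m\<ge>M. \<forall>n\<ge>M. dist (taylor (X m) \<alpha>) (taylor (X n) \<alpha>) < e"
      unfolding dist_complex_def using dist_taylor le_less_trans by blast
  qed
  then have "\<exists>a. \<forall>\<alpha>. (\<lambda>n. taylor (X n) \<alpha>) \<longlonglongrightarrow> a \<alpha>"
    by (meson Cauchy_convergent convergent_def)
  then obtain a where a: "\<And>\<alpha>. (\<lambda>n. taylor (X n) \<alpha>) \<longlonglongrightarrow> a \<alpha>" by blast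
  have tail: "\<exists>M. \<forall>m\<ge>M. \<forall>F. finite F \<longrightarrow> (\<Sum>\<alpha>\<in>F. (norm (taylor (X m) \<alpha> - a \<alpha>))\<^sup>2) \<le> e\<^sup>2" if "e > 0" for e :: real
  proof -
    obtain M where M: "\<And>m n. m \<ge> M \<Longrightarrow> n \<ge> M \<Longrightarrow> dist (X m) (X n) < e"
      using \<open>Cauchy X\<close> \<open>e > 0\<close> unfolding Cauchy_def by blast
    have "(\<Sum>\<alpha>\<in>F. (norm (taylor (X m) \<alpha> - a \<alpha>))\<^sup>2) \<le> e\<^sup>2" if "m \<ge> M" "finite F" for m F
    proof (rule LIMSEQ_le_const2)
      show "(\<lambda>n. \<Sum>\<alpha>\<in>F. (norm (taylor (X m) \<alpha> - taylor (X n) \<alpha>))\<^sup>2) \<longlonglongrightarrow> (\<Sum>\<alpha>\<in>F. (norm (taylor (X m) \<alpha> - a \<alpha>))\<^sup>2)"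
        by (intro tendsto_intros a)
      have "(\<Sum>\<alpha>\<in>F. (norm (taylor (X m) \<alpha> - taylor (X n) \<alpha>))\<^sup>2) \<le> e\<^sup>2" if "n \<ge> M" for n
      proof -
        let ?g = "X m - X n"
        have "(\<Sum>\<alpha>\<in>F. (norm (taylor ?g \<alpha>))\<^sup>2) \<le> inner ?g ?g"
          unfolding inner_hardy_self using square_summable_taylor[of ?g] \<open>finite F\<close>
          by (intro finite_sum_le_infsum) (auto simp: square_summable_def)
        moreover have "sqrt (inner ?g ?g) < e"
          using M[OF \<open>m \<ge> M\<close> \<open>n \<ge> M\<close>] by (simp add: dist_hardy_def norm_hardy_def)
        then have "inner ?g ?g \<le> e\<^sup>2" using \<open>e > 0\<close> by (metis less_imp_le real_sqrt_le_iff real_sqrt_unique)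
        ultimately show ?thesis by (simp add: taylor_diff)
      qed
      then show "\<exists>N. \<forall>n\<ge>N. (\<Sum>\<alpha>\<in>F. (norm (taylor (X m) \<alpha> - taylor (X n) \<alpha>))\<^sup>2) \<le> e\<^sup>2" by blast
    qed
    then show ?thesis by blast
  qed
  have "square_summable a"
  proof -
    obtain M where M: "\<And>F. finite F \<Longrightarrow> (\<Sum>\<alpha>\<in>F. (norm (taylor (X M) \<alpha> - a \<alpha>))\<^sup>2) \<le> 1\<^sup>2"
      using tail[of 1] by auto
    have "square_summable (\<lambda>\<alpha>. taylor (X M) \<alpha> - a \<alpha>)"
      unfolding square_summable_def
      by (rule nonneg_bdd_above_summable_on) (auto intro!: bdd_aboveI2[of _ _ "1\<^sup>2"] M simp del: one_power2)
    from square_summable_add[OF square_summable_taylor[of "X M"] square_summable_cmult[OF this, of "-1"]]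
    show ?thesis by simp
  qed
  then obtain f :: "'a hardy" where f: "taylor f = a" by (rule hardy_of_coefficients)
  have "\<exists>M. \<forall>m\<ge>M. dist (X m) f < e" if "e > 0" for e
  proof -
    obtain M where M: "\<And>m F. m \<ge> M \<Longrightarrow> finite F \<Longrightarrow> (\<Sum>\<alpha>\<in>F. (norm (taylor (X m) \<alpha> - a \<alpha>))\<^sup>2) \<le> (e/2)\<^sup>2"
      using tail[of "e/2"] \<open>e > 0\<close> by auto
    have "dist (X m) f < e" if "m \<ge> M" for m
    proof -
      have "inner (X m - f) (X m - f) \<le> (e/2)\<^sup>2"
        unfolding inner_hardy_self using square_summable_taylor[of "X m - f"] M[OF that]
        by (intro infsum_le_finite_sums) (auto simp: square_summable_def taylor_diff f)
      then have "dist (X m) f \<le> e/2" using \<open>e > 0\<close> 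
        unfolding dist_hardy_def norm_hardy_def by (intro real_le_lsqrt) auto
      then show ?thesis using \<open>e > 0\<close> by simp
    qed
    then show ?thesis by blast
  qed
  then have "X \<longlonglongrightarrow> f" by (simp add: LIMSEQ_def)
  then show "convergent X" by (auto simp: convergent_def)
qed

instantiation hardy :: (finite) complex_hilbert
begin

definition scaleC_hardy :: "complex \<Rightarrow> 'a hardy \<Rightarrow> 'a hardy" where
  "scaleC_hardy = hardy_scale"

definition cinner_hardy :: "'a hardy \<Rightarrow> 'a hardy \<Rightarrow> complex" where
  "cinner_hardy = hardy_inner"

instance
proof
  fix f g h :: "'a hardy" and r :: real and b c :: complex
  show "c *\<^sub>C (f + g) = c *\<^sub>C f + c *\<^sub>C g" "(b + c) *\<^sub>C f = b *\<^sub>C f + c *\<^sub>C f"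
    "b *\<^sub>C c *\<^sub>C f = (b * c) *\<^sub>C f"
    unfolding scaleC_hardy_def
    by (rule hardy_eqI, simp add: taylor_add taylor_scaleC algebra_simps)+
  show "complex_of_real r *\<^sub>C f = r *\<^sub>R f" by (simp add: scaleC_hardy_def scaleR_hardy_def)
  show "cinner f g = cnj (cinner g f)" unfolding cinner_hardy_def by (fact hardy_commute)
  show "cinner (f + g) h = cinner f h + cinner g h" unfolding cinner_hardy_def by (fact hardy_cinner_add)
  show "cinner (c *\<^sub>C f) g = c * cinner f g"
    unfolding cinner_hardy_def scaleC_hardy_def by (fact hardy_cinner_scaleC)
  show "Re (cinner f g) = inner f g" by (simp add: inner_hardy_def cinner_hardy_def)
qed

end

lift_definition coordinate_mult :: "'n::finite \<Rightarrow> 'n hardy \<Rightarrow> 'n hardy" is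
  "\<lambda>i f z. z $ i * f z"
  using hardy_expansion_coordinate by fastforce

lift_definition poly_hardy :: "'n::finite cpoly \<Rightarrow> 'n hardy" is
  "\<lambda>p z. if z \<in> polydisc then poly_eval p z else 0"
proof (intro conjI allI impI)
  fix p :: "'n cpoly"
  have "hardy_expansion (\<lambda>z. if z \<in> polydisc then poly_eval p z else 0) (Poly_Mapping.lookup p)"
    using hardy_expansion_poly[of p] by (simp add: hardy_expansion_def)
  then show "\<exists>a. hardy_expansion (\<lambda>z. if z \<in> polydisc then poly_eval p z else 0) a" by blast
qed simp


section \<open>The quotient module of an ideal\<close>

definition hardy_submodule :: "'n::finite cpoly set \<Rightarrow> 'n hardy set" where
  "hardy_submodule I = closure (poly_hardy ` I)"

definition quotient_module :: "'n::finite cpoly set \<Rightarrow> 'n hardy set" where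
  "quotient_module I = orth_compl (hardy_submodule I)"

definition compressed_shift :: "'n::finite cpoly set \<Rightarrow> 'n \<Rightarrow> 'n hardy \<Rightarrow> 'n hardy" where
  "compressed_shift I i = compression (quotient_module I) (coordinate_mult i)"

definition quotient_cstar :: "'n::finite cpoly set \<Rightarrow> ('n hardy \<Rightarrow> 'n hardy) set" where
  "quotient_cstar I = generated_cstar (quotient_module I) (range (compressed_shift I))"

definition quotient_algebra :: "'n::finite cpoly set \<Rightarrow> ('n hardy \<Rightarrow> 'n hardy) set" where
  "quotient_algebra I = generated_algebra (quotient_module I) (range (compressed_shift I))"

lemma generated_cstar_quotient_algebra:
  "generated_cstar (quotient_module I) (quotient_algebra I) = quotient_cstar I"
  by (simp add: quotient_algebra_def quotient_cstar_def generated_cstar_generated_algebra)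

end

theory Submission
  imports Defs "HOL-Computational_Algebra.Fundamental_Theorem_Algebra"
begin

text \<open>By homogeneity, a distinguished variety \<open>V\<close> contains only points all of
  whose coordinates have the same modulus.  So a quotient of two coordinates is a unimodular
  function on \<open>V \ {0}\<close>; if \<open>V\<close> is irreducible, it must be constant.  Hence \<open>V\<close> is a line \<open>\<complex>c\<close>
  with \<open>\<bar>c\<^sub>i\<bar> = 1\<close> for all \<open>i\<close>, and the prime ideal \<open>I\<close> is the ideal of this line
  (\<open>prime_distinguished_ideal\<close>).  The algebra behind this is a cardinality argument: polynomials
  have countable dimension over the uncountable field \<open>\<complex>\<close>, so uncountably many congruences
  \<open>b ^ N \<equiv> s * (a - x b)\<close> modulo a prime ideal force \<open>b\<close> or some \<open>a - r b\<close> into the ideal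
  (\<open>uncountably_many_congruences\<close>).  It is used once to prove the Nullstellensatz and once for two
  coordinates \<open>a\<close>, \<open>b\<close>.

  Let \<open>N\<^sub>k\<close> be the number of monomials of degree \<open>k\<close>.  The ideal of the line determines the quotient
  module: it has the orthonormal basis
  \<open>e\<^sub>k = N\<^sub>k\<^bsup>-1/2\<^esup> \<Sum>\<^bsub>\<bar>\<alpha>\<bar> = k\<^esub> cnj (c\<^sup>\<alpha>) z\<^sup>\<alpha>\<close>, and
  \<open>S\<^sub>i = c\<^sub>i S\<close> for the weighted shift \<open>S e\<^sub>k = (N\<^sub>k / N\<^bsub>k+1\<^esub>)\<^bsup>1/2\<^esup> e\<^bsub>k+1\<^esub>\<close>, whose weights tend to
  \<open>1\<close> while the first one is smaller than \<open>1\<close>.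

  For such a shift the identity representation has another completely positive extension (locale
  \<open>weighted_shift\<close>).  Push a bounded operator \<open>T\<close> to infinity along the basis: the limits of
  \<open>\<langle>T e\<^bsub>k+n\<^esub>, e\<^bsub>l+n\<^esub>\<rangle>\<close> along an ultrafilter form a Toeplitz matrix, and this is a completely
  positive operation.  Then multiply entrywise by the positive semidefinite matrix
  \<open>min N\<^sub>k N\<^sub>l / (N\<^sub>k N\<^sub>l)\<^bsup>1/2\<^esup>\<close>.  The resulting map \<open>\<phi>\<close> is completely positive.  It fixes every operator
  that commutes with \<open>S\<close>, hence the whole algebra generated by the \<open>S\<^sub>i\<close>: the matrix of such an operator
  is a lower triangular Toeplitz matrix times exactly these factors.  But \<open>\<phi>\<close> moves \<open>S\<^sup>* S\<close>, since the
  first diagonal entry \<open>N\<^sub>0 / N\<^sub>1 < 1\<close> is replaced by \<open>lim N\<^sub>n / N\<^bsub>n+1\<^esub> = 1\<close>.\<close>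

section \<open>Operators on a Hilbert space with an orthonormal basis\<close>

lemma cinner_add_right: "cinner x (y + z) = cinner x y + cinner x z"
  by (subst (1 2 3) cinner_commute) (simp add: cinner_add_left)

lemma cinner_scaleC_right: "cinner x (c *\<^sub>C y) = cnj c * cinner x y"
  by (subst (1 2) cinner_commute) (simp add: cinner_scaleC_left)

lemma cinner_self: "cinner x x = of_real ((norm x)\<^sup>2)"
proof (rule complex_eqI)
  show "Re (cinner x x) = Re (of_real ((norm x)\<^sup>2))"
    by (simp add: Re_cinner power2_norm_eq_inner)
  have "Im (cinner x x) = - Im (cinner x x)"
    by (subst cinner_commute) simp
  then show "Im (cinner x x) = Im (of_real ((norm x)\<^sup>2))" by simp
qed

lemma norm_scaleC: "norm (c *\<^sub>C x) = norm c * norm x"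
proof -
  have "of_real ((norm (c *\<^sub>C x))\<^sup>2) = (c * cnj c) * of_real ((norm x)\<^sup>2)"
    by (simp only: cinner_self[symmetric] cinner_scaleC_left cinner_scaleC_right mult_ac)
  also have "\<dots> = of_real ((norm c * norm x)\<^sup>2)"
    unfolding complex_norm_square[symmetric] by (simp add: power_mult_distrib)
  finally have "of_real ((norm (c *\<^sub>C x))\<^sup>2) = (of_real ((norm c * norm x)\<^sup>2) :: complex)" .
  then show ?thesis by (metis of_real_eq_iff norm_ge_zero mult_nonneg_nonneg power2_eq_iff_nonneg)
qed

lemma scaleC_minus_one: "(-1) *\<^sub>C x = - x"
  using scaleC_of_real[of "-1" x] by simp

text \<open>Rotating \<open>x\<close> by the phase of \<open>cinner x y\<close> makes the inner product real, which reduces the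
  claim to the real Cauchy-Schwarz inequality.\<close>
lemma cinner_Cauchy_Schwarz: "norm (cinner x y) \<le> norm x * norm y"
proof (cases "cinner x y = 0")
  case False
  define u where "u = cnj (sgn (cinner x y))"
  have u: "norm u = 1" using False by (simp add: u_def norm_sgn)
  have "cinner (u *\<^sub>C x) y = of_real (norm (cinner x y))"
    unfolding cinner_scaleC_left u_def using False
    by (simp add: sgn_eq complex_norm_square[symmetric] power2_eq_square mult.commute)
  then have "norm (cinner x y) = inner (u *\<^sub>C x) y" by (metis Re_cinner Re_complex_of_real)
  also have "\<dots> \<le> norm (u *\<^sub>C x) * norm y" by (rule norm_cauchy_schwarz)
  finally show ?thesis by (simp add: norm_scaleC u)
qed simp

lemma bounded_bilinear_cinner: "bounded_bilinear (cinner :: 'a::complex_hilbert \<Rightarrow> 'a \<Rightarrow> complex)"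
proof
  show "cinner (r *\<^sub>R x) y = r *\<^sub>R cinner x y" for r and x y :: 'a
    by (simp add: scaleC_of_real[symmetric] cinner_scaleC_left scaleR_conv_of_real)
  show "cinner x (r *\<^sub>R y) = r *\<^sub>R cinner x y" for r and x y :: 'a
    by (simp add: scaleC_of_real[symmetric] cinner_scaleC_right scaleR_conv_of_real)
  show "\<exists>K. \<forall>x y :: 'a. norm (cinner x y) \<le> norm x * norm y * K"
    by (rule exI[of _ 1]) (simp add: cinner_Cauchy_Schwarz)
qed (rule cinner_add_left, rule cinner_add_right)

lemma bounded_bilinear_scaleC: "bounded_bilinear (scaleC :: complex \<Rightarrow> 'a::complex_hilbert \<Rightarrow> 'a)"
proof
  show "(r *\<^sub>R c) *\<^sub>C x = r *\<^sub>R (c *\<^sub>C x)" for r c and x :: 'a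
    by (simp add: scaleC_of_real[symmetric] scaleC_scaleC scaleR_conv_of_real)
  show "c *\<^sub>C (r *\<^sub>R x) = r *\<^sub>R (c *\<^sub>C x)" for r c and x :: 'a
    by (simp add: scaleC_of_real[symmetric] scaleC_scaleC mult.commute)
  show "\<exists>K. \<forall>c (x :: 'a). norm (c *\<^sub>C x) \<le> norm c * norm x * K"
    by (rule exI[of _ 1]) (simp add: norm_scaleC)
qed (rule scaleC_add_left, rule scaleC_add_right)

lemmas cinner_zero_left [simp] = bounded_bilinear.zero_left[OF bounded_bilinear_cinner]
lemmas cinner_zero_right [simp] = bounded_bilinear.zero_right[OF bounded_bilinear_cinner]
lemmas cinner_diff_left = bounded_bilinear.diff_left[OF bounded_bilinear_cinner]
lemmas cinner_sum_left = bounded_bilinear.sum_left[OF bounded_bilinear_cinner]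
lemmas cinner_sum_right = bounded_bilinear.sum_right[OF bounded_bilinear_cinner]
lemmas tendsto_cinner = bounded_bilinear.tendsto[OF bounded_bilinear_cinner]
lemmas scaleC_zero_left [simp] = bounded_bilinear.zero_left[OF bounded_bilinear_scaleC]
lemmas scaleC_zero_right [simp] = bounded_bilinear.zero_right[OF bounded_bilinear_scaleC]
lemmas scaleC_sum_right = bounded_bilinear.sum_right[OF bounded_bilinear_scaleC]

lemma cinner_self_eq_0_iff: "cinner x x = 0 \<longleftrightarrow> x = 0"
  by (simp add: cinner_self)

lemma csubspaceD:
  assumes "closed_csubspace K"
  shows "closed K" "0 \<in> K" "x \<in> K \<Longrightarrow> y \<in> K \<Longrightarrow> x + y \<in> K" "x \<in> K \<Longrightarrow> c *\<^sub>C x \<in> K"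
    and "x \<in> K \<Longrightarrow> y \<in> K \<Longrightarrow> x - y \<in> K"
    and "(\<And>i. i \<in> A \<Longrightarrow> f i \<in> K) \<Longrightarrow> sum f A \<in> K"
proof -
  show *: "closed K" "0 \<in> K" "x \<in> K \<Longrightarrow> y \<in> K \<Longrightarrow> x + y \<in> K" "x \<in> K \<Longrightarrow> c *\<^sub>C x \<in> K" for x y c
    using assms by (auto simp: closed_csubspace_def)
  show "x \<in> K \<Longrightarrow> y \<in> K \<Longrightarrow> x - y \<in> K" for x y
    using *(3)[of x "- y"] *(4)[of y "-1"] by (simp add: scaleC_minus_one)
  show "(\<And>i. i \<in> A \<Longrightarrow> f i \<in> K) \<Longrightarrow> sum f A \<in> K"
    by (induction A rule: infinite_finite_induct) (auto intro: *)
qed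

lemma closed_csubspace_orth_compl: "closed_csubspace (orth_compl M)"
proof -
  have "closed ((\<lambda>x. cinner x y) -` {0})" for y :: 'a
    by (intro closed_vimage continuous_intros
          bounded_linear.continuous_on[OF bounded_bilinear.bounded_linear_left[OF bounded_bilinear_cinner]])
  then have "closed (\<Inter>y\<in>M. (\<lambda>x. cinner x y) -` {0})" by blast
  also have "(\<Inter>y\<in>M. (\<lambda>x. cinner x y) -` {0}) = orth_compl M"
    by (auto simp: orth_compl_def)
  finally show ?thesis
    by (auto simp: closed_csubspace_def orth_compl_def cinner_add_left cinner_scaleC_left)
qed

lemma bounded_opsD:
  assumes "T \<in> bounded_ops K"
  shows "x \<in> K \<Longrightarrow> T x \<in> K" "x \<in> K \<Longrightarrow> y \<in> K \<Longrightarrow> T (x + y) = T x + T y"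
    "x \<in> K \<Longrightarrow> T (c *\<^sub>C x) = c *\<^sub>C T x"
  using assms by (auto simp: bounded_ops_def)

lemma bounded_ops_bound:
  assumes "T \<in> bounded_ops K"
  obtains B where "B \<ge> 0" "\<And>x. x \<in> K \<Longrightarrow> norm (T x) \<le> B * norm x"
proof -
  obtain B where B: "\<And>x. x \<in> K \<Longrightarrow> norm (T x) \<le> B * norm x"
    using assms unfolding bounded_ops_def by blast
  have "norm (T x) \<le> max B 0 * norm x" if "x \<in> K" for x
    using B[OF that] by (rule order_trans) (intro mult_right_mono, auto)
  then show ?thesis using that[of "max B 0"] by auto
qed

lemma bounded_ops_sum:
  assumes "closed_csubspace K" "T \<in> bounded_ops K" "\<And>i. i \<in> A \<Longrightarrow> f i \<in> K"
  shows "T (sum f A) = (\<Sum>i\<in>A. T (f i))"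
proof -
  have 0: "T 0 = 0"
    using bounded_opsD(3)[OF assms(2) csubspaceD(2)[OF assms(1)], of 0] by simp
  show ?thesis
    using assms(3)
    by (induction A rule: infinite_finite_induct)
      (auto simp: 0 bounded_opsD(2)[OF assms(2)] csubspaceD(6)[OF assms(1)])
qed

lemma bounded_ops_eqI:
  assumes "S \<in> bounded_ops K" "T \<in> bounded_ops K" "\<And>x. x \<in> K \<Longrightarrow> S x = T x"
  shows "S = T"
  using assms by (intro PiE_ext[of S K "\<lambda>_. K" T]) (auto simp: bounded_ops_def)

lemma op_id_bounded: "closed_csubspace K \<Longrightarrow> op_id K \<in> bounded_ops K"
  by (auto simp: bounded_ops_def op_id_def csubspaceD intro: exI[of _ 1])

lemma op_add_bounded:
  assumes K: "closed_csubspace K" and S: "S \<in> bounded_ops K" and T: "T \<in> bounded_ops K"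
  shows "op_add K S T \<in> bounded_ops K"
proof -
  obtain B C where B: "\<And>x. x \<in> K \<Longrightarrow> norm (S x) \<le> B * norm x"
    and C: "\<And>x. x \<in> K \<Longrightarrow> norm (T x) \<le> C * norm x"
    using bounded_ops_bound[OF S] bounded_ops_bound[OF T] by metis
  have "norm (S x + T x) \<le> (B + C) * norm x" if "x \<in> K" for x
    using B[OF that] C[OF that] norm_triangle_ineq[of "S x" "T x"] by (simp add: algebra_simps)
  then show ?thesis
    using K bounded_opsD[OF S] bounded_opsD[OF T]
    by (auto simp: bounded_ops_def op_add_def csubspaceD scaleC_add_right add_ac intro!: exI[of _ "B + C"])
qed

lemma op_scale_bounded:
  assumes K: "closed_csubspace K" and T: "T \<in> bounded_ops K"
  shows "op_scale K c T \<in> bounded_ops K"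
proof -
  obtain C where C: "\<And>x. x \<in> K \<Longrightarrow> norm (T x) \<le> C * norm x"
    using bounded_ops_bound[OF T] by metis
  have "norm (c *\<^sub>C T x) \<le> (norm c * C) * norm x" if "x \<in> K" for x
    using mult_left_mono[OF C[OF that] norm_ge_zero[of c]] by (simp add: norm_scaleC)
  then show ?thesis
    using K bounded_opsD[OF T]
    by (auto simp: bounded_ops_def op_scale_def csubspaceD scaleC_add_right scaleC_scaleC mult.commute
        intro!: exI[of _ "norm c * C"])
qed

lemma op_mult_bounded:
  assumes K: "closed_csubspace K" and S: "S \<in> bounded_ops K" and T: "T \<in> bounded_ops K"
  shows "op_mult K S T \<in> bounded_ops K"
proof -
  obtain B C where B: "B \<ge> 0" "\<And>x. x \<in> K \<Longrightarrow> norm (S x) \<le> B * norm x"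
    and C: "\<And>x. x \<in> K \<Longrightarrow> norm (T x) \<le> C * norm x"
    using bounded_ops_bound[OF S] bounded_ops_bound[OF T] by metis
  have "norm (S (T x)) \<le> (B * C) * norm x" if "x \<in> K" for x
  proof -
    have "norm (S (T x)) \<le> B * norm (T x)" by (intro B bounded_opsD[OF T] that)
    also have "\<dots> \<le> B * (C * norm x)" using C[OF that] B(1) by (rule mult_left_mono)
    finally show ?thesis by simp
  qed
  then show ?thesis
    using K bounded_opsD[OF S] bounded_opsD[OF T]
    by (auto simp: bounded_ops_def op_mult_def csubspaceD)
qed

text \<open>Totality is stated as the absence of nonzero vectors in \<open>K\<close> orthogonal to the basis; the
  expansion of vectors of \<open>K\<close> follows from it.  Countable bases suffice here and turn projections,
  adjoints and operators given by sesquilinear forms into statements about coefficients.\<close>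
locale orthonormal_basis =
  fixes K :: "'a::complex_hilbert set" and e :: "nat \<Rightarrow> 'a"
  assumes K: "closed_csubspace K" and e_mem: "e k \<in> K"
    and orthonormal: "cinner (e j) (e k) = (if j = k then 1 else 0)"
    and total: "x \<in> K \<Longrightarrow> (\<And>k. cinner x (e k) = 0) \<Longrightarrow> x = 0"
begin

lemma eqI: "x \<in> K \<Longrightarrow> y \<in> K \<Longrightarrow> (\<And>k. cinner x (e k) = cinner y (e k)) \<Longrightarrow> x = y"
  using total[of "x - y"] csubspaceD(5)[OF K] by (simp add: cinner_diff_left)

lemma cinner_comb:
  assumes "finite A"
  shows "cinner (\<Sum>k\<in>A. a k *\<^sub>C e k) (e m) = (if m \<in> A then a m else 0)"
  using assms by (simp add: cinner_sum_left cinner_scaleC_left orthonormal if_distrib sum.delta cong: if_cong)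

lemma norm_comb:
  assumes "finite A"
  shows "(norm (\<Sum>k\<in>A. a k *\<^sub>C e k))\<^sup>2 = (\<Sum>k\<in>A. (norm (a k))\<^sup>2)"
proof -
  let ?s = "\<Sum>k\<in>A. a k *\<^sub>C e k"
  have "cinner ?s ?s = (\<Sum>k\<in>A. cnj (a k) * cinner ?s (e k))"
    by (simp only: cinner_sum_right[of ?s] cinner_scaleC_right)
  also have "\<dots> = (\<Sum>k\<in>A. of_real ((norm (a k))\<^sup>2))"
    using assms by (intro sum.cong) (simp_all add: cinner_comb complex_norm_square mult.commute del: of_real_power)
  finally show ?thesis by (simp add: cinner_self flip: of_real_sum of_real_power)
qed

lemma comb_mem: "(\<Sum>k\<in>A. a k *\<^sub>C e k) \<in> K"
  by (intro csubspaceD[OF K] e_mem)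

text \<open>Stated for all vectors of the ambient space: the coefficients of a vector outside \<open>K\<close> are
  those of its projection to \<open>K\<close>, which is how the projection is found in \<open>orth_proj\<close>.\<close>
lemma bessel:
  assumes "finite A"
  shows "(\<Sum>k\<in>A. (norm (cinner x (e k)))\<^sup>2) \<le> (norm x)\<^sup>2"
proof -
  let ?y = "\<Sum>k\<in>A. cinner x (e k) *\<^sub>C e k"
  have "cinner x ?y = of_real (\<Sum>k\<in>A. (norm (cinner x (e k)))\<^sup>2)"
    by (simp add: cinner_sum_right cinner_scaleC_right mult.commute flip: complex_norm_square)
  then have "norm (cinner x ?y) = (norm ?y)\<^sup>2"
    using assms by (simp only: norm_comb norm_of_real abs_of_nonneg sum_nonneg zero_le_power2)
  then have "norm ?y * norm ?y \<le> norm x * norm ?y"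
    using cinner_Cauchy_Schwarz[of x ?y] by (simp add: power2_eq_square)
  then have "norm ?y \<le> norm x"
    by (cases "norm ?y = 0") (simp_all add: mult_le_cancel_right)
  then have "(norm ?y)\<^sup>2 \<le> (norm x)\<^sup>2" by (intro power_mono) auto
  then show ?thesis using assms by (simp only: norm_comb)
qed

lemma riesz_fischer:
  assumes "\<And>n. (\<Sum>k<n. (norm (a k))\<^sup>2) \<le> C"
  shows "\<exists>x\<in>K. (\<lambda>n. \<Sum>k<n. a k *\<^sub>C e k) \<longlonglongrightarrow> x \<and> (\<forall>k. cinner x (e k) = a k)"
proof -
  let ?s = "\<lambda>n. \<Sum>k<n. a k *\<^sub>C e k"
  have sm: "summable (\<lambda>k. (norm (a k))\<^sup>2)"
  proof (rule bounded_imp_summable)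
    show "(\<Sum>k\<le>n. (norm (a k))\<^sup>2) \<le> C" for n
      using assms[of "Suc n"] by (simp add: lessThan_Suc_atMost)
  qed simp
  have "Cauchy ?s"
  proof (rule CauchyI')
    fix \<epsilon> :: real assume "\<epsilon> > 0"
    then have "\<epsilon>\<^sup>2 > 0" by simp
    then obtain M where M: "\<And>m n. m \<ge> M \<Longrightarrow> norm (\<Sum>k=m..<n. (norm (a k))\<^sup>2) < \<epsilon>\<^sup>2"
      using sm unfolding summable_Cauchy by blast
    have "dist (?s m) (?s n) < \<epsilon>" if "m \<ge> M" "n > m" for m n
    proof -
      have "?s n - ?s m = (\<Sum>k\<in>{m..<n}. a k *\<^sub>C e k)"
        using that(2) by (simp add: sum_diff_nat_ivl[of 0 m n, symmetric] atLeast0LessThan)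
      then have "(norm (?s n - ?s m))\<^sup>2 < \<epsilon>\<^sup>2"
        using M[OF that(1), of n] by (simp add: norm_comb sum_nonneg)
      then show ?thesis
        using \<open>\<epsilon> > 0\<close> power2_less_imp_less[of "norm (?s n - ?s m)" \<epsilon>] by (simp add: dist_norm norm_minus_commute)
    qed
    then show "\<exists>M. \<forall>m\<ge>M. \<forall>n>m. dist (?s m) (?s n) < \<epsilon>" by blast
  qed
  then obtain x where x: "?s \<longlonglongrightarrow> x" using Cauchy_convergent convergent_def by blast
  have "x \<in> K" using closed_sequentially[OF csubspaceD(1)[OF K] _ x] comb_mem by blast
  moreover have "cinner x (e k) = a k" for k
  proof (rule LIMSEQ_unique)
    show "(\<lambda>n. cinner (?s n) (e k)) \<longlonglongrightarrow> cinner x (e k)"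
      by (intro tendsto_cinner x tendsto_const)
    have "\<forall>\<^sub>F n in sequentially. cinner (?s n) (e k) = a k"
      using eventually_gt_at_top[of k] by eventually_elim (simp add: cinner_comb)
    then show "(\<lambda>n. cinner (?s n) (e k)) \<longlonglongrightarrow> a k" by (rule tendsto_eventually)
  qed
  ultimately show ?thesis using x by blast
qed

lemma expansion:
  assumes "x \<in> K"
  shows "(\<lambda>n. \<Sum>k<n. cinner x (e k) *\<^sub>C e k) \<longlonglongrightarrow> x"
proof -
  obtain y where "y \<in> K" "(\<lambda>n. \<Sum>k<n. cinner x (e k) *\<^sub>C e k) \<longlonglongrightarrow> y"
    and "\<forall>k. cinner y (e k) = cinner x (e k)"
    using riesz_fischer[of "\<lambda>k. cinner x (e k)", OF bessel] by auto
  then show ?thesis using eqI[of y x] assms by simp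
qed

lemma orth_proj:
  shows "orth_proj K v \<in> K" and "y \<in> K \<Longrightarrow> cinner (orth_proj K v) y = cinner v y"
proof -
  obtain x where x: "x \<in> K" "\<And>k. cinner x (e k) = cinner v (e k)"
    using riesz_fischer[of "\<lambda>k. cinner v (e k)", OF bessel] by auto
  have "cinner (v - x) y = 0" if "y \<in> K" for y
  proof (rule LIMSEQ_unique)
    show "(\<lambda>n. cinner (v - x) (\<Sum>k<n. cinner y (e k) *\<^sub>C e k)) \<longlonglongrightarrow> cinner (v - x) y"
      by (intro tendsto_cinner tendsto_const expansion that)
    show "(\<lambda>n. cinner (v - x) (\<Sum>k<n. cinner y (e k) *\<^sub>C e k)) \<longlonglongrightarrow> 0"
      by (simp add: cinner_sum_right cinner_scaleC_right cinner_diff_left x)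
  qed
  then have vx: "v - x \<in> orth_compl K" by (simp add: orth_compl_def)
  have "orth_proj K v = x"
    unfolding orth_proj_def
  proof (rule the_equality)
    fix z assume z: "z \<in> K \<and> v - z \<in> orth_compl K"
    have "(v - x) - (v - z) \<in> orth_compl K"
      using csubspaceD(5)[OF closed_csubspace_orth_compl vx] z by blast
    then have "z - x \<in> orth_compl K" by simp
    moreover have "z - x \<in> K" using z x csubspaceD(5)[OF K] by blast
    ultimately have "cinner (z - x) (z - x) = 0" by (simp add: orth_compl_def)
    then show "z = x" by (simp add: cinner_self_eq_0_iff)
  qed (use vx x in auto)
  then show "orth_proj K v \<in> K" and "y \<in> K \<Longrightarrow> cinner (orth_proj K v) y = cinner v y"
    using x(1) vx by (auto simp: orth_compl_def cinner_diff_left)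
qed

text \<open>The vector that represents \<open>B x\<close> must have the coefficients \<open>B x (e k)\<close>.  They are square
  summable because a partial sum \<open>y\<close> of the series satisfies \<open>B x y = \<parallel>y\<parallel>\<^sup>2\<close>, so that boundedness of
  \<open>B\<close> bounds \<open>\<parallel>y\<parallel>\<close>.\<close>
lemma operator_of_form:
  assumes add1: "\<And>x y z. x \<in> K \<Longrightarrow> y \<in> K \<Longrightarrow> z \<in> K \<Longrightarrow> B (x + y) z = B x z + B y z"
    and scale1: "\<And>c x z. x \<in> K \<Longrightarrow> z \<in> K \<Longrightarrow> B (c *\<^sub>C x) z = c * B x z"
    and add2: "\<And>x y z. x \<in> K \<Longrightarrow> y \<in> K \<Longrightarrow> z \<in> K \<Longrightarrow> B x (y + z) = B x y + B x z"
    and scale2: "\<And>c x z. x \<in> K \<Longrightarrow> z \<in> K \<Longrightarrow> B x (c *\<^sub>C z) = cnj c * B x z"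
    and bound: "\<And>x y. x \<in> K \<Longrightarrow> y \<in> K \<Longrightarrow> norm (B x y) \<le> C * norm x * norm y"
  obtains T where "T \<in> bounded_ops K" "\<And>x y. x \<in> K \<Longrightarrow> y \<in> K \<Longrightarrow> cinner (T x) y = B x y"
proof -
  have sum2: "B x (\<Sum>k<n. a k *\<^sub>C e k) = (\<Sum>k<n. cnj (a k) * B x (e k))" if "x \<in> K" for x a and n :: nat
  proof (induction n)
    case 0
    show ?case using scale2[OF that csubspaceD(2)[OF K], of 0] by simp
  qed (simp add: add2 scale2 that comb_mem csubspaceD[OF K] e_mem)
  have nc: "norm (\<Sum>k<n. B x (e k) *\<^sub>C e k) \<le> C * norm x" if "x \<in> K" for x and n :: nat
  proof -
    let ?y = "\<Sum>k<n. B x (e k) *\<^sub>C e k"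
    have "B x ?y = of_real ((norm ?y)\<^sup>2)"
      unfolding sum2[OF that] by (simp add: norm_comb complex_norm_square mult.commute del: of_real_power)
    then have "norm (B x ?y) = norm ?y * norm ?y"
      by (simp only: norm_of_real abs_of_nonneg zero_le_power2) (rule power2_eq_square)
    then have "norm ?y * norm ?y \<le> C * norm x * norm ?y"
      using bound[OF that comb_mem, of "\<lambda>k. B x (e k)" "{..<n}"] by simp
    moreover have "0 \<le> C * norm x"
    proof (cases "norm x = 0")
      case False
      have "0 \<le> norm (B x x)" by simp
      also have "\<dots> \<le> C * norm x * norm x" by (rule bound[OF that that])
      finally show ?thesis using False by (simp add: zero_le_mult_iff)
    qed simp
    ultimately show ?thesis by (cases "norm ?y = 0") (simp_all add: mult_le_cancel_right)
  qed
  have "\<exists>t\<in>K. norm t \<le> C * norm x \<and> (\<forall>k. cinner t (e k) = B x (e k))" if "x \<in> K" for x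
  proof -
    have "(\<Sum>k<n. (norm (B x (e k)))\<^sup>2) \<le> (C * norm x)\<^sup>2" for n
      using power_mono[OF nc[OF that, of n], of 2] by (simp add: norm_comb)
    from riesz_fischer[OF this] obtain t where t: "t \<in> K" "\<And>k. cinner t (e k) = B x (e k)"
      "(\<lambda>n. \<Sum>k<n. B x (e k) *\<^sub>C e k) \<longlonglongrightarrow> t" by auto
    have "norm t \<le> C * norm x"
      by (rule LIMSEQ_le_const2[OF tendsto_norm[OF t(3)]]) (use nc[OF that] in blast)
    then show ?thesis using t by blast
  qed
  then obtain t where t: "\<And>x. x \<in> K \<Longrightarrow> t x \<in> K" "\<And>x. x \<in> K \<Longrightarrow> norm (t x) \<le> C * norm x"
    "\<And>x k. x \<in> K \<Longrightarrow> cinner (t x) (e k) = B x (e k)" by metis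
  have t_add: "t (x + y) = t x + t y" if "x \<in> K" "y \<in> K" for x y
    using that by (intro eqI) (simp_all add: t csubspaceD[OF K] cinner_add_left add1 e_mem)
  have t_scale: "t (c *\<^sub>C x) = c *\<^sub>C t x" if "x \<in> K" for c x
    using that by (intro eqI) (simp_all add: t csubspaceD[OF K] cinner_scaleC_left scale1 e_mem)
  have "restrict t K \<in> bounded_ops K"
    using t t_add t_scale csubspaceD[OF K] unfolding bounded_ops_def by auto
  moreover have "cinner (restrict t K x) y = B x y" if "x \<in> K" "y \<in> K" for x y
  proof -
    let ?s = "\<lambda>n. \<Sum>k<n. cinner y (e k) *\<^sub>C e k"
    have s: "?s \<longlonglongrightarrow> y" by (rule expansion[OF that(2)])
    have "cinner (t x) y = B x y"
    proof (rule LIMSEQ_unique)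
      show "(\<lambda>n. cinner (t x) (?s n)) \<longlonglongrightarrow> cinner (t x) y"
        by (intro tendsto_cinner tendsto_const s)
      have "(\<lambda>n. B x (?s n) - B x y) \<longlonglongrightarrow> 0"
      proof (rule Lim_null_comparison)
        have "norm (B x (?s n) - B x y) \<le> C * norm x * norm (?s n - y)" for n
        proof -
          have "B x (?s n - y) = B x (?s n) - B x y"
            using add2[OF that(1) _ that(2), of "?s n - y"] that comb_mem csubspaceD(5)[OF K] by simp
          then show ?thesis using bound[OF that(1), of "?s n - y"] that comb_mem csubspaceD(5)[OF K] by metis
        qed
        then show "\<forall>\<^sub>F n in sequentially. norm (B x (?s n) - B x y) \<le> C * norm x * norm (?s n - y)" by simp
        have "(\<lambda>n. norm (?s n - y)) \<longlonglongrightarrow> 0"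
          using s by (simp add: LIM_zero_iff tendsto_norm_zero_iff)
        then show "(\<lambda>n. C * norm x * norm (?s n - y)) \<longlonglongrightarrow> 0" by (rule tendsto_mult_right_zero)
      qed
      then have "(\<lambda>n. B x (?s n)) \<longlonglongrightarrow> B x y" by (rule LIM_zero_cancel)
      moreover have "B x (?s n) = cinner (t x) (?s n)" for n
        by (simp add: sum2 that cinner_sum_right cinner_scaleC_right t)
      ultimately show "(\<lambda>n. cinner (t x) (?s n)) \<longlonglongrightarrow> B x y" by simp
    qed
    then show ?thesis using that by simp
  qed
  ultimately show ?thesis using that by blast
qed

lemma op_eqI:
  assumes S: "S \<in> bounded_ops K" and T: "T \<in> bounded_ops K"
    and eq: "\<And>x y. x \<in> K \<Longrightarrow> y \<in> K \<Longrightarrow> cinner (S x) y = cinner (T x) y"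
  shows "S = T"
  using S T by (intro bounded_ops_eqI[OF S T] eqI) (auto intro: eq e_mem bounded_opsD)

lemma cinner_op_expansion:
  assumes T: "T \<in> bounded_ops K" and x: "x \<in> K"
  shows "(\<lambda>n. \<Sum>k<n. cinner x (e k) * cinner (T (e k)) y) \<longlonglongrightarrow> cinner (T x) y"
proof -
  let ?s = "\<lambda>n. \<Sum>k<n. cinner x (e k) *\<^sub>C e k"
  obtain B where B: "\<And>x. x \<in> K \<Longrightarrow> norm (T x) \<le> B * norm x" using bounded_ops_bound[OF T] by metis
  have "(\<lambda>n. T (?s n) - T x) \<longlonglongrightarrow> 0"
  proof (rule Lim_null_comparison)
    have "norm (T (?s n) - T x) \<le> B * norm (?s n - x)" for n
    proof -
      have d: "?s n - x \<in> K" by (intro csubspaceD[OF K] x e_mem)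
      have "T (?s n) = T (?s n - x) + T x" using bounded_opsD(2)[OF T d x] by simp
      then show ?thesis using B[OF d] by simp
    qed
    then show "\<forall>\<^sub>F n in sequentially. norm (T (?s n) - T x) \<le> B * norm (?s n - x)" by simp
    have "(\<lambda>n. norm (?s n - x)) \<longlonglongrightarrow> 0"
      using expansion[OF x] by (simp add: LIM_zero_iff tendsto_norm_zero_iff)
    then show "(\<lambda>n. B * norm (?s n - x)) \<longlonglongrightarrow> 0" by (rule tendsto_mult_right_zero)
  qed
  then have "(\<lambda>n. T (?s n)) \<longlonglongrightarrow> T x" by (rule LIM_zero_cancel)
  then have "(\<lambda>n. cinner (T (?s n)) y) \<longlonglongrightarrow> cinner (T x) y" by (intro tendsto_cinner tendsto_const)
  moreover have "cinner (T (?s n)) y = (\<Sum>k<n. cinner x (e k) * cinner (T (e k)) y)" for n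
    by (simp add: bounded_ops_sum[OF K T] csubspaceD[OF K] e_mem bounded_opsD[OF T] cinner_sum_left
        cinner_scaleC_left)
  ultimately show ?thesis by simp
qed

lemma op_eq_on_basisI:
  assumes S: "S \<in> bounded_ops K" and T: "T \<in> bounded_ops K"
    and eq: "\<And>j k. cinner (S (e j)) (e k) = cinner (T (e j)) (e k)"
  shows "S = T"
proof (rule bounded_ops_eqI[OF S T], rule eqI)
  fix x k assume "x \<in> K"
  from cinner_op_expansion[OF S this, of "e k"] cinner_op_expansion[OF T this, of "e k"]
  show "cinner (S x) (e k) = cinner (T x) (e k)" unfolding eq by (rule LIMSEQ_unique)
qed (auto intro: bounded_opsD S T)

text \<open>The adjoint is introduced by a definite description, so nothing can be said about it before
  its existence is known; the form \<open>\<lambda>x y. cinner x (T y)\<close> provides it.\<close>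
lemma op_adj:
  assumes T: "T \<in> bounded_ops K"
  shows "op_adj K T \<in> bounded_ops K"
    and "x \<in> K \<Longrightarrow> y \<in> K \<Longrightarrow> cinner (T x) y = cinner x (op_adj K T y)"
proof -
  obtain B where B: "B \<ge> 0" "\<And>x. x \<in> K \<Longrightarrow> norm (T x) \<le> B * norm x" using bounded_ops_bound[OF T] by metis
  obtain R where R: "R \<in> bounded_ops K"
    and R': "\<And>x y. x \<in> K \<Longrightarrow> y \<in> K \<Longrightarrow> cinner (R x) y = cinner x (T y)"
  proof (rule operator_of_form[of "\<lambda>x y. cinner x (T y)" B])
    fix x y assume xy: "x \<in> K" "y \<in> K"
    have "norm (cinner x (T y)) \<le> norm x * norm (T y)" by (rule cinner_Cauchy_Schwarz)
    also have "\<dots> \<le> norm x * (B * norm y)" by (intro mult_left_mono B xy) auto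
    finally show "norm (cinner x (T y)) \<le> B * norm x * norm y" by (simp add: mult_ac)
  qed (auto simp: cinner_add_left cinner_scaleC_left bounded_opsD[OF T] cinner_add_right cinner_scaleC_right)
  have RT: "cinner (T x) y = cinner x (R y)" if "x \<in> K" "y \<in> K" for x y
    using R'[OF that(2,1)] by (metis cinner_commute)
  have "op_adj K T = R"
    unfolding op_adj_def
  proof (rule the_equality)
    fix Q assume Q: "Q \<in> bounded_ops K \<and> (\<forall>x\<in>K. \<forall>y\<in>K. cinner (T x) y = cinner x (Q y))"
    show "Q = R"
    proof (rule op_eqI)
      fix x y assume "x \<in> K" "y \<in> K"
      then have "cinner y (Q x) = cinner y (R x)" using Q RT by metis
      then show "cinner (Q x) y = cinner (R x) y" by (metis cinner_commute)
    qed (use Q R in auto)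
  qed (use R RT in auto)
  then show "op_adj K T \<in> bounded_ops K"
    and "x \<in> K \<Longrightarrow> y \<in> K \<Longrightarrow> cinner (T x) y = cinner x (op_adj K T y)"
    using R RT by auto
qed

lemma generated_cstar_subset: "X \<subseteq> bounded_ops K \<Longrightarrow> generated_cstar K X \<subseteq> bounded_ops K"
  unfolding generated_cstar_def
  by (rule Inter_lower) (auto simp: unital_subalgebra_def norm_closed_def op_id_bounded op_add_bounded
      op_mult_bounded op_scale_bounded op_adj K)

lemma compression_bounded:
  assumes add: "\<And>x y. T (x + y) = T x + T y" and scale: "\<And>c x. T (c *\<^sub>C x) = c *\<^sub>C T x"
    and bound: "\<And>x. norm (T x) \<le> C * norm x"
  shows "compression K T \<in> bounded_ops K"
proof -
  have p_add: "orth_proj K (x + y) = orth_proj K x + orth_proj K y" for x y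
    by (intro eqI) (simp_all add: orth_proj csubspaceD[OF K] cinner_add_left e_mem)
  have p_scale: "orth_proj K (c *\<^sub>C x) = c *\<^sub>C orth_proj K x" for c x
    by (intro eqI) (simp_all add: orth_proj csubspaceD[OF K] cinner_scaleC_left e_mem)
  have p_bound: "norm (orth_proj K x) \<le> norm x" for x
  proof -
    let ?y = "orth_proj K x"
    have "norm (cinner ?y ?y) = norm (cinner x ?y)" by (simp add: orth_proj)
    also have "\<dots> \<le> norm x * norm ?y" by (rule cinner_Cauchy_Schwarz)
    finally have "norm ?y * norm ?y \<le> norm x * norm ?y" by (simp add: cinner_self power2_eq_square norm_mult)
    then show ?thesis by (cases "norm ?y = 0") (simp_all add: mult_le_cancel_right)
  qed
  have "norm (orth_proj K (T x)) \<le> C * norm x" for x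
    using p_bound[of "T x"] bound[of x] by linarith
  then show ?thesis
    unfolding bounded_ops_def compression_def
    by (auto simp: orth_proj csubspaceD[OF K] add scale p_add p_scale)
qed

end

section \<open>Limits along ultrafilters\<close>

text \<open>Zorn's lemma gives a maximal proper filter \<open>U\<close> refining \<open>F\<close>.  If the complement of \<open>P\<close> is not in
  \<open>U\<close>, the filter generated by \<open>U\<close> and \<open>P\<close> is still proper, so \<open>P\<close> is in \<open>U\<close> by maximality.  Filters
  are handled as families of predicates so that they are ordered by inclusion.\<close>
lemma ex_ultrafilter:
  assumes "F \<noteq> bot"
  obtains U where "U \<le> F" "U \<noteq> bot" "\<And>P. eventually P U \<or> eventually (\<lambda>x. \<not> P x) U"
proof -
  let ?A = "{S. is_filter (\<lambda>P. P \<in> S) \<and> (\<lambda>_. False) \<notin> S \<and> {P. eventually P F} \<subseteq> S}"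
  have "\<exists>M\<in>?A. \<forall>S\<in>?A. M \<subseteq> S \<longrightarrow> S = M"
  proof (rule subset_Zorn_nonempty)
    have "is_filter (\<lambda>P. P \<in> {P. eventually P F})"
      by (rule is_filter.intro) (auto simp: eventually_conj_iff eventually_mono)
    then have "{P. eventually P F} \<in> ?A" using assms by (auto simp: trivial_limit_def)
    then show "?A \<noteq> {}" by blast
    fix \<C> assume ne: "\<C> \<noteq> {}" and ch: "subset.chain ?A \<C>"
    have fil: "is_filter (\<lambda>P. P \<in> S)" "(\<lambda>_. False) \<notin> S" "{P. eventually P F} \<subseteq> S" if "S \<in> \<C>" for S
      using ch that unfolding subset_chain_def by blast+
    have "is_filter (\<lambda>P. P \<in> \<Union>\<C>)"
    proof
      show "(\<lambda>_. True) \<in> \<Union>\<C>" using ne fil(1) is_filter.True by blast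
      fix P Q
      show "(\<lambda>x. P x \<and> Q x) \<in> \<Union>\<C>" if PQ: "P \<in> \<Union>\<C>" "Q \<in> \<Union>\<C>"
      proof -
        obtain S where "S \<in> \<C>" "P \<in> S" "Q \<in> S"
          using PQ ch unfolding subset_chain_def by blast
        then show ?thesis using is_filter.conj[OF fil(1)] by blast
      qed
      show "Q \<in> \<Union>\<C>" if "\<forall>x. P x \<longrightarrow> Q x" "P \<in> \<Union>\<C>"
        using that is_filter.mono[OF fil(1), of _ P Q] by blast
    qed
    then show "\<Union>\<C> \<in> ?A" using ne fil by blast
  qed
  then obtain M where "M \<in> ?A" and max: "\<forall>S\<in>?A. M \<subseteq> S \<longrightarrow> S = M" by (rule bexE)
  then have M: "is_filter (\<lambda>P. P \<in> M)" "(\<lambda>_. False) \<notin> M" "{P. eventually P F} \<subseteq> M" by auto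
  define U where "U = Abs_filter (\<lambda>P. P \<in> M)"
  have ev: "eventually P U \<longleftrightarrow> P \<in> M" for P
    unfolding U_def eventually_Abs_filter[OF M(1)] ..
  show ?thesis
  proof (rule that[of U])
    show "U \<le> F" using M(3) by (auto simp: le_filter_def ev)
    show "U \<noteq> bot" using M(2) by (auto simp: trivial_limit_def ev)
    fix P
    show "eventually P U \<or> eventually (\<lambda>x. \<not> P x) U"
    proof (rule disjCI)
      assume nP: "\<not> eventually (\<lambda>x. \<not> P x) U"
      let ?S = "{Q. eventually (\<lambda>x. P x \<longrightarrow> Q x) U}"
      have "?S \<in> ?A"
      proof (intro CollectI conjI)
        show "is_filter (\<lambda>Q. Q \<in> ?S)"
        proof (rule is_filter.intro)
          fix Q R
          show "(\<lambda>x. Q x \<and> R x) \<in> ?S" if "Q \<in> ?S" "R \<in> ?S"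
          proof -
            have "\<forall>\<^sub>F x in U. P x \<longrightarrow> Q x" "\<forall>\<^sub>F x in U. P x \<longrightarrow> R x" using that by auto
            then have "\<forall>\<^sub>F x in U. P x \<longrightarrow> Q x \<and> R x" by (rule eventually_elim2) simp
            then show ?thesis by simp
          qed
          show "R \<in> ?S" if QR: "\<forall>x. Q x \<longrightarrow> R x" and "Q \<in> ?S"
          proof -
            have "\<forall>\<^sub>F x in U. P x \<longrightarrow> Q x" using that by auto
            then have "\<forall>\<^sub>F x in U. P x \<longrightarrow> R x" by (rule eventually_mono) (simp add: QR)
            then show ?thesis by simp
          qed
        qed simp
        show "(\<lambda>_. False) \<notin> ?S" using nP by simp
        show "{Q. eventually Q F} \<subseteq> ?S"
        proof
          fix Q assume "Q \<in> {Q. eventually Q F}"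
          then have "eventually Q U" using \<open>U \<le> F\<close> by (simp add: le_filter_def)
          then show "Q \<in> ?S" by (simp add: eventually_mono)
        qed
      qed
      moreover have "M \<subseteq> ?S" by (auto simp: ev[symmetric] eventually_mono)
      ultimately have "?S = M" using max by blast
      moreover have "P \<in> ?S" by simp
      ultimately show "eventually P U" unfolding ev by blast
    qed
  qed
qed

lemma ultrafilter_bounded_limit:
  fixes f :: "'a \<Rightarrow> complex"
  assumes U: "U \<noteq> bot" "\<And>P. eventually P U \<or> eventually (\<lambda>x. \<not> P x) U"
    and f: "\<And>x. norm (f x) \<le> C"
  shows "\<exists>l. (f \<longlongrightarrow> l) U"
proof -
  have "compact (cball (0::complex) C)" by (rule compact_cball)
  moreover have "filtermap f U \<noteq> bot" using U(1) by (simp add: filtermap_bot_iff)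
  moreover have "eventually (\<lambda>z. z \<in> cball 0 C) (filtermap f U)"
    using f by (simp add: eventually_filtermap)
  ultimately obtain l where l: "inf (nhds l) (filtermap f U) \<noteq> bot"
    unfolding compact_filter by blast
  have "(f \<longlongrightarrow> l) U"
  proof (rule topological_tendstoI, rule ccontr)
    fix S assume S: "open S" "l \<in> S" and "\<not> (\<forall>\<^sub>F x in U. f x \<in> S)"
    then have "\<forall>\<^sub>F x in U. f x \<notin> S" using U(2)[of "\<lambda>x. f x \<in> S"] by blast
    then have "\<forall>\<^sub>F z in filtermap f U. z \<notin> S" by (simp add: eventually_filtermap)
    moreover have "\<forall>\<^sub>F z in nhds l. z \<in> S" using S by (rule eventually_nhds_in_open)
    ultimately have "\<forall>\<^sub>F z in inf (nhds l) (filtermap f U). False"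
      unfolding eventually_inf by blast
    then show False using l by (simp add: trivial_limit_def)
  qed
  then show ?thesis by blast
qed

section \<open>Weighted shifts\<close>

text \<open>The weights \<open>sqrt (N k / N (k+1))\<close> are at most \<open>1\<close> and tend to \<open>1\<close>, so \<open>S\<close> looks like the
  unilateral shift far out in the basis.  Writing the weights as quotients makes the matrix entries of
  powers of \<open>S\<close> telescope: the entry of \<open>S ^ m\<close> from \<open>e k\<close> to \<open>e (k+m)\<close> is \<open>sqrt (N k / N (k+m))\<close>.\<close>
locale weighted_shift = orthonormal_basis K e for K :: "'a::complex_hilbert set" and e +
  fixes N :: "nat \<Rightarrow> real" and S :: "'a \<Rightarrow> 'a"
  assumes N_pos: "N k > 0" and N_mono: "N k \<le> N (Suc k)"
    and N_ratio: "(\<lambda>k. N k / N (Suc k)) \<longlonglongrightarrow> 1"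
    and S_bounded: "S \<in> bounded_ops K"
    and S_basis: "S (e k) = of_real (sqrt (N k / N (Suc k))) *\<^sub>C e (Suc k)"
begin

text \<open>The increments of \<open>N\<close>.  The kernel \<open>min (N k) (N l) = (\<Sum>r\<le>min k l. incr r)\<close> is a sum of
  positive kernels of rank one because they are nonnegative.\<close>
definition incr :: "nat \<Rightarrow> real" where
  "incr r = (if r = 0 then N 0 else N r - N (r - 1))"

lemma incr_nonneg: "incr r \<ge> 0"
  using N_mono[of "r - 1"] N_pos[of 0] by (cases r) (auto simp: incr_def)

lemma sum_incr: "(\<Sum>r\<le>k. incr r) = N k"
  by (induction k) (auto simp: incr_def)

text \<open>The operators \<open>piece n r\<close>, for \<open>r \<le> n\<close>, are the components of a contraction from \<open>K\<close> to a sum of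
  \<open>n + 1\<close> copies of \<open>K\<close>.  Each cuts a vector off to indices between \<open>r\<close> and \<open>n\<close>, rescales its
  coefficients and shifts it by \<open>n\<close>.  The cut-off at \<open>n\<close> keeps all sums finite and disappears in the
  limit.\<close>
definition piece :: "nat \<Rightarrow> nat \<Rightarrow> 'a \<Rightarrow> 'a" where
  "piece n r x = (\<Sum>k\<in>{r..n}. (of_real (sqrt (incr r / N k)) * cinner x (e k)) *\<^sub>C e (k + n))"

lemma piece_mem: "piece n r x \<in> K"
  unfolding piece_def by (intro csubspaceD[OF K] e_mem)

lemma piece_add: "piece n r (x + y) = piece n r x + piece n r y"
  by (simp add: piece_def cinner_add_left distrib_left scaleC_add_left sum.distrib)

lemma piece_scale: "piece n r (c *\<^sub>C x) = c *\<^sub>C piece n r x"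
  by (simp add: piece_def cinner_scaleC_left scaleC_sum_right scaleC_scaleC mult_ac)

lemma piece_basis:
  assumes "k \<le> n"
  shows "piece n r (e k) = (if r \<le> k then of_real (sqrt (incr r / N k)) *\<^sub>C e (k + n) else 0)"
proof -
  have "piece n r (e k) =
    (\<Sum>j\<in>{r..n}. if k = j then of_real (sqrt (incr r / N k)) *\<^sub>C e (k + n) else 0)"
    unfolding piece_def by (rule sum.cong) (auto simp: orthonormal)
  then show ?thesis using assms by simp
qed

lemma norm_piece: "(norm (piece n r x))\<^sup>2 = (\<Sum>k\<in>{r..n}. incr r / N k * (norm (cinner x (e k)))\<^sup>2)"
proof -
  have "piece n r x = (\<Sum>j\<in>(\<lambda>k. k + n) ` {r..n}.
      (of_real (sqrt (incr r / N (j - n))) * cinner x (e (j - n))) *\<^sub>C e j)"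
    unfolding piece_def by (subst sum.reindex) (auto simp: inj_on_def)
  then have "(norm (piece n r x))\<^sup>2 = (\<Sum>j\<in>(\<lambda>k. k + n) ` {r..n}.
      (norm (of_real (sqrt (incr r / N (j - n))) * cinner x (e (j - n))))\<^sup>2)"
    by (simp only:) (rule norm_comb, simp)
  also have "\<dots> = (\<Sum>k\<in>{r..n}. (norm (of_real (sqrt (incr r / N k)) * cinner x (e k)))\<^sup>2)"
    by (subst sum.reindex) (auto simp: inj_on_def)
  also have "\<dots> = (\<Sum>k\<in>{r..n}. incr r / N k * (norm (cinner x (e k)))\<^sup>2)"
    using incr_nonneg[of r] N_pos by (intro sum.cong) (auto simp: norm_mult power_mult_distrib less_imp_le)
  finally show ?thesis .
qed

text \<open>The pieces form a contraction since the squared factors \<open>incr r / N k\<close> of a fixed coefficient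
  add up to \<open>1\<close> over \<open>r \<le> k\<close>.\<close>
lemma sum_norm_piece: "(\<Sum>r\<le>n. (norm (piece n r x))\<^sup>2) \<le> (norm x)\<^sup>2"
proof -
  have "(\<Sum>r\<le>n. (norm (piece n r x))\<^sup>2) =
      (\<Sum>r\<le>n. \<Sum>k\<in>{k\<in>{..n}. r \<le> k}. incr r / N k * (norm (cinner x (e k)))\<^sup>2)"
    unfolding norm_piece by (intro sum.cong) auto
  also have "\<dots> = (\<Sum>k\<le>n. \<Sum>r\<in>{r\<in>{..n}. r \<le> k}. incr r / N k * (norm (cinner x (e k)))\<^sup>2)"
    by (rule sum.swap_restrict) auto
  also have "\<dots> = (\<Sum>k\<le>n. (\<Sum>r\<le>k. incr r) / N k * (norm (cinner x (e k)))\<^sup>2)"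
    unfolding sum_divide_distrib sum_distrib_right by (intro sum.cong) auto
  also have "\<dots> = (\<Sum>k\<le>n. (norm (cinner x (e k)))\<^sup>2)"
    using N_pos by (intro sum.cong) (auto simp: sum_incr less_imp_neq[symmetric])
  also have "\<dots> \<le> (norm x)\<^sup>2" by (rule bessel) simp
  finally show ?thesis .
qed

text \<open>This is the sesquilinear form of \<open>V\<^sup>* (T \<oplus> \<dots> \<oplus> T) V\<close> for the contraction \<open>V\<close> with components
  \<open>piece n r\<close>.  It is visibly completely positive in \<open>T\<close>, and so is its limit for large \<open>n\<close>.\<close>
definition dilated_form :: "('a \<Rightarrow> 'a) \<Rightarrow> nat \<Rightarrow> 'a \<Rightarrow> 'a \<Rightarrow> complex" where
  "dilated_form T n x y = (\<Sum>r\<le>n. cinner (T (piece n r x)) (piece n r y))"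

lemma dilated_form_bound:
  assumes B: "B \<ge> 0" "\<And>x. x \<in> K \<Longrightarrow> norm (T x) \<le> B * norm x"
  shows "norm (dilated_form T n x y) \<le> B * norm x * norm y"
proof -
  let ?X = "\<lambda>r. norm (piece n r x)" and ?Y = "\<lambda>r. norm (piece n r y)"
  have "norm (dilated_form T n x y) \<le> (\<Sum>r\<le>n. norm (cinner (T (piece n r x)) (piece n r y)))"
    unfolding dilated_form_def by (rule norm_sum)
  also have "\<dots> \<le> (\<Sum>r\<le>n. B * (\<bar>?X r\<bar> * \<bar>?Y r\<bar>))"
  proof (rule sum_mono)
    fix r
    have "norm (cinner (T (piece n r x)) (piece n r y)) \<le> norm (T (piece n r x)) * ?Y r"
      by (rule cinner_Cauchy_Schwarz)
    also have "\<dots> \<le> B * ?X r * ?Y r" by (intro mult_right_mono B piece_mem) simp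
    finally show "norm (cinner (T (piece n r x)) (piece n r y)) \<le> B * (\<bar>?X r\<bar> * \<bar>?Y r\<bar>)"
      by (simp add: mult.assoc)
  qed
  also have "\<dots> = B * (\<Sum>r\<le>n. \<bar>?X r\<bar> * \<bar>?Y r\<bar>)" by (simp add: sum_distrib_left)
  also have "\<dots> \<le> B * (L2_set ?X {..n} * L2_set ?Y {..n})"
    by (intro mult_left_mono L2_set_mult_ineq B)
  also have "\<dots> \<le> B * (norm x * norm y)"
    using sum_norm_piece by (intro mult_left_mono mult_mono B) (auto simp: L2_set_def real_le_lsqrt sum_nonneg)
  finally show ?thesis by (simp add: mult.assoc)
qed

text \<open>On the basis the form is an entry of \<open>T\<close> far down its diagonal, multiplied by the entry of a
  positive semidefinite matrix with unit diagonal.\<close>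
lemma dilated_form_basis:
  assumes T: "T \<in> bounded_ops K" and n: "k \<le> n" "l \<le> n"
  shows "dilated_form T n (e k) (e l) =
    of_real (N (min k l) / sqrt (N k * N l)) * cinner (T (e (k + n))) (e (l + n))"
proof -
  let ?t = "cinner (T (e (k + n))) (e (l + n))"
  have T0: "T 0 = 0" using bounded_ops_sum[OF K T, of "{}"] by simp
  have "dilated_form T n (e k) (e l) =
      (\<Sum>r\<le>n. if r \<in> {..min k l} then of_real (incr r / sqrt (N k * N l)) * ?t else 0)"
    unfolding dilated_form_def
  proof (rule sum.cong)
    fix r
    let ?\<alpha> = "complex_of_real (sqrt (incr r / N k))" and ?\<beta> = "complex_of_real (sqrt (incr r / N l))"
    have "sqrt (incr r / N k) * sqrt (incr r / N l) = incr r / sqrt (N k * N l)"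
      using incr_nonneg[of r] by (simp add: real_sqrt_mult real_sqrt_divide)
    then have \<alpha>\<beta>: "?\<alpha> * ?\<beta> = of_real (incr r / sqrt (N k * N l))" by (metis of_real_mult)
    show "cinner (T (piece n r (e k))) (piece n r (e l)) =
      (if r \<in> {..min k l} then of_real (incr r / sqrt (N k * N l)) * ?t else 0)"
    proof (cases "r \<le> min k l")
      case True
      then have "cinner (T (piece n r (e k))) (piece n r (e l)) = ?\<alpha> * (cnj ?\<beta> * ?t)"
        by (simp only: piece_basis n if_True min.bounded_iff bounded_opsD[OF T] e_mem
            cinner_scaleC_left cinner_scaleC_right mult.left_commute)
      also have "\<dots> = (?\<alpha> * ?\<beta>) * ?t" by (simp only: complex_cnj_complex_of_real mult.assoc)
      finally show ?thesis using True by (simp only: \<alpha>\<beta> atMost_iff if_True)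
    next
      case False
      then show ?thesis by (auto simp: piece_basis n T0)
    qed
  qed simp
  also have "\<dots> = (\<Sum>r\<le>min k l. of_real (incr r / sqrt (N k * N l)) * ?t)"
    using n by (subst sum.inter_restrict[symmetric]) (auto intro: sum.cong)
  also have "\<dots> = of_real ((\<Sum>r\<le>min k l. incr r) / sqrt (N k * N l)) * ?t"
    by (simp only: sum_divide_distrib of_real_sum sum_distrib_right)
  finally show ?thesis by (simp only: sum_incr)
qed

lemma N_ratio_shift: "(\<lambda>n. N (k + n) / N (k + m + n)) \<longlonglongrightarrow> 1"
proof (induction m)
  case 0
  then show ?case using N_pos by (simp add: less_imp_neq[symmetric])
next
  case (Suc m)
  have "(\<lambda>n. N (n + (k + m)) / N (Suc (n + (k + m)))) \<longlonglongrightarrow> 1"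
    by (rule LIMSEQ_ignore_initial_segment[OF N_ratio])
  from tendsto_mult[OF Suc this] show ?case
    using N_pos by (simp add: less_imp_neq[symmetric] add_ac)
qed

lemma cinner_S_basis:
  assumes "x \<in> K"
  shows "cinner (S x) (e 0) = 0"
    and "cinner (S x) (e (Suc m)) = of_real (sqrt (N m / N (Suc m))) * cinner x (e m)"
proof -
  note lim = cinner_op_expansion[OF S_bounded assms]
  show "cinner (S x) (e 0) = 0"
    using lim[of "e 0"] by (simp add: S_basis cinner_scaleC_left orthonormal LIMSEQ_const_iff)
  let ?c = "of_real (sqrt (N m / N (Suc m))) * cinner x (e m)"
  have "\<forall>\<^sub>F n in sequentially. (\<Sum>k<n. cinner x (e k) * cinner (S (e k)) (e (Suc m))) = ?c"
    using eventually_gt_at_top[of m]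
  proof eventually_elim
    case (elim n)
    have "(\<Sum>k<n. cinner x (e k) * cinner (S (e k)) (e (Suc m))) = (\<Sum>k<n. if m = k then ?c else 0)"
      by (rule sum.cong) (auto simp: S_basis cinner_scaleC_left orthonormal)
    then show ?case using elim by simp
  qed
  then show "cinner (S x) (e (Suc m)) = ?c"
    using LIMSEQ_unique[OF lim tendsto_eventually] by blast
qed

text \<open>Comparing the entries of \<open>T S\<close> and \<open>S T\<close> shows that the entries of \<open>T\<close>, multiplied by
  \<open>sqrt (N b / N a)\<close>, are constant along diagonals.  Since \<open>e 0\<close> is orthogonal to the range of \<open>S\<close>,
  the diagonals that start at \<open>(a, 0)\<close> with \<open>a > 0\<close> vanish, and the matrix is triangular.\<close>
lemma commutant_entries:
  assumes T: "T \<in> bounded_ops K" and comm: "\<forall>x\<in>K. T (S x) = S (T x)"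
  shows "b < a \<Longrightarrow> cinner (T (e a)) (e b) = 0"
    and "cinner (T (e (a + n))) (e (b + n)) =
      cinner (T (e a)) (e b) * of_real (sqrt (N b / N a) * sqrt (N (a + n) / N (b + n)))"
proof -
  have w: "of_real (sqrt (N a / N (Suc a))) * cinner (T (e (Suc a))) y = cinner (S (T (e a))) y" for a y
  proof -
    have "S (T (e a)) = T (S (e a))" using comm e_mem by simp
    then show ?thesis by (simp only: S_basis bounded_opsD[OF T] e_mem cinner_scaleC_left)
  qed
  have nz: "complex_of_real (sqrt (N a / N (Suc a))) \<noteq> 0" for a
    using N_pos[of a] N_pos[of "Suc a"] by simp
  have zero: "cinner (T (e (Suc a))) (e 0) = 0" for a
    using w[of a "e 0"] nz[of a] by (simp add: cinner_S_basis bounded_opsD[OF T] e_mem del: of_real_eq_0_iff)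
  have step: "of_real (sqrt (N a / N (Suc a))) * cinner (T (e (Suc a))) (e (Suc b)) =
      of_real (sqrt (N b / N (Suc b))) * cinner (T (e a)) (e b)" for a b
    by (simp only: w cinner_S_basis bounded_opsD[OF T] e_mem)
  show "b < a \<Longrightarrow> cinner (T (e a)) (e b) = 0"
  proof (induction b arbitrary: a)
    case 0
    then show ?case using zero by (metis gr0_conv_Suc)
  next
    case (Suc b)
    then obtain a' where a': "a = Suc a'" "b < a'" by (metis Suc_less_eq2)
    then show ?case using step[of a' b] Suc.IH[of a'] nz[of a'] by (simp del: of_real_eq_0_iff)
  qed
  show "cinner (T (e (a + n))) (e (b + n)) =
      cinner (T (e a)) (e b) * of_real (sqrt (N b / N a) * sqrt (N (a + n) / N (b + n)))"
  proof (induction n)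
    case 0
    have "sqrt (N b / N a) * sqrt (N a / N b) = 1"
      using N_pos[of a] N_pos[of b] by (simp flip: real_sqrt_mult)
    then show ?case by simp
  next
    case (Suc n)
    let ?a = "a + n" and ?b = "b + n"
    have eq: "sqrt (N ?b / N (Suc ?b)) * (sqrt (N b / N a) * sqrt (N ?a / N ?b)) =
        sqrt (N ?a / N (Suc ?a)) * (sqrt (N b / N a) * sqrt (N (Suc ?a) / N (Suc ?b)))"
      using N_pos[of ?a] N_pos[of ?b] N_pos[of "Suc ?a"] N_pos[of "Suc ?b"]
      by (simp add: real_sqrt_divide field_simps)
    have "of_real (sqrt (N ?a / N (Suc ?a))) * cinner (T (e (Suc ?a))) (e (Suc ?b)) =
       of_real (sqrt (N ?b / N (Suc ?b)) * (sqrt (N b / N a) * sqrt (N ?a / N ?b))) * cinner (T (e a)) (e b)"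
      by (simp only: step) (simp only: Suc of_real_mult mult_ac)
    also have "\<dots> = of_real (sqrt (N ?a / N (Suc ?a))) *
       (cinner (T (e a)) (e b) * of_real (sqrt (N b / N a) * sqrt (N (Suc ?a) / N (Suc ?b))))"
      unfolding eq by (simp only: of_real_mult mult_ac)
    finally have "cinner (T (e (Suc ?a))) (e (Suc ?b)) =
       cinner (T (e a)) (e b) * of_real (sqrt (N b / N a) * sqrt (N (Suc ?a) / N (Suc ?b)))"
      by (rule iffD1[OF mult_left_cancel[OF nz]])
    then show ?case by (simp only: add_Suc_right)
  qed
qed

text \<open>Moving an entry of \<open>T\<close> down its diagonal changes it by a factor whose limit is the inverse of
  the factor in \<open>dilated_form_basis\<close>, so the entry is recovered.\<close>
lemma dilated_form_commutant:
  assumes T: "T \<in> bounded_ops K" and comm: "\<forall>x\<in>K. T (S x) = S (T x)"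
  shows "(\<lambda>n. dilated_form T n (e k) (e l)) \<longlonglongrightarrow> cinner (T (e k)) (e l)"
proof (cases "l < k")
  case True
  have "\<forall>\<^sub>F n in sequentially. dilated_form T n (e k) (e l) = 0"
    using eventually_ge_at_top[of k]
    by eventually_elim (use True in \<open>simp add: dilated_form_basis[OF T] commutant_entries(1)[OF T comm]\<close>)
  then show ?thesis using True by (simp add: commutant_entries(1)[OF T comm] tendsto_eventually)
next
  case False
  define m where "m = l - k"
  have l: "l = k + m" using False by (simp add: m_def)
  have "\<forall>\<^sub>F n in sequentially. cinner (T (e k)) (e l) * of_real (sqrt (N (k + n) / N (k + m + n))) =
      dilated_form T n (e k) (e l)"
    using eventually_ge_at_top[of l]
  proof eventually_elim
    case (elim n)
    have "N k / sqrt (N k * N l) * sqrt (N l / N k) = 1"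
      using N_pos[of k] N_pos[of l] by (simp add: real_sqrt_divide real_sqrt_mult field_simps)
    then have "of_real (N k / sqrt (N k * N l)) * (z * of_real (sqrt (N l / N k) * s)) = z * of_real s"
      for s and z :: complex
      by (metis (no_types, opaque_lifting) mult.assoc mult.commute mult_1 of_real_1 of_real_mult)
    then show ?case
      using elim by (simp only: l dilated_form_basis[OF T] commutant_entries(2)[OF T comm, of k n "k + m"]
          min_absorb1 le_add1)
  qed
  moreover have "(\<lambda>n. cinner (T (e k)) (e l) * of_real (sqrt (N (k + n) / N (k + m + n))))
      \<longlonglongrightarrow> cinner (T (e k)) (e l) * of_real (sqrt 1)"
    by (intro tendsto_intros N_ratio_shift)
  ultimately show ?thesis by (simp add: tendsto_cong)
qed

text \<open>The limits of the forms define \<open>\<phi>\<close>.  An ultrafilter makes them exist for all bounded operators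
  at once; where an ordinary limit exists, the third property says that \<open>\<phi>\<close> has this entry.\<close>
lemma dilation_map:
  obtains \<phi> where "\<And>T. T \<in> bounded_ops K \<Longrightarrow> \<phi> T \<in> bounded_ops K"
    and "\<And>C. C \<subseteq> bounded_ops K \<Longrightarrow> completely_positive K C K \<phi>"
    and "\<And>T k l z. T \<in> bounded_ops K \<Longrightarrow> (\<lambda>n. dilated_form T n (e k) (e l)) \<longlonglongrightarrow> z \<Longrightarrow>
      cinner (\<phi> T (e k)) (e l) = z"
proof -
  obtain U :: "nat filter" where U: "U \<le> sequentially" "U \<noteq> bot"
    and ultra: "\<And>P. eventually P U \<or> eventually (\<lambda>x. \<not> P x) U"
    using ex_ultrafilter[OF sequentially_bot] by blast
  have "\<exists>R\<in>bounded_ops K. \<forall>x\<in>K. \<forall>y\<in>K. ((\<lambda>n. dilated_form T n x y) \<longlongrightarrow> cinner (R x) y) U"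
    if T: "T \<in> bounded_ops K" for T
  proof -
    obtain B where B: "B \<ge> 0" "\<And>x. x \<in> K \<Longrightarrow> norm (T x) \<le> B * norm x" using bounded_ops_bound[OF T] by metis
    have db: "norm (dilated_form T n x y) \<le> B * norm x * norm y" for n x y
      by (rule dilated_form_bound) (use B in auto)
    \<comment> \<open>A family in \<open>n\<close> bounded by \<open>B * norm x * norm y\<close> converges along \<open>U\<close>, and the limit form
      inherits the bound.\<close>
    define L where "L x y = Lim U (\<lambda>n. dilated_form T n x y)" for x y
    have lim: "((\<lambda>n. dilated_form T n x y) \<longlongrightarrow> L x y) U" for x y
    proof -
      obtain l where "((\<lambda>n. dilated_form T n x y) \<longlongrightarrow> l) U"
        using ultrafilter_bounded_limit[where f = "\<lambda>n. dilated_form T n x y", OF U(2) ultra db] by blast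
      then show ?thesis unfolding L_def using tendsto_Lim[OF U(2)] by metis
    qed
    obtain R where "R \<in> bounded_ops K" "\<And>x y. x \<in> K \<Longrightarrow> y \<in> K \<Longrightarrow> cinner (R x) y = L x y"
    proof (rule operator_of_form[of L B])
      fix x y z assume "x \<in> K" "y \<in> K" "z \<in> K"
      have "(\<lambda>n. dilated_form T n (x + y) z) = (\<lambda>n. dilated_form T n x z + dilated_form T n y z)"
        by (simp add: dilated_form_def piece_add bounded_opsD[OF T] piece_mem cinner_add_left sum.distrib)
      then show "L (x + y) z = L x z + L y z"
        using tendsto_unique[OF U(2) lim[of "x + y" z]] tendsto_add[OF lim lim] by simp
      have "(\<lambda>n. dilated_form T n x (y + z)) = (\<lambda>n. dilated_form T n x y + dilated_form T n x z)"
        by (simp add: dilated_form_def piece_add bounded_opsD[OF T] piece_mem cinner_add_right sum.distrib)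
      then show "L x (y + z) = L x y + L x z"
        using tendsto_unique[OF U(2) lim[of x "y + z"]] tendsto_add[OF lim lim] by simp
    next
      fix c x z assume "x \<in> K" "z \<in> K"
      have "(\<lambda>n. dilated_form T n (c *\<^sub>C x) z) = (\<lambda>n. c * dilated_form T n x z)"
        by (simp add: dilated_form_def piece_scale bounded_opsD[OF T] piece_mem cinner_scaleC_left sum_distrib_left)
      then show "L (c *\<^sub>C x) z = c * L x z"
        using tendsto_unique[OF U(2) lim[of "c *\<^sub>C x" z]] tendsto_mult_left[OF lim] by simp
      have "(\<lambda>n. dilated_form T n x (c *\<^sub>C z)) = (\<lambda>n. cnj c * dilated_form T n x z)"
        by (simp add: dilated_form_def piece_scale cinner_scaleC_right sum_distrib_left)
      then show "L x (c *\<^sub>C z) = cnj c * L x z"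
        using tendsto_unique[OF U(2) lim[of x "c *\<^sub>C z"]] tendsto_mult_left[OF lim] by simp
      show "norm (L x z) \<le> B * norm x * norm z"
        by (rule tendsto_upperbound[OF tendsto_norm[OF lim]])
          (use U(2) db in auto)
    qed blast
    then show ?thesis using lim by metis
  qed
  then obtain \<phi> where \<phi>: "\<And>T. T \<in> bounded_ops K \<Longrightarrow> \<phi> T \<in> bounded_ops K"
    and lim: "\<And>T x y. T \<in> bounded_ops K \<Longrightarrow> x \<in> K \<Longrightarrow> y \<in> K \<Longrightarrow>
      ((\<lambda>n. dilated_form T n x y) \<longlongrightarrow> cinner (\<phi> T x) y) U"
    by metis
  show ?thesis
  proof (rule that[of \<phi>])
    fix C assume C: "C \<subseteq> bounded_ops K"
    have "linear_on_ops K C K \<phi>"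
      unfolding linear_on_ops_def
    proof (intro conjI ballI allI)
      fix T assume "T \<in> C"
      then have T: "T \<in> bounded_ops K" using C by blast
      show "\<phi> T \<in> bounded_ops K" by (rule \<phi>[OF T])
      show "\<phi> (op_scale K c T) = op_scale K c (\<phi> T)" for c
      proof (rule op_eqI)
        fix x y assume xy: "x \<in> K" "y \<in> K"
        have "(\<lambda>n. dilated_form (op_scale K c T) n x y) = (\<lambda>n. c * dilated_form T n x y)"
          by (simp add: dilated_form_def op_scale_def piece_mem cinner_scaleC_left sum_distrib_left)
        then have "cinner (\<phi> (op_scale K c T) x) y = c * cinner (\<phi> T x) y"
          using tendsto_unique[OF U(2) lim[OF op_scale_bounded[OF K T] xy]] tendsto_mult_left[OF lim[OF T xy]] by simp
        then show "cinner (\<phi> (op_scale K c T) x) y = cinner (op_scale K c (\<phi> T) x) y"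
          using xy by (simp add: op_scale_def cinner_scaleC_left)
      qed (intro \<phi> op_scale_bounded K T)+
      fix T' assume "T' \<in> C"
      then have T': "T' \<in> bounded_ops K" using C by blast
      show "\<phi> (op_add K T T') = op_add K (\<phi> T) (\<phi> T')"
      proof (rule op_eqI)
        fix x y assume xy: "x \<in> K" "y \<in> K"
        have "(\<lambda>n. dilated_form (op_add K T T') n x y) = (\<lambda>n. dilated_form T n x y + dilated_form T' n x y)"
          by (simp add: dilated_form_def op_add_def piece_mem cinner_add_left sum.distrib)
        then have "cinner (\<phi> (op_add K T T') x) y = cinner (\<phi> T x) y + cinner (\<phi> T' x) y"
          using tendsto_unique[OF U(2) lim[OF op_add_bounded[OF K T T'] xy]]
            tendsto_add[OF lim[OF T xy] lim[OF T' xy]] by simp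
        then show "cinner (\<phi> (op_add K T T') x) y = cinner (op_add K (\<phi> T) (\<phi> T') x) y"
          using xy by (simp add: op_add_def cinner_add_left)
      qed (intro \<phi> op_add_bounded K T T')+
    qed
    moreover have "positive_matrix K m (\<lambda>i j. \<phi> (T i j))"
      if T: "\<forall>i<m. \<forall>j<m. T i j \<in> C" and pos: "positive_matrix K m T" for m T
      unfolding positive_matrix_def
    proof (intro allI impI)
      fix h assume h: "\<forall>i<m. h i \<in> K"
      let ?f = "\<lambda>n. \<Sum>i<m. \<Sum>j<m. dilated_form (T i j) n (h j) (h i)"
      let ?z = "\<Sum>i<m. \<Sum>j<m. cinner (\<phi> (T i j) (h j)) (h i)"
      have f: "(?f \<longlongrightarrow> ?z) U"
        using T C h by (intro tendsto_sum lim) auto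
      have "0 \<le> ?f n" for n
      proof -
        have "?f n = (\<Sum>i<m. \<Sum>r\<le>n. \<Sum>j<m. cinner (T i j (piece n r (h j))) (piece n r (h i)))"
          unfolding dilated_form_def by (intro sum.cong refl sum.swap)
        also have "\<dots> = (\<Sum>r\<le>n. \<Sum>i<m. \<Sum>j<m. cinner (T i j (piece n r (h j))) (piece n r (h i)))"
          by (rule sum.swap)
        also have "0 \<le> \<dots>"
          by (rule sum_nonneg) (use pos in \<open>simp add: positive_matrix_def piece_mem\<close>)
        finally show ?thesis .
      qed
      then have *: "0 \<le> Re (?f n)" "Im (?f n) = 0" for n by (simp_all only: less_eq_complex_def zero_complex.simps)
      have "0 \<le> Re ?z" by (rule tendsto_lowerbound[OF tendsto_Re[OF f]]) (use * U(2) in auto)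
      moreover have "Im ?z = 0"
        using tendsto_unique[OF U(2) tendsto_Im[OF f], of 0] unfolding * by simp
      ultimately show "0 \<le> ?z" by (simp add: less_eq_complex_def)
    qed
    ultimately show "completely_positive K C K \<phi>" unfolding completely_positive_def by blast
  next
    fix T k l z assume T: "T \<in> bounded_ops K" and z: "(\<lambda>n. dilated_form T n (e k) (e l)) \<longlonglongrightarrow> z"
    show "cinner (\<phi> T (e k)) (e l) = z"
      using tendsto_unique[OF U(2) lim[OF T e_mem e_mem] tendsto_mono[OF U(1) z]] .
  qed (rule \<phi>)
qed

lemma norm_closed_commutant:
  defines "A \<equiv> {T \<in> bounded_ops K. \<forall>x\<in>K. T (S x) = S (T x)}"
  shows "unital_subalgebra K A" and "norm_closed K A"
proof -
  have A: "T \<in> A \<longleftrightarrow> T \<in> bounded_ops K \<and> (\<forall>x\<in>K. T (S x) = S (T x))" for T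
    by (simp add: A_def)
  show "unital_subalgebra K A"
    unfolding unital_subalgebra_def
  proof (intro conjI ballI allI)
    show "A \<subseteq> bounded_ops K" by (auto simp: A)
    show "op_id K \<in> A"
      by (simp add: A op_id_bounded K) (simp add: op_id_def bounded_opsD[OF S_bounded])
    fix T assume "T \<in> A"
    then have T: "T \<in> bounded_ops K" "\<forall>x\<in>K. T (S x) = S (T x)" by (simp_all add: A)
    show "op_scale K c T \<in> A" for c
      using T(2) by (simp add: A op_scale_bounded[OF K T(1)])
        (simp add: op_scale_def bounded_opsD[OF S_bounded] bounded_opsD[OF T(1)])
    fix R assume "R \<in> A"
    then have R: "R \<in> bounded_ops K" "\<forall>x\<in>K. R (S x) = S (R x)" by (simp_all add: A)
    show "op_add K T R \<in> A"
      using T(2) R(2) by (simp add: A op_add_bounded[OF K T(1) R(1)])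
        (simp add: op_add_def bounded_opsD[OF S_bounded] bounded_opsD[OF T(1)] bounded_opsD[OF R(1)])
    show "op_mult K T R \<in> A"
      using T(2) R(2) by (simp add: A op_mult_bounded[OF K T(1) R(1)])
        (simp add: op_mult_def bounded_opsD[OF S_bounded] bounded_opsD[OF T(1)] bounded_opsD[OF R(1)])
  qed
  obtain B where B: "B \<ge> 0" "\<And>x. x \<in> K \<Longrightarrow> norm (S x) \<le> B * norm x" using bounded_ops_bound[OF S_bounded] by metis
  show "norm_closed K A"
    unfolding norm_closed_def
  proof (intro ballI impI)
    fix T assume T: "T \<in> bounded_ops K"
      and approx: "\<forall>\<epsilon>>0. \<exists>R\<in>A. \<forall>x\<in>K. norm (R x - T x) \<le> \<epsilon> * norm x"
    have "T (S x) = S (T x)" if x: "x \<in> K" for x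
    proof -
      have le: "norm (T (S x) - S (T x)) \<le> \<epsilon> * (2 * B * norm x)" if \<epsilon>: "\<epsilon> > 0" for \<epsilon>
      proof -
        obtain R where R: "R \<in> bounded_ops K" "R (S x) = S (R x)"
          and d: "\<And>x. x \<in> K \<Longrightarrow> norm (R x - T x) \<le> \<epsilon> * norm x"
          using approx \<epsilon> x unfolding A_def by blast
        have Sx: "S x \<in> K" by (rule bounded_opsD(1)[OF S_bounded x])
        have "norm (R (S x) - T (S x)) \<le> \<epsilon> * norm (S x)" by (rule d[OF Sx])
        also have "\<dots> \<le> \<epsilon> * (B * norm x)" using \<epsilon> B(2)[OF x] by simp
        finally have 1: "norm (R (S x) - T (S x)) \<le> \<epsilon> * (B * norm x)" .
        have mem: "R x - T x \<in> K" "T x \<in> K"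
          by (intro csubspaceD[OF K] bounded_opsD[OF R(1)] bounded_opsD[OF T] x)+
        have "S (R x) = S (R x - T x) + S (T x)"
          using bounded_opsD(2)[OF S_bounded mem] by simp
        then have "norm (S (R x) - S (T x)) \<le> B * norm (R x - T x)" using B(2)[OF mem(1)] by simp
        also have "\<dots> \<le> B * (\<epsilon> * norm x)" using B(1) d[OF x] by (intro mult_left_mono)
        finally have 2: "norm (S (R x) - S (T x)) \<le> B * (\<epsilon> * norm x)" .
        have "norm (T (S x) - S (T x)) \<le> norm (R (S x) - T (S x)) + norm (S (R x) - S (T x))"
          unfolding R(2) using norm_triangle_ineq4[of "S (R x) - S (T x)" "S (R x) - T (S x)"]
          by (simp add: algebra_simps)
        then show ?thesis using 1 2 by (simp add: algebra_simps)
      qed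
      have "norm (T (S x) - S (T x)) \<le> 0 + \<delta>" if "\<delta> > 0" for \<delta>
      proof -
        let ?M = "2 * B * norm x + 1"
        have M: "?M > 0" using B(1) by (simp add: add_nonneg_pos)
        have "norm (T (S x) - S (T x)) \<le> \<delta> / ?M * (2 * B * norm x)"
          using le[of "\<delta> / ?M"] that M by simp
        also have "\<dots> \<le> \<delta> / ?M * ?M" using that M by (intro mult_left_mono) auto
        finally show ?thesis using M by simp
      qed
      then have "norm (T (S x) - S (T x)) \<le> 0" by (rule field_le_epsilon)
      then show ?thesis by simp
    qed
    then show "T \<in> A" using T by (simp add: A_def)
  qed
qed

text \<open>The map of \<open>dilation_map\<close> agrees with the identity on the generated algebra, which lies in the
  commutant of \<open>S\<close>.  It differs from the identity at \<open>S\<^sup>* S\<close>: the diagonal entries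
  \<open>N k / N (k+1)\<close> of this operator tend to \<open>1\<close>, but the first one is smaller than \<open>1\<close>.\<close>
theorem identity_not_boundary:
  assumes X: "X \<subseteq> {T \<in> bounded_ops K. \<forall>x\<in>K. T (S x) = S (T x)}" and S: "S \<in> X"
    and strict: "N 0 < N 1"
  shows "\<not> boundary_representation K (generated_algebra K X) K (\<lambda>T\<in>generated_cstar K X. T)"
proof
  let ?C = "generated_cstar K X"
  assume "boundary_representation K (generated_algebra K X) K (\<lambda>T\<in>?C. T)"
  then have uni: "\<forall>\<phi>. completely_positive K ?C K \<phi> \<and>
      (\<forall>T\<in>generated_algebra K X. \<phi> T = (\<lambda>T\<in>?C. T) T) \<longrightarrow> (\<forall>T\<in>?C. \<phi> T = (\<lambda>T\<in>?C. T) T)"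
    unfolding boundary_representation_def generated_cstar_generated_algebra by (rule conjunct2)
  have unique: "\<phi> T = T"
    if "completely_positive K ?C K \<phi>" "\<forall>T\<in>generated_algebra K X. \<phi> T = (\<lambda>T\<in>?C. T) T" "T \<in> ?C" for \<phi> T
  proof -
    have "\<forall>T\<in>?C. \<phi> T = (\<lambda>T\<in>?C. T) T"
      by (rule mp[OF spec[OF uni]]) (rule conjI[OF that(1,2)])
    from bspec[OF this that(3)] show ?thesis by (simp only: restrict_apply' that(3))
  qed
  have CB: "?C \<subseteq> bounded_ops K" using X by (intro generated_cstar_subset) blast
  have AC: "generated_algebra K X \<subseteq> ?C"
    unfolding generated_algebra_def generated_cstar_def by blast
  have AS: "T \<in> bounded_ops K \<and> (\<forall>x\<in>K. T (S x) = S (T x))" if "T \<in> generated_algebra K X" for T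
  proof -
    have "generated_algebra K X \<subseteq> {T \<in> bounded_ops K. \<forall>x\<in>K. T (S x) = S (T x)}"
      unfolding generated_algebra_def using norm_closed_commutant X by (intro Inter_lower) simp
    then show ?thesis using that by blast
  qed
  obtain \<phi> where \<phi>: "\<And>T. T \<in> bounded_ops K \<Longrightarrow> \<phi> T \<in> bounded_ops K"
    and cp: "completely_positive K ?C K \<phi>"
    and entry: "\<And>T k l z. T \<in> bounded_ops K \<Longrightarrow> (\<lambda>n. dilated_form T n (e k) (e l)) \<longlonglongrightarrow> z \<Longrightarrow>
      cinner (\<phi> T (e k)) (e l) = z"
    by (rule dilation_map) (use CB in blast)
  have fix_A: "\<forall>T\<in>generated_algebra K X. \<phi> T = (\<lambda>T\<in>?C. T) T"
  proof
    fix T assume TA: "T \<in> generated_algebra K X"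
    have T: "T \<in> bounded_ops K" "\<forall>x\<in>K. T (S x) = S (T x)" using AS[OF TA] by auto
    have "\<phi> T = T"
      by (rule op_eq_on_basisI[OF \<phi>[OF T(1)] T(1)]) (rule entry[OF T(1) dilated_form_commutant[OF T]])
    then show "\<phi> T = (\<lambda>T\<in>?C. T) T" using TA AC by auto
  qed
  let ?Q = "op_mult K (op_adj K S) S"
  have Q_entry: "cinner (?Q (e k)) (e k) = of_real (N k / N (Suc k))" for k
  proof -
    have Sk: "S (e k) \<in> K" by (rule bounded_opsD(1)[OF S_bounded e_mem])
    have "cinner (?Q (e k)) (e k) = cnj (cinner (e k) (op_adj K S (S (e k))))"
      by (subst cinner_commute) (simp add: op_mult_def e_mem)
    also have "\<dots> = cnj (cinner (S (e k)) (S (e k)))"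
      by (simp only: op_adj(2)[OF S_bounded e_mem Sk])
    also have "\<dots> = of_real (sqrt (N k / N (Suc k)) * sqrt (N k / N (Suc k)))"
      by (simp only: S_basis cinner_scaleC_left cinner_scaleC_right orthonormal if_True of_real_mult simp_thms
          complex_cnj_mult complex_cnj_complex_of_real complex_cnj_one mult_1_right)
    also have "sqrt (N k / N (Suc k)) * sqrt (N k / N (Suc k)) = N k / N (Suc k)"
      using N_pos[of k] N_pos[of "Suc k"] by simp
    finally show ?thesis .
  qed
  have QC: "?Q \<in> ?C"
    using S unfolding generated_cstar_def unital_subalgebra_def by blast
  then have Q: "?Q \<in> bounded_ops K" using CB by blast
  have "(\<lambda>n. dilated_form ?Q n (e 0) (e 0)) \<longlonglongrightarrow> 1"
  proof -
    have "dilated_form ?Q n (e 0) (e 0) = of_real (N n / N (Suc n))" for n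
      using N_pos[of 0] by (simp add: dilated_form_basis[OF Q] Q_entry)
    moreover have "(\<lambda>n. complex_of_real (N n / N (Suc n))) \<longlonglongrightarrow> of_real 1"
      by (intro tendsto_of_real N_ratio)
    ultimately show ?thesis by simp
  qed
  from entry[OF Q this] have "of_real (N 0 / N 1) = (1 :: complex)"
    using unique[OF cp fix_A QC] Q_entry[of 0] by simp
  then have "N 0 / N 1 = 1" by (simp only: of_real_eq_1_iff)
  then show False using strict N_pos[of 1] by simp
qed

end

section \<open>Zeros of polynomial ideals\<close>

text \<open>Ideals of \<^const>\<open>poly_ring\<close> in terms of the type class operations on polynomials, in which all
  computations below are carried out.\<close>
definition poly_ideal :: "'n::finite cpoly set \<Rightarrow> bool" where
  "poly_ideal J \<longleftrightarrow> 0 \<in> J \<and> (\<forall>p\<in>J. \<forall>q\<in>J. p + q \<in> J) \<and> (\<forall>p\<in>J. \<forall>s. s * p \<in> J)"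

definition prime_poly_ideal :: "'n::finite cpoly set \<Rightarrow> bool" where
  "prime_poly_ideal J \<longleftrightarrow> poly_ideal J \<and> 1 \<notin> J \<and> (\<forall>p q. p * q \<in> J \<longrightarrow> p \<in> J \<or> q \<in> J)"

lemma poly_idealD:
  assumes "poly_ideal J"
  shows "0 \<in> J" "p \<in> J \<Longrightarrow> q \<in> J \<Longrightarrow> p + q \<in> J" "p \<in> J \<Longrightarrow> s * p \<in> J" "p \<in> J \<Longrightarrow> p * s \<in> J"
    "p \<in> J \<Longrightarrow> - p \<in> J" "p \<in> J \<Longrightarrow> q \<in> J \<Longrightarrow> p - q \<in> J"
    "(\<And>i. i \<in> A \<Longrightarrow> f i \<in> J) \<Longrightarrow> sum f A \<in> J"
proof -
  show *: "0 \<in> J" "p \<in> J \<Longrightarrow> q \<in> J \<Longrightarrow> p + q \<in> J" "p \<in> J \<Longrightarrow> s * p \<in> J" for p q s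
    using assms by (auto simp: poly_ideal_def)
  show "p \<in> J \<Longrightarrow> p * s \<in> J" using *(3)[of p s] by (simp add: mult.commute)
  show neg: "p \<in> J \<Longrightarrow> - p \<in> J" for p using *(3)[of p "- 1"] by simp
  show "p \<in> J \<Longrightarrow> q \<in> J \<Longrightarrow> p - q \<in> J" using *(2)[of p "- q"] neg by simp
  show "(\<And>i. i \<in> A \<Longrightarrow> f i \<in> J) \<Longrightarrow> sum f A \<in> J"
    by (induction A rule: infinite_finite_induct) (auto intro: *)
qed

lemma poly_ideal_cong:
  assumes "poly_ideal J" "p - q \<in> J"
  shows "p \<in> J \<longleftrightarrow> q \<in> J"
  using poly_idealD(2)[OF assms(1) assms(2), of q] poly_idealD(6)[OF assms(1) _ assms(2), of p] by auto

lemma prime_poly_idealI: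
  assumes "primeideal I poly_ring"
  shows "prime_poly_ideal I"
proof -
  interpret primeideal I "poly_ring :: 'a cpoly ring" by fact
  have 0: "0 \<in> I" using additive_subgroup.zero_closed[OF is_additive_subgroup] by (simp add: poly_ring_def)
  have add: "p + q \<in> I" if "p \<in> I" "q \<in> I" for p q
    using additive_subgroup.a_closed[OF is_additive_subgroup that] by (simp add: poly_ring_def)
  have mult: "s * p \<in> I" if "p \<in> I" for p s
    using I_l_closed[OF that, of s] by (simp add: poly_ring_def)
  have pr: "p \<in> I \<or> q \<in> I" if "p * q \<in> I" for p q
    using I_prime[of p q] that by (simp add: poly_ring_def)
  have "1 \<notin> I"
  proof
    assume "1 \<in> I"
    then have "I = UNIV" using mult[of 1] by auto
    then show False using I_notcarr by (simp add: poly_ring_def)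
  qed
  with 0 add mult pr show ?thesis by (auto simp: prime_poly_ideal_def poly_ideal_def)
qed

lemma prime_poly_idealD:
  assumes "prime_poly_ideal I"
  shows "poly_ideal I" "1 \<notin> I" "p * q \<in> I \<Longrightarrow> p \<in> I \<or> q \<in> I" "p ^ n \<in> I \<Longrightarrow> p \<in> I"
proof -
  show *: "poly_ideal I" "1 \<notin> I" "p * q \<in> I \<Longrightarrow> p \<in> I \<or> q \<in> I" for p q
    using assms by (auto simp: prime_poly_ideal_def)
  show "p ^ n \<in> I \<Longrightarrow> p \<in> I" by (induction n) (use * in auto)
qed

definition const_poly :: "complex \<Rightarrow> 'n::finite cpoly" where
  "const_poly x = Poly_Mapping.single 0 x"

definition poly_var :: "'n::finite \<Rightarrow> 'n cpoly" where
  "poly_var i = Poly_Mapping.single (Poly_Mapping.single i 1) 1"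

lemma const_poly_0 [simp]: "const_poly 0 = 0" and const_poly_1 [simp]: "const_poly 1 = 1"
  by (simp_all add: const_poly_def)

lemma const_poly_add: "const_poly (x + y) = const_poly x + const_poly y"
  by (simp add: const_poly_def single_add)

lemma const_poly_minus: "const_poly (- x) = - const_poly x"
  by (simp add: const_poly_def single_uminus)

lemma const_poly_diff: "const_poly (x - y) = const_poly x - const_poly y"
  by (simp add: const_poly_def single_diff)

lemma const_poly_mult: "const_poly (x * y) = const_poly x * const_poly y"
  by (simp add: const_poly_def mult_single)

lemma const_poly_sum: "const_poly (sum f A) = (\<Sum>i\<in>A. const_poly (f i))"
  by (induction A rule: infinite_finite_induct) (simp_all add: const_poly_add)

lemma const_poly_power: "const_poly (x ^ n) = const_poly x ^ n"
  by (induction n) (simp_all add: const_poly_mult)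

lemma const_poly_prod: "const_poly (prod f A) = (\<Prod>i\<in>A. const_poly (f i))"
  by (induction A rule: infinite_finite_induct) (simp_all add: const_poly_mult)

lemma const_poly_mult_single: "const_poly x * Poly_Mapping.single \<alpha> y = Poly_Mapping.single \<alpha> (x * y)"
  by (simp add: const_poly_def mult_single)

lemma lookup_const_poly_mult: "Poly_Mapping.lookup (const_poly x * p) \<alpha> = x * Poly_Mapping.lookup p \<alpha>"
  unfolding const_poly_def mult_map_scale_conv_mult[symmetric] by (rule map.rep_eq[THEN fun_cong, THEN trans]) (simp add: when_def)

lemma const_poly_in_ideal_iff:
  assumes "poly_ideal J" "1 \<notin> J"
  shows "const_poly x \<in> J \<longleftrightarrow> x = 0"
proof
  assume "const_poly x \<in> J"
  then have "const_poly (inverse x) * const_poly x \<in> J" by (rule poly_idealD[OF assms(1)])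
  then show "x = 0" using assms(2) by (cases "x = 0") (simp_all flip: const_poly_mult)
qed (simp add: poly_idealD[OF assms(1)])

lemma sum_monomials:
  assumes "finite A" "Poly_Mapping.keys p \<subseteq> A"
  shows "p = (\<Sum>\<alpha>\<in>A. Poly_Mapping.single \<alpha> (Poly_Mapping.lookup p \<alpha>))"
proof (rule poly_mapping_eqI)
  fix \<beta>
  have "Poly_Mapping.lookup (\<Sum>\<alpha>\<in>A. Poly_Mapping.single \<alpha> (Poly_Mapping.lookup p \<alpha>)) \<beta> =
      (\<Sum>\<alpha>\<in>A. if \<beta> = \<alpha> then Poly_Mapping.lookup p \<beta> else 0)"
    unfolding lookup_sum by (rule sum.cong) (auto simp: lookup_single)
  also have "\<dots> = Poly_Mapping.lookup p \<beta>"
    using assms by (auto simp: in_keys_iff)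
  finally show "Poly_Mapping.lookup p \<beta> =
    Poly_Mapping.lookup (\<Sum>\<alpha>\<in>A. Poly_Mapping.single \<alpha> (Poly_Mapping.lookup p \<alpha>)) \<beta>" ..
qed

text \<open>By elimination: with a pivot \<open>a0\<close> for the coordinate \<open>x\<close>, subtracting multiples of \<open>v a0\<close> from
  the other vectors leaves vectors that vanish at \<open>x\<close>.\<close>
lemma linear_dependence:
  fixes v :: "'a \<Rightarrow> 'b \<Rightarrow> complex"
  assumes "finite F" "finite A" "card F < card A"
  shows "\<exists>l. (\<exists>a\<in>A. l a \<noteq> 0) \<and> (\<forall>x\<in>F. (\<Sum>a\<in>A. l a * v a x) = 0)"
  using assms
proof (induction F arbitrary: A v)
  case empty
  then show ?case by (intro exI[of _ "\<lambda>_. 1"]) (auto simp: card_gt_0_iff)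
next
  case (insert x F)
  show ?case
  proof (cases "\<forall>a\<in>A. v a x = 0")
    case True
    obtain l where "\<exists>a\<in>A. l a \<noteq> 0" "\<forall>y\<in>F. (\<Sum>a\<in>A. l a * v a y) = 0"
      using insert.IH[of A v] insert.prems insert.hyps by auto
    then show ?thesis using True by (intro exI[of _ l]) auto
  next
    case False
    then obtain a0 where a0: "a0 \<in> A" "v a0 x \<noteq> 0" by blast
    let ?A = "A - {a0}"
    have "card F < card ?A" using insert.prems insert.hyps a0 by simp
    then obtain l where l: "\<exists>a\<in>?A. l a \<noteq> 0"
      "\<forall>y\<in>F. (\<Sum>a\<in>?A. l a * (v a y - v a x / v a0 x * v a0 y)) = 0"
      using insert.IH[of ?A "\<lambda>a y. v a y - v a x / v a0 x * v a0 y"] insert.prems by auto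
    define t where "t = (\<Sum>a\<in>?A. l a * v a x) / v a0 x"
    define l' where "l' = l(a0 := - t)"
    have split: "(\<Sum>a\<in>A. l' a * v a y) = (\<Sum>a\<in>?A. l a * v a y) - t * v a0 y" for y
    proof -
      have "(\<Sum>a\<in>A. l' a * v a y) = l' a0 * v a0 y + (\<Sum>a\<in>?A. l' a * v a y)"
        using insert.prems a0 by (intro sum.remove) auto
      also have "(\<Sum>a\<in>?A. l' a * v a y) = (\<Sum>a\<in>?A. l a * v a y)"
        by (rule sum.cong) (auto simp: l'_def)
      finally show ?thesis by (simp add: l'_def)
    qed
    have "(\<Sum>a\<in>A. l' a * v a y) = 0" if "y \<in> F" for y
    proof -
      have "t * v a0 y = (\<Sum>a\<in>?A. l a * (v a x / v a0 x * v a0 y))"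
        by (simp add: t_def sum_divide_distrib sum_distrib_right mult.assoc)
      then show ?thesis using l(2) that
        by (simp add: split right_diff_distrib sum_subtractf)
    qed
    moreover have "(\<Sum>a\<in>A. l' a * v a x) = 0" using a0 by (simp add: split t_def)
    moreover have "\<exists>a\<in>A. l' a \<noteq> 0" using l(1) by (auto simp: l'_def)
    ultimately show ?thesis by (intro exI[of _ l']) auto
  qed
qed

text \<open>The homogenization of \<open>q\<close> to degree \<open>m\<close>, evaluated at \<open>(a, b)\<close>.\<close>
definition binary_form :: "'n::finite cpoly \<Rightarrow> 'n cpoly \<Rightarrow> nat \<Rightarrow> complex poly \<Rightarrow> 'n cpoly" where
  "binary_form a b m q = (\<Sum>j\<le>m. const_poly (coeff q j) * (a ^ j * b ^ (m - j)))"

lemma binary_form_linear_factor: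
  assumes "degree q \<le> m"
  shows "binary_form a b (Suc m) ([:- r, 1:] * q) = (a - const_poly r * b) * binary_form a b m q"
proof -
  have c: "coeff ([:- r, 1:] * q) j = (if j = 0 then 0 else coeff q (j - 1)) - r * coeff q j" for j
    by (cases j) simp_all
  have "binary_form a b (Suc m) ([:- r, 1:] * q) =
     (\<Sum>j\<le>Suc m. const_poly (if j = 0 then 0 else coeff q (j - 1)) * (a ^ j * b ^ (Suc m - j)))
     - (\<Sum>j\<le>Suc m. const_poly (r * coeff q j) * (a ^ j * b ^ (Suc m - j)))"
    unfolding binary_form_def c by (simp only: const_poly_diff left_diff_distrib sum_subtractf)
  also have "(\<Sum>j\<le>Suc m. const_poly (if j = 0 then 0 else coeff q (j - 1)) * (a ^ j * b ^ (Suc m - j)))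
      = a * binary_form a b m q"
    by (subst sum.atMost_Suc_shift) (simp add: binary_form_def sum_distrib_left mult_ac)
  also have "(\<Sum>j\<le>Suc m. const_poly (r * coeff q j) * (a ^ j * b ^ (Suc m - j))) = const_poly r * b * binary_form a b m q"
    using assms by (simp add: coeff_eq_0 binary_form_def sum_distrib_left const_poly_mult Suc_diff_le mult_ac)
  finally show ?thesis by (simp add: algebra_simps)
qed

lemma degree_prod_linear_le:
  "finite L \<Longrightarrow> degree (\<Prod>l\<in>L. [:- l, 1 :: complex:]) \<le> card L"
  using degree_prod_sum_le[of L "\<lambda>l. [:- l, 1 :: complex:]"] by (simp add: o_def)

lemma binary_form_prod:
  assumes "finite L"
  shows "binary_form a b (card L) (\<Prod>l\<in>L. [:- l, 1:]) = (\<Prod>l\<in>L. a - const_poly l * b)"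
  using assms
proof (induction L rule: finite_induct)
  case empty
  show ?case by (simp add: binary_form_def)
next
  case (insert l L)
  then show ?case
    by (simp add: binary_form_linear_factor degree_prod_linear_le del: mult_pCons_left)
qed

lemma binary_form_sum:
  assumes "finite A"
  shows "binary_form a b m (\<Sum>c\<in>A. smult (l c) (q c)) = (\<Sum>c\<in>A. const_poly (l c) * binary_form a b m (q c))"
proof -
  have "binary_form a b m (\<Sum>c\<in>A. smult (l c) (q c)) =
     (\<Sum>j\<le>m. \<Sum>c\<in>A. const_poly (l c) * (const_poly (coeff (q c) j) * (a ^ j * b ^ (m - j))))"
    by (simp add: binary_form_def coeff_sum const_poly_sum const_poly_mult sum_distrib_right mult.assoc)
  also have "\<dots> = (\<Sum>c\<in>A. const_poly (l c) * binary_form a b m (q c))"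
    by (subst sum.swap) (simp add: binary_form_def sum_distrib_left)
  finally show ?thesis .
qed

text \<open>Over \<open>\<complex>\<close> a binary form is a product of linear factors \<open>a - r b\<close> and powers of \<open>b\<close>, the latter
  accounting for a drop of the degree of \<open>q\<close> below \<open>m\<close>.\<close>
lemma binary_form_in_prime_ideal:
  assumes I: "prime_poly_ideal I" and "q \<noteq> 0" "degree q \<le> m" "binary_form a b m q \<in> I"
  shows "b \<in> I \<or> (\<exists>r. a - const_poly r * b \<in> I)"
  using assms(2-)
proof (induction m arbitrary: q)
  case 0
  then obtain x where "q = [:x:]" "x \<noteq> 0" using degree_0_id[of q] by (metis le_zero_eq pCons_eq_0_iff)
  then have "const_poly x \<in> I" using 0 by (simp add: binary_form_def)
  then show ?case using const_poly_in_ideal_iff prime_poly_idealD[OF I] \<open>x \<noteq> 0\<close> by blast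
next
  case (Suc m)
  show ?case
  proof (cases "degree q \<le> m")
    case True
    have "binary_form a b (Suc m) q = b * binary_form a b m q"
      using True by (simp add: binary_form_def coeff_eq_0 sum_distrib_left Suc_diff_le mult_ac)
    then show ?thesis
      using Suc.prems Suc.IH[OF Suc.prems(1) True] prime_poly_idealD(3)[OF I] by metis
  next
    case False
    then have "degree q = Suc m" using Suc.prems by simp
    then have "\<not> constant (poly q)" by (simp add: constant_degree)
    then obtain r where "poly q r = 0" using fundamental_theorem_of_algebra by blast
    then obtain q' where q': "q = [:- r, 1:] * q'" by (metis poly_eq_0_iff_dvd dvdE)
    have "q' \<noteq> 0" using Suc.prems q' by auto
    then have "degree q = Suc (degree q')" unfolding q' by (subst degree_mult_eq) auto
    then have d: "degree q' \<le> m" using \<open>degree q = Suc m\<close> by simp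
    have "(a - const_poly r * b) * binary_form a b m q' \<in> I"
      using Suc.prems(3) unfolding q' binary_form_linear_factor[OF d] .
    then show ?thesis
      using Suc.IH[OF \<open>q' \<noteq> 0\<close> d] prime_poly_idealD(3)[OF I] by blast
  qed
qed

text \<open>The polynomials with exponents at most \<open>n\<close> form a finite-dimensional space.  As there are only
  countably many pairs \<open>(N, n)\<close>, one pair serves infinitely many \<open>c\<close>, and the corresponding \<open>s\<close>
  are linearly dependent.  Modulo \<open>I\<close>, \<open>s\<close> stands for \<open>b ^ N / (a - c b)\<close>; clearing denominators in
  the dependence gives a nonzero binary form in \<open>a\<close> and \<open>b\<close> that, multiplied by \<open>b ^ N\<close>, lies in \<open>I\<close>.\<close>
lemma uncountably_many_congruences:
  assumes I: "prime_poly_ideal I" and U: "uncountable U"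
    and ex: "\<And>c. c \<in> U \<Longrightarrow> \<exists>N s. b ^ N - s * (a - const_poly c * b) \<in> I"
  shows "b \<in> I \<or> (\<exists>r. a - const_poly r * b \<in> I)"
proof -
  note J = prime_poly_idealD(1)[OF I]
  define F where "F n = {\<alpha> :: 'a mindex. \<forall>i. Poly_Mapping.lookup \<alpha> i \<le> n}" for n
  have F: "finite (F n)" for n unfolding F_def by (rule mindex_finite_le)
  have keys: "\<exists>n. Poly_Mapping.keys s \<subseteq> F n" for s :: "'a cpoly"
  proof -
    let ?m = "\<lambda>(\<alpha>, i). Poly_Mapping.lookup \<alpha> i"
    have "Poly_Mapping.lookup \<alpha> i \<le> Max (?m ` (Poly_Mapping.keys s \<times> UNIV))"
      if "\<alpha> \<in> Poly_Mapping.keys s" for \<alpha> i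
      using that by (intro Max_ge) (auto intro!: image_eqI[where x = "(\<alpha>, i)"])
    then show ?thesis unfolding F_def by blast
  qed
  define V where "V = (\<lambda>(N, n). {c \<in> U. \<exists>s. Poly_Mapping.keys s \<subseteq> F n \<and> b ^ N - s * (a - const_poly c * b) \<in> I})"
  have "U \<subseteq> (\<Union>p. V p)" using ex keys unfolding V_def by fastforce
  then have "\<not> countable (\<Union>p. V p)" using U countable_subset by blast
  then obtain p where "infinite (V p)" by (meson countable_UN countable_finite countableI_type)
  obtain N n where "p = (N, n)" by fastforce
  obtain A where A: "A \<subseteq> V p" "finite A" "card A = Suc (card (F n))"
    using infinite_arbitrarily_large[OF \<open>infinite (V p)\<close>] by blast
  obtain s where s: "\<And>c. c \<in> A \<Longrightarrow> Poly_Mapping.keys (s c) \<subseteq> F n"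
    "\<And>c. c \<in> A \<Longrightarrow> b ^ N - s c * (a - const_poly c * b) \<in> I"
  proof -
    have "\<forall>c\<in>A. \<exists>s. Poly_Mapping.keys s \<subseteq> F n \<and> b ^ N - s * (a - const_poly c * b) \<in> I"
      using A(1) \<open>p = (N, n)\<close> unfolding V_def by auto
    then show ?thesis using that by metis
  qed
  obtain l c0 where c0: "c0 \<in> A" "l c0 \<noteq> 0"
    and l: "\<And>\<alpha>. \<alpha> \<in> F n \<Longrightarrow> (\<Sum>c\<in>A. l c * Poly_Mapping.lookup (s c) \<alpha>) = 0"
    using linear_dependence[OF F[of n] A(2), of "\<lambda>c. Poly_Mapping.lookup (s c)"] A(3) by auto
  have rel: "(\<Sum>c\<in>A. const_poly (l c) * s c) = 0"
  proof (rule poly_mapping_eqI)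
    fix \<alpha>
    have "(\<Sum>c\<in>A. l c * Poly_Mapping.lookup (s c) \<alpha>) = 0"
    proof (cases "\<alpha> \<in> F n")
      case False
      then have "Poly_Mapping.lookup (s c) \<alpha> = 0" if "c \<in> A" for c
        using s(1)[OF that] by (meson in_keys_iff subsetD)
      then show ?thesis by simp
    qed (rule l)
    then show "Poly_Mapping.lookup (\<Sum>c\<in>A. const_poly (l c) * s c) \<alpha> = Poly_Mapping.lookup 0 \<alpha>"
      by (simp add: lookup_sum lookup_const_poly_mult)
  qed
  \<comment> \<open>Multiplying the relation by all denominators \<open>a - x b\<close> leaves the product over \<open>x \<noteq> c\<close> next
    to the \<open>c\<close>-th coefficient.\<close>
  let ?P = "\<lambda>c. \<Prod>x\<in>A - {c}. a - const_poly x * b"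
  have P: "(a - const_poly c * b) * ?P c = (\<Prod>x\<in>A. a - const_poly x * b)" if "c \<in> A" for c
    using prod.remove[OF A(2) that] by (rule sym)
  let ?Q = "\<Sum>c\<in>A. const_poly (l c) * ?P c"
  have "(\<Sum>c\<in>A. const_poly (l c) * ?P c * (b ^ N - s c * (a - const_poly c * b))) \<in> I"
    by (intro poly_idealD[OF J] s)
  also have "(\<Sum>c\<in>A. const_poly (l c) * ?P c * (b ^ N - s c * (a - const_poly c * b))) =
     ?Q * b ^ N - (\<Sum>c\<in>A. (const_poly (l c) * s c) * ((a - const_poly c * b) * ?P c))"
  proof -
    have "x * p * (y - t * w) = x * p * y - (x * t) * (w * p)" for x p y t w :: "'a cpoly"
      by (simp add: algebra_simps)
    then show ?thesis by (simp only: sum_distrib_right sum_subtractf)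
  qed
  also have "(\<Sum>c\<in>A. (const_poly (l c) * s c) * ((a - const_poly c * b) * ?P c)) =
      (\<Sum>c\<in>A. const_poly (l c) * s c) * (\<Prod>x\<in>A. a - const_poly x * b)"
    by (simp add: P sum_distrib_right)
  finally have "?Q * b ^ N \<in> I" by (simp add: rel)
  then consider "b \<in> I" | "?Q \<in> I" using prime_poly_idealD(3,4)[OF I] by blast
  then show ?thesis
  proof cases
    case 2
    let ?q = "\<Sum>c\<in>A. smult (l c) (\<Prod>x\<in>A - {c}. [:- x, 1:])"
    have card: "card (A - {c}) = card (F n)" if "c \<in> A" for c using A that by simp
    have "binary_form a b (card (F n)) ?q = ?Q"
      unfolding binary_form_sum[OF A(2)]
    proof (rule sum.cong)
      fix c assume "c \<in> A"
      show "const_poly (l c) * binary_form a b (card (F n)) (\<Prod>x\<in>A - {c}. [:- x, 1:]) = const_poly (l c) * ?P c"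
        using binary_form_prod[of "A - {c}" a b] A(2) by (simp add: card[OF \<open>c \<in> A\<close>])
    qed simp
    moreover have "degree ?q \<le> card (F n)"
    proof (rule degree_sum_le[OF A(2)])
      fix c assume "c \<in> A"
      have "degree (\<Prod>x\<in>A - {c}. [:- x, 1:]) \<le> card (F n)"
        using degree_prod_linear_le[of "A - {c}"] A(2) by (simp add: card[OF \<open>c \<in> A\<close>])
      then show "degree (smult (l c) (\<Prod>x\<in>A - {c}. [:- x, 1:])) \<le> card (F n)"
        using degree_smult_le le_trans by blast
    qed
    \<comment> \<open>At \<open>c0\<close>, whose coefficient \<open>l c0\<close> is nonzero, only one summand of \<open>?q\<close> survives.\<close>
    moreover have "?q \<noteq> 0"
    proof
      assume "?q = 0"
      then have "poly ?q c0 = 0" by simp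
      moreover have "poly ?q c0 = (\<Sum>c\<in>A. if c0 = c then l c0 * (\<Prod>x\<in>A - {c0}. c0 - x) else 0)"
        unfolding poly_sum
        by (rule sum.cong) (use c0 A(2) in \<open>auto simp: poly_prod intro!: prod_zero bexI[of _ c0]\<close>)
      ultimately show False using c0 A(2) by (simp add: prod_zero_iff)
    qed
    ultimately show ?thesis using binary_form_in_prime_ideal[OF I] 2 by metis
  qed simp
qed

text \<open>The set is the ideal generated by \<open>J\<close> and \<open>w\<close>.\<close>
lemma extend_ideal:
  assumes "poly_ideal J"
  shows "poly_ideal {p. \<exists>s. p - s * w \<in> J}" (is "poly_ideal ?L")
    and "J \<subseteq> {p. \<exists>s. p - s * w \<in> J}" and "w \<in> {p. \<exists>s. p - s * w \<in> J}"
proof -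
  show "poly_ideal ?L"
    unfolding poly_ideal_def
  proof (intro conjI ballI allI)
    show "0 \<in> ?L" using poly_idealD(1)[OF assms] by (auto intro!: exI[of _ 0])
    fix p assume "p \<in> ?L"
    then obtain s where s: "p - s * w \<in> J" by blast
    show "t * p \<in> ?L" for t
      using poly_idealD(3)[OF assms s, of t] by (auto intro!: exI[of _ "t * s"] simp: algebra_simps)
    fix q assume "q \<in> ?L"
    then obtain t where "q - t * w \<in> J" by blast
    then have "(p - s * w) + (q - t * w) \<in> J" by (rule poly_idealD(2)[OF assms s])
    also have "(p - s * w) + (q - t * w) = (p + q) - (s + t) * w" by (simp add: algebra_simps)
    finally show "p + q \<in> ?L" by blast
  qed
  show "J \<subseteq> ?L" by (auto intro!: exI[of _ 0])
  show "w \<in> ?L" using poly_idealD(1)[OF assms] by (auto intro!: exI[of _ 1])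
qed

lemma ex_maximal_ideal:
  assumes J: "poly_ideal J" "1 \<notin> J"
  obtains M where "poly_ideal M" "1 \<notin> M" "J \<subseteq> M"
    "\<And>w. w \<notin> M \<Longrightarrow> \<exists>s. 1 - s * w \<in> M"
proof -
  let ?A = "{M. poly_ideal M \<and> 1 \<notin> M \<and> J \<subseteq> M}"
  have "\<exists>M\<in>?A. \<forall>X\<in>?A. M \<subseteq> X \<longrightarrow> X = M"
  proof (rule subset_Zorn_nonempty)
    show "?A \<noteq> {}" using J by blast
    fix \<C> assume ne: "\<C> \<noteq> {}" and ch: "subset.chain ?A \<C>"
    have mem: "poly_ideal M" "1 \<notin> M" "J \<subseteq> M" if "M \<in> \<C>" for M
      using ch that unfolding subset_chain_def by blast+
    have "poly_ideal (\<Union>\<C>)"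
      unfolding poly_ideal_def
    proof (intro conjI ballI allI)
      show "0 \<in> \<Union>\<C>" using ne poly_idealD(1)[OF mem(1)] by blast
      fix p assume p: "p \<in> \<Union>\<C>"
      then show "s * p \<in> \<Union>\<C>" for s using poly_idealD(3)[OF mem(1)] by blast
      fix q assume "q \<in> \<Union>\<C>"
      then obtain M where "M \<in> \<C>" "p \<in> M" "q \<in> M"
        using p ch unfolding subset_chain_def by blast
      then show "p + q \<in> \<Union>\<C>" using poly_idealD(2)[OF mem(1)] by blast
    qed
    then show "\<Union>\<C> \<in> ?A" using ne mem by blast
  qed
  then obtain M where "M \<in> ?A" and max: "\<forall>X\<in>?A. M \<subseteq> X \<longrightarrow> X = M" by (rule bexE)
  then have M: "poly_ideal M" "1 \<notin> M" "J \<subseteq> M" by auto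
  show ?thesis
  proof (rule that[OF M])
    fix w assume "w \<notin> M"
    let ?L = "{p. \<exists>s. p - s * w \<in> M}"
    have "?L \<noteq> M" using extend_ideal(3)[OF M(1), of w] \<open>w \<notin> M\<close> by blast
    then have "?L \<notin> ?A" using max extend_ideal(2)[OF M(1), of w] by blast
    then have "1 \<in> ?L" using extend_ideal(1,2)[OF M(1), of w] M(3) by blast
    then show "\<exists>s. 1 - s * w \<in> M" by blast
  qed
qed

lemma single_eq_prod_var:
  "Poly_Mapping.single \<alpha> x = const_poly x * (\<Prod>i\<in>UNIV. poly_var i ^ Poly_Mapping.lookup \<alpha> i)"
proof -
  have pow: "poly_var i ^ n = Poly_Mapping.single (Poly_Mapping.single i n) 1" for i :: 'a and n
    by (induction n) (simp_all add: poly_var_def mult_single flip: single_add)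
  have pr: "(\<Prod>i\<in>A. Poly_Mapping.single (f i) 1) = Poly_Mapping.single (\<Sum>i\<in>A. f i) (1 :: complex)"
    for f :: "'a \<Rightarrow> 'a mindex" and A
    by (induction A rule: infinite_finite_induct) (simp_all add: mult_single)
  have "(\<Sum>i\<in>UNIV. Poly_Mapping.single i (Poly_Mapping.lookup \<alpha> i)) = \<alpha>"
    by (rule sym, rule poly_mapping_eqI) (simp add: lookup_sum lookup_single when_def)
  then show ?thesis by (simp add: pow pr const_poly_mult_single)
qed

text \<open>Modulo \<open>J\<close>, substituting \<open>u i\<close> for the \<open>i\<close>-th variable changes nothing.  With constants \<open>u i\<close> this
  is evaluation at a point; with multiples of one variable it is restriction to a line.\<close>
lemma substitution_congruence:
  assumes J: "poly_ideal J" and u: "\<And>i. poly_var i - u i \<in> J"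
  shows "p - (\<Sum>\<alpha>\<in>Poly_Mapping.keys p.
      const_poly (Poly_Mapping.lookup p \<alpha>) * (\<Prod>i\<in>UNIV. u i ^ Poly_Mapping.lookup \<alpha> i)) \<in> J"
proof -
  have mult: "a * b - a' * b' \<in> J" if "a - a' \<in> J" "b - b' \<in> J" for a b a' b'
  proof -
    have "a * b - a' * b' = (a - a') * b + a' * (b - b')" by (simp add: algebra_simps)
    then show ?thesis using that poly_idealD[OF J] by metis
  qed
  have pow: "poly_var i ^ n - u i ^ n \<in> J" for i n
    by (induction n) (simp_all add: u mult poly_idealD[OF J])
  have pr: "(\<Prod>i\<in>A. poly_var i ^ g i) - (\<Prod>i\<in>A. u i ^ g i) \<in> J" for A g
    by (induction A rule: infinite_finite_induct) (simp_all add: pow mult poly_idealD[OF J])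
  have "p - (\<Sum>\<alpha>\<in>Poly_Mapping.keys p. const_poly (Poly_Mapping.lookup p \<alpha>) * (\<Prod>i\<in>UNIV. u i ^ Poly_Mapping.lookup \<alpha> i)) =
     (\<Sum>\<alpha>\<in>Poly_Mapping.keys p. const_poly (Poly_Mapping.lookup p \<alpha>) *
       ((\<Prod>i\<in>UNIV. poly_var i ^ Poly_Mapping.lookup \<alpha> i) - (\<Prod>i\<in>UNIV. u i ^ Poly_Mapping.lookup \<alpha> i)))"
    by (subst sum_monomials[of "Poly_Mapping.keys p" p])
      (simp_all add: single_eq_prod_var right_diff_distrib sum_subtractf)
  also have "\<dots> \<in> J" by (intro poly_idealD[OF J] pr)
  finally show ?thesis .
qed

text \<open>In a maximal ideal \<open>M\<close> above \<open>J\<close> every coordinate is congruent to a constant: otherwise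
  \<open>z\<^sub>i - c\<close> would be invertible modulo \<open>M\<close> for all complex \<open>c\<close>, which
  \<open>uncountably_many_congruences\<close> with \<open>b = 1\<close> excludes.  These constants are a zero of \<open>M\<close>.\<close>
theorem nullstellensatz:
  assumes J: "poly_ideal J" "1 \<notin> J"
  shows "zero_locus J \<noteq> {}"
proof -
  obtain M where M: "poly_ideal M" "1 \<notin> M" "J \<subseteq> M" and max: "\<And>w. w \<notin> M \<Longrightarrow> \<exists>s. 1 - s * w \<in> M"
    using ex_maximal_ideal[OF J] by metis
  have prime: "prime_poly_ideal M"
    unfolding prime_poly_ideal_def
  proof (intro conjI allI impI M)
    fix p q assume pq: "p * q \<in> M"
    show "p \<in> M \<or> q \<in> M"
    proof (cases "p \<in> M")
      case False
      then obtain s where "1 - s * p \<in> M" using max by blast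
      then have "(1 - s * p) * q + s * (p * q) \<in> M" using pq poly_idealD[OF M(1)] by blast
      then show ?thesis by (simp add: algebra_simps)
    qed simp
  qed
  have "\<exists>r. poly_var i - const_poly r \<in> M" for i
  proof (rule ccontr)
    assume none: "\<nexists>r. poly_var i - const_poly r \<in> M"
    have "(1 :: 'a cpoly) \<in> M \<or> (\<exists>r. poly_var i - const_poly r * 1 \<in> M)"
    proof (rule uncountably_many_congruences[OF prime uncountable_UNIV_complex])
      fix c
      obtain s where "1 - s * (poly_var i - const_poly c) \<in> M" using max none by blast
      then show "\<exists>N s. 1 ^ N - s * (poly_var i - const_poly c * 1) \<in> M" by auto
    qed
    then show False using M none by simp
  qed
  then obtain w where w: "\<And>i. poly_var i - const_poly (w i) \<in> M" by metis
  have "poly_eval p (\<chi> i. w i) = 0" if "p \<in> J" for p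
  proof -
    have "p - const_poly (poly_eval p (\<chi> i. w i)) \<in> M"
      using substitution_congruence[OF M(1) w, of p]
      by (simp add: poly_eval_def zpow_def const_poly_sum const_poly_mult const_poly_prod const_poly_power)
    moreover have "p \<in> M" using that M by blast
    ultimately have "const_poly (poly_eval p (\<chi> i. w i)) \<in> M" using poly_ideal_cong[OF M(1)] by blast
    then show ?thesis using const_poly_in_ideal_iff[OF M(1,2)] by blast
  qed
  then show ?thesis unfolding zero_locus_def by blast
qed

section \<open>Prime ideals of distinguished varieties\<close>

lemma lookup_homogeneous_part:
  "Poly_Mapping.lookup (homogeneous_part k p) \<alpha> = (if mindex_degree \<alpha> = k then Poly_Mapping.lookup p \<alpha> else 0)"
proof -
  let ?A = "{\<alpha> \<in> Poly_Mapping.keys p. mindex_degree \<alpha> = k}"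
  have "Poly_Mapping.lookup (homogeneous_part k p) \<alpha> =
      (\<Sum>\<beta>\<in>?A. if \<alpha> = \<beta> then Poly_Mapping.lookup p \<alpha> else 0)"
    unfolding homogeneous_part_def lookup_sum by (rule sum.cong) (auto simp: lookup_single)
  also have "\<dots> = (if mindex_degree \<alpha> = k then Poly_Mapping.lookup p \<alpha> else 0)"
    by (auto simp: in_keys_iff)
  finally show ?thesis .
qed

lemma homogeneous_part_add: "homogeneous_part k (p + q) = homogeneous_part k p + homogeneous_part k q"
  by (rule poly_mapping_eqI) (simp add: lookup_homogeneous_part lookup_add)

lemma homogeneous_part_diff: "homogeneous_part k (p - q) = homogeneous_part k p - homogeneous_part k q"
  by (rule poly_mapping_eqI) (simp add: lookup_homogeneous_part lookup_minus)

lemma homogeneous_part_sum: "homogeneous_part k (sum f A) = (\<Sum>x\<in>A. homogeneous_part k (f x))"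
  by (rule poly_mapping_eqI) (simp add: lookup_homogeneous_part lookup_sum)

lemma homogeneous_part_const_poly_mult: "homogeneous_part k (const_poly x * p) = const_poly x * homogeneous_part k p"
  by (rule poly_mapping_eqI) (simp add: lookup_homogeneous_part lookup_const_poly_mult)

lemma homogeneous_part_single:
  "homogeneous_part k (Poly_Mapping.single \<alpha> x) = (if mindex_degree \<alpha> = k then Poly_Mapping.single \<alpha> x else 0)"
  by (rule poly_mapping_eqI) (auto simp: lookup_homogeneous_part lookup_single when_def)

lemma mindex_degree_zero [simp]: "mindex_degree 0 = 0"
  by (simp add: mindex_degree_def)

lemma mindex_degree_add: "mindex_degree (\<alpha> + \<beta>) = mindex_degree \<alpha> + mindex_degree \<beta>"
  by (simp add: mindex_degree_def lookup_add sum.distrib)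

lemma mindex_degree_single: "mindex_degree (Poly_Mapping.single i n) = n"
  by (simp add: mindex_degree_def lookup_single when_def)

lemma homogeneous_part_one: "homogeneous_part k 1 = (if k = 0 then 1 else 0)"
  using homogeneous_part_single[of k 0 1] by auto

lemma homogeneous_part_var_mult:
  "homogeneous_part 0 (poly_var j * p) = 0"
  "homogeneous_part (Suc k) (poly_var j * p) = poly_var j * homogeneous_part k p"
proof -
  have p: "p = (\<Sum>\<alpha>\<in>Poly_Mapping.keys p. Poly_Mapping.single \<alpha> (Poly_Mapping.lookup p \<alpha>))" (is "_ = sum ?m _")
    by (rule sum_monomials) auto
  have v: "poly_var j * Poly_Mapping.single \<alpha> x = Poly_Mapping.single (Poly_Mapping.single j 1 + \<alpha>) x" for \<alpha> x
    by (simp add: poly_var_def mult_single)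
  have vp: "poly_var j * p = (\<Sum>\<alpha>\<in>Poly_Mapping.keys p. poly_var j * ?m \<alpha>)"
    by (subst (1) p) (rule sum_distrib_left)
  show "homogeneous_part 0 (poly_var j * p) = 0"
    unfolding vp by (simp add: homogeneous_part_sum v homogeneous_part_single mindex_degree_add mindex_degree_single)
  have "homogeneous_part (Suc k) (poly_var j * p) = (\<Sum>\<alpha>\<in>Poly_Mapping.keys p. poly_var j * homogeneous_part k (?m \<alpha>))"
    unfolding vp homogeneous_part_sum
    by (rule sum.cong) (auto simp: v homogeneous_part_single mindex_degree_add mindex_degree_single)
  also have "\<dots> = poly_var j * homogeneous_part k p"
    by (simp only: sum_distrib_left[symmetric] homogeneous_part_sum[symmetric] p[symmetric])
  finally show "homogeneous_part (Suc k) (poly_var j * p) = poly_var j * homogeneous_part k p" .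
qed

lemma sum_homogeneous_parts:
  obtains n where "p = (\<Sum>k\<le>n. homogeneous_part k p)" "\<And>k. k > n \<Longrightarrow> homogeneous_part k p = 0"
proof -
  obtain n where n: "\<And>\<alpha>. \<alpha> \<in> Poly_Mapping.keys p \<Longrightarrow> mindex_degree \<alpha> \<le> n"
    using finite_nat_set_iff_bounded_le[of "mindex_degree ` Poly_Mapping.keys p"] by auto
  show ?thesis
  proof (rule that[of n])
    show "p = (\<Sum>k\<le>n. homogeneous_part k p)"
    proof (rule poly_mapping_eqI)
      fix \<alpha>
      show "Poly_Mapping.lookup p \<alpha> = Poly_Mapping.lookup (\<Sum>k\<le>n. homogeneous_part k p) \<alpha>"
        using n[of \<alpha>] by (auto simp: lookup_sum lookup_homogeneous_part in_keys_iff)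
    qed
    fix k assume "k > n"
    show "homogeneous_part k p = 0"
      by (rule poly_mapping_eqI) (use n \<open>k > n\<close> in \<open>force simp: lookup_homogeneous_part in_keys_iff\<close>)
  qed
qed

lemma poly_eval_superset:
  assumes "finite A" "Poly_Mapping.keys p \<subseteq> A"
  shows "poly_eval p z = (\<Sum>\<alpha>\<in>A. Poly_Mapping.lookup p \<alpha> * zpow z \<alpha>)"
  unfolding poly_eval_def using assms by (intro sum.mono_neutral_left) (auto simp: in_keys_iff)

lemma poly_eval_add: "poly_eval (p + q) z = poly_eval p z + poly_eval q z"
proof -
  let ?A = "Poly_Mapping.keys p \<union> Poly_Mapping.keys q"
  have "Poly_Mapping.keys (p + q) \<subseteq> ?A" by (rule keys_add)
  then show ?thesis
    by (simp add: poly_eval_superset[of ?A] lookup_add distrib_right sum.distrib)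
qed

lemma poly_eval_const_poly_mult: "poly_eval (const_poly x * p) z = x * poly_eval p z"
proof -
  have "Poly_Mapping.keys (const_poly x * p) \<subseteq> Poly_Mapping.keys p"
    by (auto simp: in_keys_iff lookup_const_poly_mult)
  then show ?thesis
    by (simp add: poly_eval_superset[of "Poly_Mapping.keys p"] lookup_const_poly_mult sum_distrib_left mult.assoc)
qed

lemma poly_eval_diff: "poly_eval (p - q) z = poly_eval p z - poly_eval q z"
proof -
  have "p - q = p + const_poly (- 1) * q" by (simp add: const_poly_minus)
  then have "poly_eval (p - q) z = poly_eval p z + - 1 * poly_eval q z"
    by (simp only: poly_eval_add poly_eval_const_poly_mult)
  then show ?thesis by simp
qed

lemma poly_eval_sum: "poly_eval (sum f A) z = (\<Sum>x\<in>A. poly_eval (f x) z)"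
  by (induction A rule: infinite_finite_induct) (simp_all add: poly_eval_add, simp_all add: poly_eval_def)

lemma zpow_add: "zpow z (\<alpha> + \<beta>) = zpow z \<alpha> * zpow z \<beta>"
  by (simp add: zpow_def lookup_add power_add prod.distrib)

lemma zpow_single: "zpow z (Poly_Mapping.single i 1) = z $ i"
proof -
  have "zpow z (Poly_Mapping.single i 1) = (\<Prod>j\<in>UNIV. if i = j then z $ j else 1)"
    unfolding zpow_def by (rule prod.cong) (auto simp: lookup_single)
  then show ?thesis by simp
qed

lemma zpow_scale: "zpow (\<chi> i. t * z $ i) \<alpha> = t ^ mindex_degree \<alpha> * zpow z \<alpha>"
  by (simp add: zpow_def mindex_degree_def power_mult_distrib prod.distrib power_sum)

lemma poly_eval_var: "poly_eval (poly_var i) z = z $ i"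
  using zpow_single[of z i] by (simp add: poly_eval_def poly_var_def)

lemma poly_eval_one: "poly_eval 1 z = 1"
  by (simp add: poly_eval_def zpow_def)

lemma poly_eval_homogeneous_part_scale:
  "poly_eval (homogeneous_part k p) (\<chi> i. t * z $ i) = t ^ k * poly_eval (homogeneous_part k p) z"
proof -
  have "mindex_degree \<alpha> = k" if "\<alpha> \<in> Poly_Mapping.keys (homogeneous_part k p)" for \<alpha>
    using that by (auto simp: in_keys_iff lookup_homogeneous_part split: if_splits)
  then show ?thesis by (simp add: poly_eval_def zpow_scale sum_distrib_left mult_ac)
qed

lemma zero_locus_cone:
  assumes "homogeneous_ideal I" "z \<in> zero_locus I"
  shows "(\<chi> i. t * z $ i) \<in> zero_locus I"
  unfolding zero_locus_def
proof (intro CollectI ballI)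
  fix p assume "p \<in> I"
  obtain n where n: "p = (\<Sum>k\<le>n. homogeneous_part k p)" using sum_homogeneous_parts by metis
  have "poly_eval (homogeneous_part k p) z = 0" for k
    using assms \<open>p \<in> I\<close> by (auto simp: homogeneous_ideal_def zero_locus_def)
  then show "poly_eval p (\<chi> i. t * z $ i) = 0"
    by (subst n) (simp add: poly_eval_sum poly_eval_homogeneous_part_scale)
qed

text \<open>The zero set is a cone, so a nonzero point can be scaled to maximum norm \<open>1\<close>.  It then lies on
  the boundary of the polydisc and hence on the torus.\<close>
lemma distinguished_norms_eq:
  fixes I :: "'n::finite cpoly set"
  assumes I: "homogeneous_ideal I" and V: "distinguished_variety (zero_locus I)" and z: "z \<in> zero_locus I"
  shows "norm (z $ i) = norm (z $ j)"
proof (cases "z = 0")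
  case False
  define m where "m = Max (range (\<lambda>i. norm (z $ i)))"
  have m: "norm (z $ i) \<le> m" for i unfolding m_def by (rule Max_ge) auto
  have "m \<in> range (\<lambda>i. norm (z $ i))" unfolding m_def by (rule Max_in) auto
  then obtain i0 where i0: "norm (z $ i0) = m" by auto
  obtain i1 where "z $ i1 \<noteq> 0" using False by (auto simp: vec_eq_iff)
  then have "m > 0" using m[of i1] by (smt (verit) zero_less_norm_iff)
  define w where "w = (\<chi> i. of_real (1 / m) * z $ i)"
  have wi: "norm (w $ i) = norm (z $ i) / m" for i
    using \<open>m > 0\<close> by (simp add: w_def norm_mult norm_divide)
  have "w \<in> zero_locus I" unfolding w_def by (rule zero_locus_cone[OF I z])
  moreover have "w \<in> frontier polydisc"
  proof -
    have "w \<notin> polydisc" using i0 wi[of i0] \<open>m > 0\<close> by (auto simp: polydisc_def intro!: exI[of _ i0])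
    then have "w \<notin> interior polydisc" using interior_subset by blast
    moreover have "w \<in> closure polydisc"
      unfolding closure_sequential
    proof (intro exI conjI allI)
      let ?w = "\<lambda>n. (1 - inverse (real (Suc n))) *\<^sub>R w"
      have "norm (?w n $ i) < 1" for n i
      proof -
        have t: "0 \<le> 1 - inverse (real (Suc n))" "1 - inverse (real (Suc n)) < 1"
          by (simp_all add: inverse_eq_divide)
        have "norm (?w n $ i) = (1 - inverse (real (Suc n))) * norm (w $ i)" using t by simp
        also have "\<dots> \<le> (1 - inverse (real (Suc n))) * 1"
          using m[of i] \<open>m > 0\<close> t by (intro mult_left_mono) (simp_all add: wi)
        finally show ?thesis using t(2) unfolding mult_1_right by (rule le_less_trans)
      qed
      then show "?w n \<in> polydisc" for n by (simp add: polydisc_def)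
      have "?w \<longlonglongrightarrow> (1 - 0) *\<^sub>R w"
        by (intro tendsto_intros LIMSEQ_inverse_real_of_nat)
      then show "?w \<longlonglongrightarrow> w" by simp
    qed
    ultimately show ?thesis by (simp add: frontier_def)
  qed
  ultimately have "w \<in> torus" using V by (auto simp: distinguished_variety_def)
  then have "norm (z $ i) / m = 1" for i by (simp add: torus_def flip: wi)
  then show ?thesis using \<open>m > 0\<close> by (simp add: field_simps)
qed simp

text \<open>The hypothesis makes \<open>1 - z\<^sub>j\<close> a unit modulo the homogeneous ideal \<open>L\<close> generated by \<open>I\<close> and
  \<open>z\<^sub>i - c z\<^sub>j\<close>, with inverse \<open>- h\<close>.  Degree by degree such an inverse has to be the geometric series
  \<open>\<Sum>k. z\<^sub>j ^ k\<close>; since it is a polynomial, some power of \<open>z\<^sub>j\<close> vanishes modulo \<open>L\<close>.\<close>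
lemma poly_var_power_in_extension:
  assumes I: "poly_ideal I" and hom: "\<forall>p\<in>I. \<forall>k. homogeneous_part k p \<in> I"
    and one: "1 - h * (poly_var j - 1) - s * (poly_var i - const_poly c * poly_var j) \<in> I"
  shows "\<exists>N s. poly_var j ^ N - s * (poly_var i - const_poly c * poly_var j) \<in> I"
proof -
  let ?w = "poly_var i - const_poly c * poly_var j"
  let ?L = "{p. \<exists>s. p - s * ?w \<in> I}"
  note L = extend_ideal(1)[OF I, of ?w]
  have sw: "s * ?w = poly_var i * s - const_poly c * (poly_var j * s)" for s by (simp add: algebra_simps)
  have homL: "homogeneous_part k p \<in> ?L" if p: "p \<in> ?L" for p k
  proof -
    obtain s where "p - s * ?w \<in> I" using p by blast
    then have *: "homogeneous_part k p - homogeneous_part k (s * ?w) \<in> I"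
      using hom by (metis homogeneous_part_diff)
    show ?thesis
    proof (cases k)
      case 0
      have "homogeneous_part k (s * ?w) = 0 * ?w"
        unfolding sw 0 by (simp add: homogeneous_part_diff homogeneous_part_const_poly_mult homogeneous_part_var_mult)
      then show ?thesis using * by (metis (mono_tags, lifting) mem_Collect_eq)
    next
      case (Suc l)
      have "homogeneous_part k (s * ?w) = homogeneous_part l s * ?w"
        unfolding sw Suc by (simp add: homogeneous_part_diff homogeneous_part_const_poly_mult homogeneous_part_var_mult)
      then show ?thesis using * by (metis (mono_tags, lifting) mem_Collect_eq)
    qed
  qed
  define q where "q = 1 + h - poly_var j * h"
  have "q \<in> ?L" using one by (auto intro!: exI[of _ s] simp: q_def algebra_simps)
  have mem: "poly_var j ^ k + homogeneous_part k h \<in> ?L" for k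
  proof (induction k)
    case 0
    show ?case
      using homL[OF \<open>q \<in> ?L\<close>, of 0] unfolding q_def
      by (simp add: homogeneous_part_add homogeneous_part_diff homogeneous_part_var_mult homogeneous_part_one)
  next
    case (Suc k)
    have "homogeneous_part (Suc k) h - poly_var j * homogeneous_part k h \<in> ?L"
      using homL[OF \<open>q \<in> ?L\<close>, of "Suc k"] unfolding q_def
      by (simp add: homogeneous_part_add homogeneous_part_diff homogeneous_part_var_mult homogeneous_part_one)
    then have "poly_var j * (poly_var j ^ k + homogeneous_part k h) +
        (homogeneous_part (Suc k) h - poly_var j * homogeneous_part k h) \<in> ?L"
      by (intro poly_idealD(2)[OF L] poly_idealD(3)[OF L Suc])
    then show ?case by (simp only: algebra_simps power_Suc) (simp add: algebra_simps)
  qed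
  obtain k where k: "homogeneous_part k h = 0" using sum_homogeneous_parts[of h] by (metis lessI)
  have "poly_var j ^ k \<in> ?L" using mem[of k] unfolding k add_0_right .
  then have "\<exists>s. poly_var j ^ k - s * ?w \<in> I" by (rule CollectD)
  then show ?thesis by (rule exI)
qed

text \<open>For \<open>\<bar>c\<bar> < 1\<close> no point of the variety has \<open>z\<^sub>i = c z\<^sub>j\<close> and \<open>z\<^sub>j = 1\<close>.  By the
  Nullstellensatz and \<open>poly_var_power_in_extension\<close> a power of \<open>z\<^sub>j\<close> is then a multiple of
  \<open>z\<^sub>i - c z\<^sub>j\<close> modulo \<open>I\<close>, for uncountably many \<open>c\<close>, which forces some \<open>z\<^sub>i - r z\<^sub>j\<close> into \<open>I\<close>.  So
  the variety is a line, and modulo \<open>I\<close> a form of degree \<open>k\<close> is its value at the direction of the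
  line times \<open>z\<^sub>j ^ k\<close>.\<close>
theorem prime_distinguished_ideal:
  fixes I :: "'n::finite cpoly set"
  assumes prime: "prime_poly_ideal I" and I: "homogeneous_ideal I"
    and V: "distinguished_variety (zero_locus I)"
  obtains c :: "complex ^ 'n" and j where "\<And>i. norm (c $ i) = 1" "c $ j = 1"
    "\<And>p. p \<in> I \<longleftrightarrow> (\<forall>k. poly_eval (homogeneous_part k p) c = 0)"
proof -
  note J = prime_poly_idealD(1)[OF prime]
  have hom: "\<forall>p\<in>I. \<forall>k. homogeneous_part k p \<in> I"
    using I by (simp add: homogeneous_ideal_def)
  note norms = distinguished_norms_eq[OF I V]
  obtain z where z: "z \<in> zero_locus I" "z \<noteq> 0" using V by (auto simp: distinguished_variety_def)
  have zi: "z $ i \<noteq> 0" for i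
  proof
    assume "z $ i = 0"
    then have "norm (z $ k) = 0" for k using norms[OF z(1), of k i] by simp
    then show False using z(2) by (simp add: vec_eq_iff)
  qed
  have vanish: "poly_eval p z = 0" if "p \<in> I" for p using that z(1) by (simp add: zero_locus_def)
  fix j :: 'n
  have "\<exists>r. poly_var i - const_poly r * poly_var j \<in> I" for i
  proof -
    have "poly_var j \<in> I \<or> (\<exists>r. poly_var i - const_poly r * poly_var j \<in> I)"
    proof (rule uncountably_many_congruences[OF prime])
      show "uncountable (ball (0 :: complex) 1)" by (rule uncountable_ball) simp
      fix c :: complex assume c: "c \<in> ball 0 1"
      let ?w = "poly_var i - const_poly c * poly_var j"
      let ?L = "{p. \<exists>s. p - s * ?w \<in> I}"
      note L = extend_ideal[OF J, of ?w]
      let ?M = "{p. \<exists>h. p - h * (poly_var j - 1) \<in> ?L}"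
      note M = extend_ideal[OF L(1), of "poly_var j - 1"]
      have "zero_locus ?M = {}"
      proof (rule ccontr)
        assume "zero_locus ?M \<noteq> {}"
        then obtain y where y: "\<And>p. p \<in> ?M \<Longrightarrow> poly_eval p y = 0" unfolding zero_locus_def by blast
        have "y \<in> zero_locus I" using y L(2) M(2) unfolding zero_locus_def by blast
        then have "norm (y $ i) = norm (y $ j)" by (rule norms)
        moreover have "poly_eval ?w y = 0" using y L(3) M(2) by blast
        moreover have "poly_eval (poly_var j - 1) y = 0" using y M(3) by blast
        ultimately show False
          using c by (simp add: poly_eval_diff poly_eval_var poly_eval_const_poly_mult poly_eval_one)
      qed
      then have "1 \<in> ?M" using nullstellensatz[OF M(1)] by blast
      then obtain h s where "1 - h * (poly_var j - 1) - s * ?w \<in> I" by blast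
      then show "\<exists>N s. poly_var j ^ N - s * ?w \<in> I" by (rule poly_var_power_in_extension[OF J hom])
    qed
    moreover have "poly_var j \<notin> I" using vanish[of "poly_var j"] zi[of j] by (auto simp: poly_eval_var)
    ultimately show ?thesis by blast
  qed
  then obtain r where r: "\<And>i. poly_var i - const_poly (r i) * poly_var j \<in> I" by metis
  have zr: "z $ i = r i * z $ j" for i
    using vanish[OF r[of i]] by (simp add: poly_eval_diff poly_eval_var poly_eval_const_poly_mult)
  let ?c = "\<chi> i. r i"
  have z_eq: "z = (\<chi> i. z $ j * ?c $ i)" 
    unfolding vec_eq_iff using zr by (metis mult.commute vec_lambda_beta)
  show ?thesis
  proof (rule that[of ?c j])
    show "norm (?c $ i) = 1" for i
      using norms[OF z(1), of i j] zr[of i] zi[of j] by (simp add: norm_mult)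
    show "?c $ j = 1" 
      using zr[of j] zi[of j] by (metis mult_cancel_right1 vec_lambda_beta)
    fix p
    show "p \<in> I \<longleftrightarrow> (\<forall>k. poly_eval (homogeneous_part k p) ?c = 0)"
    proof (intro iffI allI)
      fix k assume "p \<in> I"
      then have "poly_eval (homogeneous_part k p) z = 0" using vanish hom by blast
      then have "(z $ j) ^ k * poly_eval (homogeneous_part k p) ?c = 0"
        by (subst (asm) z_eq) (simp only: poly_eval_homogeneous_part_scale)
      then show "poly_eval (homogeneous_part k p) ?c = 0" using zi[of j] by simp
    next
      assume zero: "\<forall>k. poly_eval (homogeneous_part k p) ?c = 0"
      have "homogeneous_part k p \<in> I" for k
      proof -
        let ?q = "homogeneous_part k p"
        have deg: "mindex_degree \<alpha> = k" if "\<alpha> \<in> Poly_Mapping.keys ?q" for \<alpha>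
          using that by (auto simp: in_keys_iff lookup_homogeneous_part split: if_splits)
        have "(\<Prod>i\<in>UNIV. (const_poly (r i) * poly_var j) ^ Poly_Mapping.lookup \<alpha> i) = const_poly (zpow ?c \<alpha>) * poly_var j ^ mindex_degree \<alpha>"
          for \<alpha>
          by (simp add: power_mult_distrib prod.distrib zpow_def const_poly_prod const_poly_power mindex_degree_def power_sum)
        then have "(\<Sum>\<alpha>\<in>Poly_Mapping.keys ?q. const_poly (Poly_Mapping.lookup ?q \<alpha>) *
            (\<Prod>i\<in>UNIV. (const_poly (r i) * poly_var j) ^ Poly_Mapping.lookup \<alpha> i)) = const_poly (poly_eval ?q ?c) * poly_var j ^ k"
          using deg by (simp add: poly_eval_def const_poly_sum const_poly_mult sum_distrib_right mult.assoc)
        then show ?thesis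
          using substitution_congruence[OF J, of "\<lambda>i. const_poly (r i) * poly_var j" ?q] r zero by simp
      qed
      moreover obtain n where "p = (\<Sum>k\<le>n. homogeneous_part k p)" using sum_homogeneous_parts by metis
      ultimately show "p \<in> I" by (metis poly_idealD(7)[OF J])
    qed
  qed
qed

section \<open>Counting monomials\<close>

definition level :: "nat \<Rightarrow> 'n::finite mindex set" where
  "level k = {\<alpha>. mindex_degree \<alpha> = k}"

lemma finite_level [simp]: "finite (level k :: 'n::finite mindex set)"
proof (rule finite_subset[OF _ mindex_finite_le[of k]])
  have "Poly_Mapping.lookup \<alpha> i \<le> mindex_degree \<alpha>" for \<alpha> :: "'n mindex" and i
    unfolding mindex_degree_def by (rule member_le_sum) auto
  then show "level k \<subseteq> {\<alpha> :: 'n mindex. \<forall>i. Poly_Mapping.lookup \<alpha> i \<le> k}"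
    by (auto simp: level_def)
qed

lemma card_level_0: "card (level 0 :: 'n::finite mindex set) = 1"
proof -
  have "level 0 = {0 :: 'n mindex}"
    by (auto simp: level_def mindex_degree_def intro: poly_mapping_eqI)
  then show ?thesis by simp
qed

text \<open>Both sides count pairs of a variable and a multi-index of degree \<open>k + 1\<close>, weighted by the
  exponent of the variable: directly on the left, and through division by the variable on the
  right.\<close>
lemma card_level_Suc:
  "Suc k * card (level (Suc k) :: 'n::finite mindex set) = (k + CARD('n)) * card (level k :: 'n mindex set)"
proof -
  have "Suc k * card (level (Suc k) :: 'n mindex set) = (\<Sum>\<beta>\<in>level (Suc k). \<Sum>i::'n\<in>UNIV. Poly_Mapping.lookup \<beta> i)"
    by (simp add: level_def flip: mindex_degree_def)
  also have "\<dots> = (\<Sum>i::'n\<in>UNIV. \<Sum>\<beta>\<in>level (Suc k). Poly_Mapping.lookup \<beta> i)" by (rule sum.swap)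
  also have "\<dots> = (\<Sum>i::'n\<in>UNIV. \<Sum>\<alpha>\<in>level k. Suc (Poly_Mapping.lookup \<alpha> i))"
  proof (rule sum.cong)
    fix i :: 'n
    let ?s = "\<lambda>\<alpha> :: 'n mindex. \<alpha> + Poly_Mapping.single i 1"
    have "(\<Sum>\<beta>\<in>?s ` level k. Poly_Mapping.lookup \<beta> i) = (\<Sum>\<beta>\<in>level (Suc k). Poly_Mapping.lookup \<beta> i)"
    proof (rule sum.mono_neutral_left)
      show "?s ` level k \<subseteq> level (Suc k)"
        by (auto simp: level_def mindex_degree_add mindex_degree_single)
      show "\<forall>\<beta>\<in>level (Suc k) - ?s ` level k. Poly_Mapping.lookup \<beta> i = 0"
      proof (rule ballI, rule ccontr)
        fix \<beta> assume \<beta>: "\<beta> \<in> level (Suc k) - ?s ` level k" and nz: "Poly_Mapping.lookup \<beta> i \<noteq> 0"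
        have eq: "\<beta> = ?s (\<beta> - Poly_Mapping.single i 1)"
          using nz by (intro poly_mapping_eqI) (auto simp: lookup_add lookup_minus lookup_single when_def)
        have "mindex_degree \<beta> = Suc (mindex_degree (\<beta> - Poly_Mapping.single i 1))"
          by (subst eq) (simp add: mindex_degree_add mindex_degree_single)
        then have "\<beta> - Poly_Mapping.single i 1 \<in> level k" using \<beta> by (simp add: level_def)
        then show False using \<beta> eq by blast
      qed
    qed simp
    then show "(\<Sum>\<beta>\<in>level (Suc k). Poly_Mapping.lookup \<beta> i) = (\<Sum>\<alpha>\<in>level k. Suc (Poly_Mapping.lookup \<alpha> i))"
      by (subst (asm) sum.reindex) (auto simp: inj_on_def lookup_add)
  qed simp
  also have "\<dots> = (\<Sum>\<alpha>\<in>level k. \<Sum>i::'n\<in>UNIV. Suc (Poly_Mapping.lookup \<alpha> i))" by (rule sum.swap)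
  also have "\<dots> = (\<Sum>\<alpha>\<in>level k. mindex_degree (\<alpha> :: 'n mindex) + CARD('n))"
    by (simp add: mindex_degree_def sum_Suc)
  also have "\<dots> = (k + CARD('n)) * card (level k :: 'n mindex set)" by (simp add: level_def)
  finally show ?thesis .
qed

lemma card_level_pos: "card (level k :: 'n::finite mindex set) > 0"
proof (induction k)
  case (Suc k)
  then have "Suc k * card (level (Suc k) :: 'n mindex set) > 0" unfolding card_level_Suc by simp
  then show ?case by (cases "card (level (Suc k) :: 'n mindex set)") simp_all
qed (simp add: card_level_0)

lemma card_level_mono: "card (level k :: 'n::finite mindex set) \<le> card (level (Suc k) :: 'n mindex set)"
proof -
  have "Suc k * card (level k :: 'n mindex set) \<le> (k + CARD('n)) * card (level k :: 'n mindex set)"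
    by (intro mult_right_mono) (auto simp: Suc_le_eq)
  then show ?thesis unfolding card_level_Suc[symmetric] Suc_mult_le_cancel1 .
qed

lemma card_level_ratio:
  "(\<lambda>k. real (card (level k :: 'n::finite mindex set)) / real (card (level (Suc k) :: 'n mindex set))) \<longlonglongrightarrow> 1"
proof -
  let ?d = "CARD('n)"
  have "real (card (level k :: 'n mindex set)) / real (card (level (Suc k) :: 'n mindex set)) =
      1 - (real ?d - 1) * inverse (real (k + ?d))" for k
  proof -
    have "real (Suc k) * real (card (level (Suc k) :: 'n mindex set)) = real (k + ?d) * real (card (level k :: 'n mindex set))"
      by (simp only: of_nat_mult[symmetric] card_level_Suc)
    then have "real (card (level k :: 'n mindex set)) * real (k + ?d) =
        real (Suc k) * real (card (level (Suc k) :: 'n mindex set))"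
      by (simp only: mult.commute)
    moreover have nz: "real (k + ?d) \<noteq> 0" by (simp only: of_nat_eq_0_iff add_is_0) simp
    moreover have "real (card (level (Suc k) :: 'n mindex set)) \<noteq> 0"
      using card_level_pos[of "Suc k", where ?'n = 'n] by (metis less_numeral_extra(3) of_nat_eq_0_iff)
    ultimately have "real (card (level k :: 'n mindex set)) / real (card (level (Suc k) :: 'n mindex set)) =
        real (Suc k) / real (k + ?d)"
      by (simp only: frac_eq_eq not_False_eq_True)
    also have "real (Suc k) = real (k + ?d) - (real ?d - 1)" by simp
    also have "(real (k + ?d) - (real ?d - 1)) / real (k + ?d) = 1 - (real ?d - 1) * inverse (real (k + ?d))"
      using nz by (simp only: diff_divide_distrib divide_self not_False_eq_True) (simp only: divide_inverse left_diff_distrib)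
    finally show ?thesis .
  qed
  moreover have "(\<lambda>k. 1 - (real ?d - 1) * inverse (real (k + ?d))) \<longlonglongrightarrow> 1 - (real ?d - 1) * 0"
    by (intro tendsto_intros LIMSEQ_ignore_initial_segment[OF lim_inverse_n])
  ultimately show ?thesis by simp
qed

section \<open>The quotient module of a line\<close>

lemma taylor_poly_hardy: "taylor (poly_hardy p) = Poly_Mapping.lookup p"
proof (rule taylor_eqI)
  show "hardy_expansion (hardy_fun (poly_hardy p)) (Poly_Mapping.lookup p)"
    using hardy_expansion_poly[of p] by (simp add: poly_hardy.rep_eq hardy_expansion_def)
qed

definition monomial :: "'n::finite mindex \<Rightarrow> 'n hardy" where
  "monomial \<alpha> = poly_hardy (Poly_Mapping.single \<alpha> 1)"

lemma taylor_monomial: "taylor (monomial \<alpha>) \<beta> = (if \<alpha> = \<beta> then 1 else 0)"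
  by (simp add: monomial_def taylor_poly_hardy lookup_single when_def)

lemma cinner_monomial: "cinner f (monomial \<alpha>) = taylor f \<alpha>"
proof -
  have "cinner f (monomial \<alpha>) = (\<Sum>\<^sub>\<infinity>\<beta>\<in>{\<alpha>}. taylor f \<beta> * cnj (taylor (monomial \<alpha>) \<beta>))"
    unfolding cinner_hardy_def hardy_inner_def by (rule infsum_cong_neutral) (auto simp: taylor_monomial)
  then show ?thesis by (simp add: taylor_monomial)
qed

lemma taylor_cscale: "taylor (x *\<^sub>C f) \<alpha> = x * taylor f \<alpha>"
  by (simp add: scaleC_hardy_def taylor_scaleC)

lemma taylor_sum: "taylor (sum f A) \<alpha> = (\<Sum>x\<in>A. taylor (f x) \<alpha>)"
  by (induction A rule: infinite_finite_induct) (simp_all add: taylor_zero taylor_add)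

lemma poly_hardy_eq_sum:
  assumes "finite A" "Poly_Mapping.keys p \<subseteq> A"
  shows "poly_hardy p = (\<Sum>\<alpha>\<in>A. Poly_Mapping.lookup p \<alpha> *\<^sub>C monomial \<alpha>)"
proof (rule hardy_eqI, rule ext)
  fix \<beta>
  have "taylor (\<Sum>\<alpha>\<in>A. Poly_Mapping.lookup p \<alpha> *\<^sub>C monomial \<alpha>) \<beta> =
      (\<Sum>\<alpha>\<in>A. if \<alpha> = \<beta> then Poly_Mapping.lookup p \<alpha> else 0)"
    unfolding taylor_sum by (rule sum.cong) (auto simp: taylor_cscale taylor_monomial)
  then show "taylor (poly_hardy p) \<beta> = taylor (\<Sum>\<alpha>\<in>A. Poly_Mapping.lookup p \<alpha> *\<^sub>C monomial \<alpha>) \<beta>"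
    using assms by (auto simp: taylor_poly_hardy in_keys_iff)
qed

lemma cinner_poly_hardy:
  assumes "finite A" "Poly_Mapping.keys p \<subseteq> A"
  shows "cinner f (poly_hardy p) = (\<Sum>\<alpha>\<in>A. cnj (Poly_Mapping.lookup p \<alpha>) * taylor f \<alpha>)"
  by (simp add: poly_hardy_eq_sum[OF assms] cinner_sum_right cinner_scaleC_right cinner_monomial)

lemma taylor_coordinate_mult:
  "taylor (coordinate_mult i f) =
    (\<lambda>\<alpha>. if Poly_Mapping.lookup \<alpha> i = 0 then 0 else taylor f (\<alpha> - Poly_Mapping.single i 1))"
  by (rule taylor_eqI)
    (simp add: coordinate_mult.rep_eq hardy_expansion_coordinate[OF hardy_expansion_taylor])

lemma coordinate_mult_add: "coordinate_mult i (f + g) = coordinate_mult i f + coordinate_mult i g"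
  by (rule hardy_eqI) (auto simp: taylor_coordinate_mult taylor_add)

lemma coordinate_mult_scale: "coordinate_mult i (x *\<^sub>C f) = x *\<^sub>C coordinate_mult i f"
  by (rule hardy_eqI) (auto simp: taylor_coordinate_mult taylor_cscale)

lemma coordinate_mult_sum: "coordinate_mult i (sum f A) = (\<Sum>x\<in>A. coordinate_mult i (f x))"
  by (rule hardy_eqI, rule ext) (auto simp: taylor_coordinate_mult taylor_sum)

lemma minus_single_add:
  assumes "Poly_Mapping.lookup \<alpha> i \<noteq> (0::nat)"
  shows "\<alpha> - Poly_Mapping.single i 1 + Poly_Mapping.single i 1 = \<alpha>"
  using assms by (intro poly_mapping_eqI) (auto simp: lookup_add lookup_minus lookup_single when_def)

lemma coordinate_mult_monomial: "coordinate_mult i (monomial \<alpha>) = monomial (\<alpha> + Poly_Mapping.single i 1)"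
proof (rule hardy_eqI, rule ext)
  fix \<beta>
  show "taylor (coordinate_mult i (monomial \<alpha>)) \<beta> = taylor (monomial (\<alpha> + Poly_Mapping.single i 1)) \<beta>"
  proof (cases "Poly_Mapping.lookup \<beta> i = 0")
    case True
    then have "\<alpha> + Poly_Mapping.single i 1 \<noteq> \<beta>" by (auto simp: lookup_add)
    then show ?thesis using True by (simp add: taylor_coordinate_mult taylor_monomial)
  next
    case False
    have "\<alpha> = \<beta> - Poly_Mapping.single i 1 \<longleftrightarrow> \<alpha> + Poly_Mapping.single i 1 = \<beta>"
      using minus_single_add[OF False] by (metis add_right_cancel)
    then show ?thesis using False by (simp add: taylor_coordinate_mult taylor_monomial)
  qed
qed

lemma norm_coordinate_mult: "norm (coordinate_mult i f) = norm f"
proof -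
  let ?s = "\<lambda>\<alpha>. \<alpha> + Poly_Mapping.single i (1::nat)"
  let ?b = "taylor (coordinate_mult i f)"
  have inj: "inj ?s" by (simp add: inj_def)
  have ran: "\<alpha> \<in> range ?s" if "Poly_Mapping.lookup \<alpha> i \<noteq> 0" for \<alpha>
    using minus_single_add[OF that] by (metis rangeI)
  have "inner (coordinate_mult i f) (coordinate_mult i f) = (\<Sum>\<^sub>\<infinity>\<alpha>. (norm (?b \<alpha>))\<^sup>2)"
    by (rule inner_hardy_self)
  also have "\<dots> = (\<Sum>\<^sub>\<infinity>\<alpha>\<in>range ?s. (norm (?b \<alpha>))\<^sup>2)"
    by (rule infsum_cong_neutral) (use ran in \<open>auto simp: taylor_coordinate_mult\<close>)
  also have "\<dots> = (\<Sum>\<^sub>\<infinity>\<alpha>. (norm (?b (?s \<alpha>)))\<^sup>2)"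
    by (simp only: infsum_reindex[OF inj] o_def)
  also have "\<dots> = inner f f"
    by (simp add: inner_hardy_self taylor_coordinate_mult lookup_add)
  finally show ?thesis by (simp add: norm_hardy_def)
qed

lemma mem_quotient_module_iff: "f \<in> quotient_module I \<longleftrightarrow> (\<forall>p\<in>I. cinner f (poly_hardy p) = 0)"
proof
  assume "f \<in> quotient_module I"
  then show "\<forall>p\<in>I. cinner f (poly_hardy p) = 0"
    using closure_subset[of "poly_hardy ` I"]
    by (auto simp: quotient_module_def hardy_submodule_def orth_compl_def)
next
  assume f: "\<forall>p\<in>I. cinner f (poly_hardy p) = 0"
  have "closed (cinner f -` {0})"
    by (intro closed_vimage closed_singleton
        linear_continuous_on bounded_bilinear.bounded_linear_right[OF bounded_bilinear_cinner])
  then have "closure (poly_hardy ` I) \<subseteq> cinner f -` {0}"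
    using f by (intro closure_minimal) auto
  then show "f \<in> quotient_module I"
    by (auto simp: quotient_module_def hardy_submodule_def orth_compl_def)
qed

text \<open>For \<open>c\<close> on the torus, the normalized homogeneous part of degree \<open>k\<close> of the kernel function
  \<open>\<Prod>i. 1 / (1 - cnj (c\<^sub>i) z\<^sub>i)\<close> at \<open>c\<close>: the inner product of a form of degree \<open>k\<close> with it is the value
  of the form at \<open>c\<close>, divided by \<open>sqrt (card (level k))\<close>.\<close>
definition level_vector :: "complex ^ 'n::finite \<Rightarrow> nat \<Rightarrow> 'n hardy" where
  "level_vector c k =
    (\<Sum>\<alpha>\<in>level k. (cnj (zpow c \<alpha>) / of_real (sqrt (card (level k :: 'n mindex set)))) *\<^sub>C monomial \<alpha>)"

lemma taylor_level_vector:
  fixes c :: "complex ^ 'n::finite"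
  shows "taylor (level_vector c k) \<beta> =
    (if mindex_degree \<beta> = k then cnj (zpow c \<beta>) / of_real (sqrt (card (level k :: 'n mindex set))) else 0)"
proof -
  have "taylor (level_vector c k) \<beta> = (\<Sum>\<alpha>\<in>level k.
      if \<alpha> = \<beta> then cnj (zpow c \<beta>) / of_real (sqrt (card (level k :: 'n mindex set))) else 0)"
    unfolding level_vector_def taylor_sum by (rule sum.cong) (auto simp: taylor_cscale taylor_monomial)
  also have "\<dots> = (if \<beta> \<in> level k then cnj (zpow c \<beta>) / of_real (sqrt (card (level k :: 'n mindex set))) else 0)"
    by simp
  finally show ?thesis by (simp only: level_def mem_Collect_eq)
qed

lemma cinner_level_vector:
  fixes c :: "complex ^ 'n::finite"
  shows "cinner f (level_vector c k) =
    (\<Sum>\<alpha>\<in>level k. zpow c \<alpha> * taylor f \<alpha>) / of_real (sqrt (card (level k :: 'n mindex set)))"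
  by (simp add: level_vector_def cinner_sum_right cinner_scaleC_right cinner_monomial sum_divide_distrib)

text \<open>The ideal of all polynomials that vanish on a line through \<open>0\<close> and a point of the torus.\<close>
locale torus_line =
  fixes I :: "'n::finite cpoly set" and c :: "complex ^ 'n"
  assumes c: "norm (c $ i) = 1"
    and mem: "p \<in> I \<longleftrightarrow> (\<forall>k. poly_eval (homogeneous_part k p) c = 0)"
begin

definition N :: "nat \<Rightarrow> real" where
  "N k = real (card (level k :: 'n mindex set))"

lemma N_pos: "N k > 0"
  by (simp only: N_def of_nat_0_less_iff card_level_pos)

lemma taylor_level:
  "taylor (level_vector c k) \<beta> = (if mindex_degree \<beta> = k then cnj (zpow c \<beta>) / of_real (sqrt (N k)) else 0)"
  by (simp add: taylor_level_vector N_def)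

lemma cinner_level:
  "cinner f (level_vector c k) = (\<Sum>\<alpha>\<in>level k. zpow c \<alpha> * taylor f \<alpha>) / of_real (sqrt (N k))"
  by (simp add: cinner_level_vector N_def)

lemma sqrt_N: "complex_of_real (sqrt (N k)) \<noteq> 0" "complex_of_real (sqrt (N k)) * of_real (sqrt (N k)) = of_real (N k)"
proof -
  show "complex_of_real (sqrt (N k)) \<noteq> 0" using N_pos[of k] by simp
  have "sqrt (N k) * sqrt (N k) = N k" using N_pos[of k] by simp
  then show "complex_of_real (sqrt (N k)) * of_real (sqrt (N k)) = of_real (N k)" by (metis of_real_mult)
qed

lemma zpow_cnj: "zpow c \<alpha> * cnj (zpow c \<alpha>) = 1"
proof -
  have "norm (zpow c \<alpha>) = 1" by (simp add: zpow_def prod_norm[symmetric] norm_power c)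
  then show ?thesis by (simp add: complex_norm_square[symmetric])
qed

lemma level_vector_mem: "level_vector c k \<in> quotient_module I"
  unfolding mem_quotient_module_iff
proof
  fix p assume "p \<in> I"
  let ?A = "Poly_Mapping.keys p \<union> level k" and ?s = "complex_of_real (sqrt (N k))"
  have "cinner (level_vector c k) (poly_hardy p) = (\<Sum>\<alpha>\<in>?A. cnj (Poly_Mapping.lookup p \<alpha>) * taylor (level_vector c k) \<alpha>)"
    by (rule cinner_poly_hardy) auto
  also have "\<dots> = (\<Sum>\<alpha>\<in>?A. cnj (Poly_Mapping.lookup (homogeneous_part k p) \<alpha> * zpow c \<alpha>) / ?s)"
    by (rule sum.cong) (auto simp: taylor_level lookup_homogeneous_part)
  also have "\<dots> = cnj (\<Sum>\<alpha>\<in>?A. Poly_Mapping.lookup (homogeneous_part k p) \<alpha> * zpow c \<alpha>) / ?s"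
    by (simp only: cnj_sum sum_divide_distrib)
  also have "(\<Sum>\<alpha>\<in>?A. Poly_Mapping.lookup (homogeneous_part k p) \<alpha> * zpow c \<alpha>) = poly_eval (homogeneous_part k p) c"
    by (rule poly_eval_superset[symmetric]) (auto simp: in_keys_iff lookup_homogeneous_part split: if_splits)
  finally show "cinner (level_vector c k) (poly_hardy p) = 0" using \<open>p \<in> I\<close> mem by simp
qed

lemma orthonormal: "cinner (level_vector c j) (level_vector c k) = (if j = k then 1 else 0)"
proof -
  have "(\<Sum>\<alpha>\<in>level k. zpow c \<alpha> * taylor (level_vector c j) \<alpha>) =
      (\<Sum>\<alpha>\<in>(level k :: 'n mindex set). if j = k then 1 / complex_of_real (sqrt (N k)) else 0)"
    by (rule sum.cong) (auto simp: taylor_level level_def zpow_cnj)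
  then show ?thesis using sqrt_N[of k] by (auto simp: cinner_level N_def)
qed

lemma total:
  assumes f: "f \<in> quotient_module I" and orth: "\<And>k. cinner f (level_vector c k) = 0"
  shows "f = 0"
proof (rule hardy_eqI, rule ext)
  \<comment> \<open>The monomial of \<open>\<alpha>\<close>, corrected by a multiple of \<open>level_vector c k\<close> so as to vanish at \<open>c\<close>,
    lies in \<open>I\<close>; pairing \<open>f\<close> with it isolates one coefficient of \<open>f\<close>.\<close>
  fix \<alpha> :: "'n mindex"
  define k where "k = mindex_degree \<alpha>"
  let ?A = "level k :: 'n mindex set"
  have \<alpha>: "\<alpha> \<in> ?A" by (simp add: level_def k_def)
  define p where "p = Poly_Mapping.single \<alpha> 1 -
    (\<Sum>\<beta>\<in>?A. Poly_Mapping.single \<beta> (zpow c \<alpha> * cnj (zpow c \<beta>) / of_real (N k)))"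
  have lookup_p: "Poly_Mapping.lookup p \<beta> =
      (if \<beta> = \<alpha> then 1 else 0) - (if \<beta> \<in> ?A then zpow c \<alpha> * cnj (zpow c \<beta>) / of_real (N k) else 0)" for \<beta>
    unfolding p_def lookup_minus lookup_sum
    by (auto simp: lookup_single when_def)
  have keys: "Poly_Mapping.keys p \<subseteq> ?A" using \<alpha> by (auto simp: in_keys_iff lookup_p split: if_splits)
  have eval0: "poly_eval p c = 0"
  proof -
    have "poly_eval p c = (\<Sum>\<beta>\<in>?A. (if \<beta> = \<alpha> then zpow c \<alpha> else 0) - zpow c \<alpha> / of_real (N k))"
      unfolding poly_eval_superset[OF finite_level keys]
    proof (rule sum.cong)
      fix \<beta> assume "\<beta> \<in> ?A"
      have "zpow c \<alpha> * cnj (zpow c \<beta>) / of_real (N k) * zpow c \<beta> =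
          zpow c \<alpha> * (zpow c \<beta> * cnj (zpow c \<beta>)) / of_real (N k)"
        by (simp add: mult_ac)
      also have "\<dots> = zpow c \<alpha> / of_real (N k)" by (simp only: zpow_cnj mult_1_right)
      finally have eq: "zpow c \<alpha> * cnj (zpow c \<beta>) / of_real (N k) * zpow c \<beta> = zpow c \<alpha> / of_real (N k)" .
      show "Poly_Mapping.lookup p \<beta> * zpow c \<beta> =
          (if \<beta> = \<alpha> then zpow c \<alpha> else 0) - zpow c \<alpha> / of_real (N k)"
        using \<open>\<beta> \<in> ?A\<close> by (simp only: lookup_p if_True left_diff_distrib eq) simp
    qed simp
    also have "\<dots> = zpow c \<alpha> - of_real (N k) * (zpow c \<alpha> / of_real (N k))"
      using \<alpha> by (simp add: sum_subtractf N_def)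
    also have "\<dots> = 0" using N_pos[of k] by simp
    finally show ?thesis .
  qed
  have "p \<in> I"
    unfolding mem
  proof
    fix l
    show "poly_eval (homogeneous_part l p) c = 0"
    proof (cases "l = k")
      case True
      have "homogeneous_part l p = p"
        by (rule poly_mapping_eqI) (use keys in \<open>auto simp: lookup_homogeneous_part in_keys_iff level_def True\<close>)
      then show ?thesis using eval0 by simp
    next
      case False
      have "homogeneous_part l p = 0"
        by (rule poly_mapping_eqI) (use keys False in \<open>auto simp: lookup_homogeneous_part in_keys_iff level_def\<close>)
      then show ?thesis by (simp add: poly_eval_def)
    qed
  qed
  then have "cinner f (poly_hardy p) = 0" using f mem_quotient_module_iff by blast
  then have "0 = (\<Sum>\<beta>\<in>?A. cnj (Poly_Mapping.lookup p \<beta>) * taylor f \<beta>)"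
    by (simp only: cinner_poly_hardy[OF finite_level keys])
  also have "\<dots> = (\<Sum>\<beta>\<in>?A. (if \<beta> = \<alpha> then taylor f \<alpha> else 0) -
      cnj (zpow c \<alpha>) / of_real (N k) * (zpow c \<beta> * taylor f \<beta>))"
    by (rule sum.cong) (auto simp: lookup_p left_diff_distrib)
  also have "\<dots> = taylor f \<alpha> - cnj (zpow c \<alpha>) / of_real (N k) * (\<Sum>\<beta>\<in>?A. zpow c \<beta> * taylor f \<beta>)"
    using \<alpha> by (simp add: sum_subtractf sum_distrib_left)
  also have "(\<Sum>\<beta>\<in>?A. zpow c \<beta> * taylor f \<beta>) = 0"
    using orth[of k] sqrt_N(1)[of k] unfolding cinner_level by (simp only: divide_eq_0_iff) simp
  finally show "taylor f \<alpha> = taylor 0 \<alpha>" by (simp add: taylor_zero)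
qed

sublocale orthonormal_basis "quotient_module I" "level_vector c"
proof
  show "closed_csubspace (quotient_module I)"
    unfolding quotient_module_def by (rule closed_csubspace_orth_compl)
qed (rule level_vector_mem orthonormal total; assumption)+

lemma compressed_shift_bounded: "compressed_shift I i \<in> bounded_ops (quotient_module I)"
  unfolding compressed_shift_def
  by (rule compression_bounded[where C = 1])
    (simp_all add: coordinate_mult_add coordinate_mult_scale norm_coordinate_mult)

text \<open>A coordinate moves the monomials of degree \<open>k\<close> injectively into degree \<open>k + 1\<close> and multiplies
  their values at \<open>c\<close> by \<open>c $ i\<close>.  The projection only sees the inner product with
  \<open>level_vector c (k + 1)\<close>, to which the \<open>N k\<close> monomials contribute equally.\<close>
lemma compressed_shift_basis:
  "compressed_shift I i (level_vector c k) =
    (c $ i * of_real (sqrt (N k / N (Suc k)))) *\<^sub>C level_vector c (Suc k)"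
proof -
  let ?x = "orth_proj (quotient_module I) (coordinate_mult i (level_vector c k))"
  have "?x = (c $ i * of_real (sqrt (N k / N (Suc k)))) *\<^sub>C level_vector c (Suc k)"
  proof (rule eqI)
    show "?x \<in> quotient_module I" by (rule orth_proj)
    show "(c $ i * of_real (sqrt (N k / N (Suc k)))) *\<^sub>C level_vector c (Suc k) \<in> quotient_module I"
      by (intro csubspaceD[OF K] level_vector_mem)
    fix m
    let ?sk = "complex_of_real (sqrt (N k))" and ?sm = "complex_of_real (sqrt (N m))"
    have "coordinate_mult i (level_vector c k) =
        (\<Sum>\<alpha>\<in>level k. (cnj (zpow c \<alpha>) / ?sk) *\<^sub>C monomial (\<alpha> + Poly_Mapping.single i 1))"
      by (simp add: level_vector_def N_def coordinate_mult_sum coordinate_mult_scale coordinate_mult_monomial)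
    then have "cinner ?x (level_vector c m) =
        (\<Sum>\<alpha>\<in>level k. cnj (zpow c \<alpha>) / ?sk * cinner (monomial (\<alpha> + Poly_Mapping.single i 1)) (level_vector c m))"
      by (simp add: orth_proj level_vector_mem cinner_sum_left cinner_scaleC_left)
    also have "\<dots> = (\<Sum>\<alpha>\<in>(level k :: 'n mindex set). if m = Suc k then c $ i / (?sk * ?sm) else 0)"
    proof (rule sum.cong)
      fix \<alpha> :: "'n mindex" assume \<alpha>: "\<alpha> \<in> level k"
      let ?\<beta> = "\<alpha> + Poly_Mapping.single i 1"
      have "cinner (monomial ?\<beta>) (level_vector c m) = cnj (taylor (level_vector c m) ?\<beta>)"
        by (subst cinner_commute) (simp only: cinner_monomial)
      also have "\<dots> = (if m = Suc k then zpow c \<alpha> * c $ i / ?sm else 0)"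
        using \<alpha> by (auto simp: taylor_level mindex_degree_add mindex_degree_single level_def zpow_add
            zpow_single[of c i, unfolded One_nat_def])
      finally have "cnj (zpow c \<alpha>) / ?sk * cinner (monomial ?\<beta>) (level_vector c m) =
          (if m = Suc k then (zpow c \<alpha> * cnj (zpow c \<alpha>)) * (c $ i / (?sk * ?sm)) else 0)"
        by (simp add: mult_ac)
      then show "cnj (zpow c \<alpha>) / ?sk * cinner (monomial ?\<beta>) (level_vector c m) =
          (if m = Suc k then c $ i / (?sk * ?sm) else 0)"
        by (simp only: zpow_cnj mult_1_left)
    qed simp
    also have "\<dots> = (if m = Suc k then c $ i * of_real (sqrt (N k / N (Suc k))) else 0)"
    proof -
      have "of_real (N k) * (c $ i / (?sk * complex_of_real (sqrt (N (Suc k))))) =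
          c $ i * (?sk / complex_of_real (sqrt (N (Suc k))))"
        unfolding sqrt_N(2)[of k, symmetric] using sqrt_N(1)[of k] by simp
      then show ?thesis by (simp add: real_sqrt_divide N_def)
    qed
    also have "\<dots> = cinner ((c $ i * of_real (sqrt (N k / N (Suc k)))) *\<^sub>C level_vector c (Suc k)) (level_vector c m)"
      by (auto simp: cinner_scaleC_left orthonormal)
    finally show "cinner ?x (level_vector c m) =
      cinner ((c $ i * of_real (sqrt (N k / N (Suc k)))) *\<^sub>C level_vector c (Suc k)) (level_vector c m)" .
  qed
  then show ?thesis by (simp add: compressed_shift_def compression_def level_vector_mem)
qed

lemma compressed_shifts_commute:
  assumes "x \<in> quotient_module I"
  shows "compressed_shift I i (compressed_shift I j x) = compressed_shift I j (compressed_shift I i x)"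
proof -
  let ?K = "quotient_module I" and ?S = "compressed_shift I"
  have "op_mult ?K (?S i) (?S j) = op_mult ?K (?S j) (?S i)"
    by (rule op_eq_on_basisI[OF op_mult_bounded[OF K compressed_shift_bounded compressed_shift_bounded]
          op_mult_bounded[OF K compressed_shift_bounded compressed_shift_bounded]])
      (simp add: op_mult_def level_vector_mem
        compressed_shift_basis bounded_opsD[OF compressed_shift_bounded] cinner_scaleC_left)
  from fun_cong[OF this, of x] show ?thesis using assms by (simp add: op_mult_def)
qed

end

section \<open>The identity representation\<close>

theorem proposition4p7:
  fixes I :: "'n::finite cpoly set"
  assumes "CARD('n) \<ge> 3"
    and "primeideal I poly_ring"
    and "homogeneous_ideal I"
    and "distinguished_variety (zero_locus I)"
  shows "\<not> boundary_representation (quotient_module I) (quotient_algebra I)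
           (quotient_module I) (\<lambda>T\<in>quotient_cstar I. T)"
proof -
  obtain c :: "complex ^ 'n" and j where norm_c: "\<And>i. norm (c $ i) = 1" and c_j: "c $ j = 1"
    and mem: "\<And>p. p \<in> I \<longleftrightarrow> (\<forall>k. poly_eval (homogeneous_part k p) c = 0)"
    using prime_distinguished_ideal[OF prime_poly_idealI[OF assms(2)] assms(3,4)] by blast
  interpret torus_line I c by unfold_locales (rule norm_c mem)+
  interpret weighted_shift "quotient_module I" "level_vector c" N "compressed_shift I j"
  proof
    show "0 < N k" for k by (rule N_pos)
    show "N k \<le> N (Suc k)" for k by (simp only: N_def of_nat_le_iff card_level_mono)
    show "(\<lambda>k. N k / N (Suc k)) \<longlonglongrightarrow> 1" unfolding N_def by (rule card_level_ratio)
    show "compressed_shift I j \<in> bounded_ops (quotient_module I)" by (rule compressed_shift_bounded)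
    show "compressed_shift I j (level_vector c k) =
        of_real (sqrt (N k / N (Suc k))) *\<^sub>C level_vector c (Suc k)" for k
      by (simp add: compressed_shift_basis c_j)
  qed
  have "N 0 < N 1"
    using assms(1) card_level_Suc[of 0, where ?'n = 'n] by (simp add: N_def card_level_0)
  then show ?thesis
    unfolding quotient_algebra_def quotient_cstar_def
    by (intro identity_not_boundary) (auto simp: compressed_shift_bounded compressed_shifts_commute)
qed

end
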